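(* Let $X,Y,K,f,G$ and the local solution $x_\ast$ with associated multiplier $\lambda_\ast\in\Lambda(x_\ast)$ satisfy assumptions (A1)--(A5) listed in the context. Then for any $\sigma_0>0$ large enough, there exist positive constants $\sigma_1,\delta,\overline{\beta}$ such that all of the following hold: (T1) $\sigma_0\delta\le\sigma_1$. (T2) There exists $r_0>0$ such that for all $(x_0,\lambda_0)\in\mathcal{B}_{r_0}\big((x_\ast,\lambda_\ast)\big)$, the sequence $\big((x_k,\lambda_k)\big)_{k\in\mathbb{N}}$ of solutions to the inclusion problems $\mathrm{IP}(\rho_k,p_k)$ with $p_k=(x_k,\lambda_k,\lambda_k)$ (that is, $(x_{k+1},\lambda_{k+1})$ is the solution of $\mathrm{IP}(\rho_k,p_k)$ for each $k=0,1,2,\ldots$) is contained in $\mathcal{B}_\delta\big((x_\ast,\lambda_\ast)\big)$. In particular, each $x_{k+1}$ is a local minimizer of the stabilized subproblem $\min_{x\in X}\max_{\lambda\in K^\circ}L_k(x,\lambda)$ (i.e. a local minimizer of $x\mapsto\max_{\lambda\in K^\circ}L_k(x,\lambda)$), and $\lambda_{k+1}$ is the unique maximizer of $L_k(x_{k+1},\cdot)$ over $K^\circ$. Here $\rho_k>0$ is an arbitrary constant that fulfills $$\sigma_0\Vert x_k-x_\ast\Vert_X\le\rho_k\le\sigma_1 .$$ (T3) For each $k\in\mathbb{N}$ there exists $\widehat{\lambda}_k\in\operatorname{argmin}\{\Vert\lambda_k-\lambda\Vert_{Y^\ast}:\lambda\in\Lambda(x_\ast)\}$, and we have $$\Vert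 x_{k+1}-x_\ast\Vert_X+\Vert\lambda_{k+1}-\widehat{\lambda}_{k+1}\Vert_{Y^\ast}\le\overline{\beta}\Big(\Vert x_k-x_\ast\Vert_X^2+\Vert\lambda_k-\widehat{\lambda}_k\Vert_{Y^\ast}^2+\rho_k\Vert\lambda_k-\widehat{\lambda}_k\Vert_{Y^\ast}\Big).$$
   Context: Problem: minimize $f(x)$ over $x\in X$ subject to $G(x)\in K\subseteq Y$, where $f:X\to\mathbb{R}$, $G:X\to Y$. $X^\ast,Y^\ast$ are the dual spaces, $\langle\cdot,\cdot\rangle$ the duality pairings, $A^\ast\in\mathfrak{L}(Y^\ast,X^\ast)$ the adjoint of a bounded linear operator $A\in\mathfrak{L}(X,Y)$, $\mathcal{N}(A)$ its kernel, $\mathfrak{F}(X,Y)$ the set of Fredholm operators from $X$ to $Y$, and $\mathfrak{R}:Y^\ast\to Y$ the Riesz isomorphism, $(\mathfrak{R}\lambda,y)_Y=\langle\lambda,y\rangle_{Y^\ast,Y}$. The polar cone is $K^\circ=\{y^\ast\in Y^\ast:\langle y^\ast,y\rangle\le0\ \forall y\in K\}$, and for $\lambda\in Y^\ast$ we write $\{\lambda\}^{\mathrm{An}}=\{y\in Y:\langle\lambda,y\rangle_{Y^\ast,Y}=0\}$. $\mathcal{B}_r(\cdot)$ denotes the ball of radius $r$; product spaces carry the sum of the norms. The Lagrangian is $\mathcal{L}(x,\lambda)=f(x)+\langle\lambda,G(x)\rangle_{Y^\ast,Y}$, with first and second Fréchet derivatives in $x$ denoted $\mathcal{L}'_x,\mathcal{L}''_{xx}$.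 Multiplier set: $\Lambda(x_\ast)=\{\lambda\in K^\circ: f'(x_\ast)+G'(x_\ast)^\ast\lambda=0,\ \langle\lambda,G(x_\ast)\rangle=0\}$. Assumptions: (A1) $X$ and $Y$ are real Hilbert spaces. (A2) $K\subseteq Y$ is a finitely spanned closed convex cone: there are $y_1,\dots,y_m\in Y$ with $K=\{\sum_{i=1}^m\mu_iy_i:\mu_i\ge0\}$. (A3) $f$ and $G$ are (locally) twice Lipschitz continuously Fréchet differentiable (twice Fréchet differentiable with locally Lipschitz second derivatives). (A4) $x_\ast$ is a local solution of the problem, $G'(x_\ast)\in\mathfrak{F}(X,Y)$ and $G(x_\ast)=0$. (A5) For the associated multiplier $\lambda_\ast\in\Lambda(x_\ast)$ there is $\alpha>0$ with $\langle\mathcal{L}''_{xx}(x_\ast,\lambda_\ast)d,d\rangle_{X^\ast,X}\ge\alpha\Vert d\Vert_X^2$ for all $d\in\mathcal{N}(G'(x_\ast))\cup\{d\in X:G'(x_\ast)d\in\operatorname{span}\{y_1,\dots,y_m\}\}$. Stabilized subproblem: given $x_k,\lambda_k$ and $\rho_k>0$, $$L_k(x,\lambda)=\langle f'(x_k),x-x_k\rangle+\tfrac12\langle\mathcal{L}''_{xx}(x_k,\lambda_k)(x-x_k),x-x_k\rangle+\langle\lambda,G(x_k)+G'(x_k)(x-x_k)\rangle-\tfrac{\rho_k}{2}\Vert\lambda-\lambda_k\Vert_{Y^\ast}^2 .$$ Inclusion problem $\mathrm{IP}(\rho,p)$: for $\rho>0$ and $p=(\underline{x},\underline{\lambda}_1,\underline{\lambda}_2)\in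 X\times Y^\ast\times Y^\ast$, find $(x,\lambda)\in X\times Y^\ast$ with $\lambda\in K^\circ$ such that $$\mathcal{L}'_x(\underline{x},\lambda)+\mathcal{L}''_{xx}(\underline{x},\underline{\lambda}_1)(x-\underline{x})=0,\qquad G(\underline{x})+G'(\underline{x})(x-\underline{x})-\rho\,\mathfrak{R}(\lambda-\underline{\lambda}_2)\in K\cap\{\lambda\}^{\mathrm{An}} .$$ *)

theory Defs
  imports "HOL-Analysis.Analysis"
begin

text \<open>The dual of a normed space \<open>'a\<close> is the type \<open>'a \<Rightarrow>\<^sub>L real\<close> with its operator norm, the duality
  pairing of \<open>l\<close> and \<open>y\<close> is \<open>blinfun_apply l y\<close>, and the adjoint of \<open>A\<close> maps \<open>l\<close> to \<open>l o\<^sub>L A\<close>.\<close>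

text \<open>The Frechet derivative as a bounded operator. It is meaningful only at points where \<open>g\<close> is
  differentiable.\<close>
definition fderiv :: "('a::real_normed_vector \<Rightarrow> 'b::real_normed_vector) \<Rightarrow> 'a \<Rightarrow> ('a \<Rightarrow>\<^sub>L 'b)"
  where "fderiv g x = Blinfun (frechet_derivative g (at x))"

definition locally_lipschitz :: "('a::metric_space \<Rightarrow> 'b::metric_space) \<Rightarrow> bool"
  where "locally_lipschitz g \<longleftrightarrow> (\<forall>x. \<exists>r>0. \<exists>C. C-lipschitz_on (ball x r) g)"

definition twice_lipschitz_differentiable ::
  "('a::real_normed_vector \<Rightarrow> 'b::real_normed_vector) \<Rightarrow> bool"
  where "twice_lipschitz_differentiable g \<longleftrightarrow>
    (\<forall>x. g differentiable (at x)) \<and> (\<forall>x. fderiv g differentiable (at x)) \<and>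
    locally_lipschitz (fderiv (fderiv g))"

definition fredholm :: "('a::real_normed_vector \<Rightarrow>\<^sub>L 'b::real_normed_vector) \<Rightarrow> bool"
  where "fredholm A \<longleftrightarrow>
    (\<exists>B. finite B \<and> span B = {d. blinfun_apply A d = 0}) \<and>
    closed (range (blinfun_apply A)) \<and>
    (\<exists>C. finite C \<and> span (range (blinfun_apply A) \<union> C) = UNIV)"

text \<open>The representer exists and is unique by the Riesz theorem when \<open>'y\<close> is complete.\<close>
definition riesz :: "('y::real_inner \<Rightarrow>\<^sub>L real) \<Rightarrow> 'y"
  where "riesz l = (THE u. \<forall>y. inner u y = blinfun_apply l y)"

definition polar_cone :: "'y::real_normed_vector set \<Rightarrow> ('y \<Rightarrow>\<^sub>L real) set"
  where "polar_cone K = {l. \<forall>y\<in>K. blinfun_apply l y \<le> 0}"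

definition annihilator :: "('y::real_normed_vector \<Rightarrow>\<^sub>L real) \<Rightarrow> 'y set"
  where "annihilator l = {y. blinfun_apply l y = 0}"

text \<open>Balls of the product space for the sum of the norms; the library norm on pairs is the
  Euclidean one.\<close>
definition sum_ball :: "'a::real_normed_vector \<times> 'b::real_normed_vector \<Rightarrow> real \<Rightarrow> ('a \<times> 'b) set"
  where "sum_ball c r = {p. norm (fst p - fst c) + norm (snd p - snd c) < r}"

definition local_solution ::
  "('x::real_normed_vector \<Rightarrow> real) \<Rightarrow> ('x \<Rightarrow> 'y) \<Rightarrow> 'y set \<Rightarrow> 'x \<Rightarrow> bool"
  where "local_solution f G K xs \<longleftrightarrow>
    G xs \<in> K \<and> (\<exists>e>0. \<forall>x\<in>ball xs e. G x \<in> K \<longrightarrow> f xs \<le> f x)"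

definition lagrangian ::
  "('x \<Rightarrow> real) \<Rightarrow> ('x \<Rightarrow> 'y::real_normed_vector) \<Rightarrow> 'x \<Rightarrow> ('y \<Rightarrow>\<^sub>L real) \<Rightarrow> real"
  where "lagrangian f G x l = f x + blinfun_apply l (G x)"

definition lagrangian_x ::
  "('x::real_normed_vector \<Rightarrow> real) \<Rightarrow> ('x \<Rightarrow> 'y::real_normed_vector) \<Rightarrow> 'x \<Rightarrow> ('y \<Rightarrow>\<^sub>L real)
    \<Rightarrow> ('x \<Rightarrow>\<^sub>L real)"
  where "lagrangian_x f G x l = fderiv (\<lambda>z. lagrangian f G z l) x"

definition lagrangian_xx ::
  "('x::real_normed_vector \<Rightarrow> real) \<Rightarrow> ('x \<Rightarrow> 'y::real_normed_vector) \<Rightarrow> 'x \<Rightarrow> ('y \<Rightarrow>\<^sub>L real)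
    \<Rightarrow> ('x \<Rightarrow>\<^sub>L ('x \<Rightarrow>\<^sub>L real))"
  where "lagrangian_xx f G x l = fderiv (\<lambda>z. lagrangian_x f G z l) x"

definition multipliers ::
  "('x::real_normed_vector \<Rightarrow> real) \<Rightarrow> ('x \<Rightarrow> 'y::real_normed_vector) \<Rightarrow> 'y set \<Rightarrow> 'x
    \<Rightarrow> ('y \<Rightarrow>\<^sub>L real) set"
  where "multipliers f G K xs =
    {l \<in> polar_cone K. fderiv f xs + (l o\<^sub>L fderiv G xs) = 0 \<and> blinfun_apply l (G xs) = 0}"

text \<open>\<open>subproblem_fun f G xk lk \<rho>\<close> is the function \<open>L\<^sub>k\<close> of the stabilized subproblem.\<close>
definition subproblem_fun ::
  "('x::real_normed_vector \<Rightarrow> real) \<Rightarrow> ('x \<Rightarrow> 'y::real_normed_vector) \<Rightarrow> 'x \<Rightarrow> ('y \<Rightarrow>\<^sub>L real) \<Rightarrow> real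
    \<Rightarrow> 'x \<Rightarrow> ('y \<Rightarrow>\<^sub>L real) \<Rightarrow> real"
  where "subproblem_fun f G xk lk \<rho> x l =
    blinfun_apply (fderiv f xk) (x - xk)
    + 1/2 * blinfun_apply (blinfun_apply (lagrangian_xx f G xk lk) (x - xk)) (x - xk)
    + blinfun_apply l (G xk + blinfun_apply (fderiv G xk) (x - xk))
    - \<rho>/2 * (norm (l - lk))\<^sup>2"

text \<open>Local minimizers of \<open>x \<mapsto> max\<^bsub>l \<in> S\<^esub> L x l\<close>. The first conjunct says that the maxima are
  attained, so that the suprema in the second conjunct are these maxima.\<close>
definition local_minimizer_of_max :: "('x::metric_space \<Rightarrow> 'l \<Rightarrow> real) \<Rightarrow> 'l set \<Rightarrow> 'x \<Rightarrow> bool"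
  where "local_minimizer_of_max L S x \<longleftrightarrow>
    (\<forall>z. \<exists>l. is_arg_max (L z) (\<lambda>l. l \<in> S) l) \<and>
    (\<exists>e>0. \<forall>z\<in>ball x e. (SUP l\<in>S. L x l) \<le> (SUP l\<in>S. L z l))"

definition unique_maximizer :: "('l \<Rightarrow> real) \<Rightarrow> 'l set \<Rightarrow> 'l \<Rightarrow> bool"
  where "unique_maximizer h S l \<longleftrightarrow> (\<forall>l'. is_arg_max h (\<lambda>l. l \<in> S) l' \<longleftrightarrow> l' = l)"

text \<open>\<open>(x, l)\<close> solves \<open>IP(\<rho>, (xu, l1, l2))\<close>.\<close>
definition IP_solution ::
  "('x::real_normed_vector \<Rightarrow> real) \<Rightarrow> ('x \<Rightarrow> 'y::real_inner) \<Rightarrow> 'y set \<Rightarrow> real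
    \<Rightarrow> 'x \<times> ('y \<Rightarrow>\<^sub>L real) \<times> ('y \<Rightarrow>\<^sub>L real) \<Rightarrow> 'x \<times> ('y \<Rightarrow>\<^sub>L real) \<Rightarrow> bool"
  where "IP_solution f G K \<rho> = (\<lambda>(xu, l1, l2) (x, l).
    l \<in> polar_cone K \<and>
    lagrangian_x f G xu l + blinfun_apply (lagrangian_xx f G xu l1) (x - xu) = 0 \<and>
    G xu + blinfun_apply (fderiv G xu) (x - xu) - \<rho> *\<^sub>R riesz (l - l2) \<in> K \<inter> annihilator l)"

definition admissible_parameter :: "real \<Rightarrow> real \<Rightarrow> 'x::real_normed_vector \<Rightarrow> 'x \<Rightarrow> real \<Rightarrow> bool"
  where "admissible_parameter \<sigma>0 \<sigma>1 xs xk \<rho> \<longleftrightarrow>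
    \<rho> > 0 \<and> \<sigma>0 * norm (xk - xs) \<le> \<rho> \<and> \<rho> \<le> \<sigma>1"

end

theory Submission
  imports Defs
begin

text \<open>Let \<open>S\<close> be the span of the generators of \<open>K\<close> and \<open>Q\<close> the orthogonal projection onto the
  complement of \<open>S\<close>. Since \<open>K \<subseteq> S\<close>, every functional that vanishes on \<open>S\<close> lies in the polar
  cone, so in the subproblem the multiplier may move freely along the complement of \<open>S\<close>, and
  maximizing over these directions adds the penalty \<open>norm (Q (G'(x\<^sub>k) d))\<^sup>2 / \<rho>\<close> to the curvature
  \<open>L''(x\<^sub>k, \<lambda>\<^sub>k) d d\<close>. The second-order condition says that the curvature at the solution is coercive
  on the kernel of \<open>Q \<circ> G'(x\<^sub>*)\<close>. This operator has closed range because \<open>G'(x\<^sub>*)\<close> is Fredholm and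
  \<open>S\<close> has finite dimension, so curvature plus a large multiple of the penalty is coercive on the
  whole space, and it stays so under small changes of the operators
  (\<open>coercive_with_penalty_stable\<close>). Hence for small \<open>\<rho>\<close> the inclusion problem, written as one
  equation in \<open>x\<close> by expressing the multiplier as a projection onto the polar cone, is a globally
  strongly monotone Lipschitz equation. It has exactly one solution, and this solution globally
  minimizes the max-function of the subproblem (locale \<open>stabilized_subproblem\<close>).

  The rate comes from two estimates, both obtained by testing the linearized Karush-Kuhn-Tucker
  system with the primal error \<open>x\<^sub>k\<^sub>+\<^sub>1 - x\<^sub>*\<close> and using that the multiplier and the cone element are
  complementary. Write \<open>e\<close> for \<open>norm (x\<^sub>k - x\<^sub>*)\<close> and \<open>d\<close> for the distance of \<open>\<lambda>\<^sub>k\<close> from the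
  multiplier set. The first estimate (\<open>a_priori_multiplier_estimate\<close>) bounds the multiplier step: \<open>\<rho>\<close>
  times the step is of order \<open>e\<^sup>2 + \<rho> d\<close>. Here the lower bound on \<open>\<rho>\<close> by a multiple of \<open>e\<close> enters: it
  absorbs the mixed term \<open>e d\<close> and shows that the step itself is of order \<open>e + d\<close>. In the
  second estimate (\<open>kkt_stability_estimate\<close>) the regularization term is moved into the right-hand
  side, and the distance of the new multiplier from the multiplier set is controlled by Hoffman's
  error bound (\<open>multiplier_error_bound\<close>), which holds because \<open>K\<close> has finitely many generators; this
  gives the quadratic bound. For small \<open>\<delta>\<close> and \<open>\<sigma>\<^sub>1\<close> the bound halves \<open>e + d\<close> in each step, while
  \<open>\<lambda>\<^sub>k\<close> moves by at most a multiple of \<open>e + d\<close>; so a weighted sum of \<open>e + d\<close> and the distance of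
  \<open>\<lambda>\<^sub>k\<close> from \<open>\<lambda>\<^sub>*\<close> never increases, and the iterates stay in the ball.\<close>

section \<open>Projections and functionals in Hilbert spaces\<close>

text \<open>A minimizing sequence is Cauchy by the parallelogram law, because the midpoints of its members lie
  in the convex set and cannot be closer than the infimum.\<close>

lemma nearest_point_exists:
  fixes S :: "'a::{real_inner,complete_space} set"
  assumes "closed S" "convex S" "S \<noteq> {}"
  shows "\<exists>p\<in>S. \<forall>s\<in>S. norm (z - p) \<le> norm (z - s)"
proof -
  define I where "I = infdist z S"
  have I0: "I \<ge> 0" and Ile: "\<And>s. s \<in> S \<Longrightarrow> I \<le> norm (z - s)"
    by (auto simp: I_def infdist_nonneg dist_norm[symmetric] infdist_le)
  have "\<exists>s\<in>S. norm (z - s) < I + 1 / real (Suc n)" for n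
  proof (rule ccontr)
    assume "\<not> ?thesis"
    then have "I + 1 / real (Suc n) \<le> infdist z S"
      unfolding infdist_notempty[OF assms(3)]
      by (intro cINF_greatest assms) (auto simp: dist_norm not_less)
    then show False by (simp add: I_def field_simps)
  qed
  then obtain s where sS: "\<And>n. s n \<in> S" and s: "\<And>n. norm (z - s n) < I + 1 / real (Suc n)"
    by metis
  have close: "(norm (s m - s n))\<^sup>2 \<le> 4 * (2 * I + 1) / real (Suc N)" if "N \<le> m" "N \<le> n" for m n N
  proof -
    have b: "(norm (z - s k))\<^sup>2 \<le> I\<^sup>2 + (2 * I + 1) / real (Suc N)" if "N \<le> k" for k
    proof -
      have "1 / real (Suc k) \<le> 1 / real (Suc N)" using that by (simp add: field_simps)
      then have "norm (z - s k) \<le> I + 1 / real (Suc N)" using s[of k] by linarith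
      then have "(norm (z - s k))\<^sup>2 \<le> (I + 1 / real (Suc N))\<^sup>2" by (simp add: power_mono)
      also have "\<dots> = I\<^sup>2 + 2 * I / real (Suc N) + (1 / real (Suc N))\<^sup>2"
        by (simp add: power2_sum)
      also have "(1 / real (Suc N))\<^sup>2 \<le> 1 / real (Suc N)"
        by (simp add: power2_eq_square divide_simps)
      finally show ?thesis by (simp add: add_divide_distrib)
    qed
    have "(1/2) *\<^sub>R s m + (1/2) *\<^sub>R s n \<in> S"
      using assms(2) sS[of m] sS[of n] by (auto simp: convex_def)
    from Ile[OF this] have "I\<^sup>2 \<le> (norm (z - ((1/2) *\<^sub>R s m + (1/2) *\<^sub>R s n)))\<^sup>2"
      using I0 by (simp add: power_mono)
    moreover have "(norm (s m - s n))\<^sup>2 = 2 * (norm (z - s m))\<^sup>2 + 2 * (norm (z - s n))\<^sup>2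
        - 4 * (norm (z - ((1/2) *\<^sub>R s m + (1/2) *\<^sub>R s n)))\<^sup>2"
      unfolding power2_norm_eq_inner by (simp add: inner_simps inner_commute algebra_simps)
    ultimately have "(norm (s m - s n))\<^sup>2 \<le> 4 * ((2 * I + 1) / real (Suc N))"
      using b[OF that(1)] b[OF that(2)] by linarith
    then show ?thesis by simp
  qed
  have "Cauchy s"
  proof (rule metric_CauchyI)
    fix e :: real assume e: "e > 0"
    obtain N where "4 * (2 * I + 1) / e\<^sup>2 < real N"
      using reals_Archimedean2 by blast
    then have N: "4 * (2 * I + 1) / e\<^sup>2 < real (Suc N)" by simp
    then have *: "4 * (2 * I + 1) / real (Suc N) < e\<^sup>2"
      using e by (simp add: field_simps)
    show "\<exists>M. \<forall>m\<ge>M. \<forall>n\<ge>M. dist (s m) (s n) < e"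
    proof (intro exI allI impI)
      fix m n assume "m \<ge> N" "n \<ge> N"
      from close[OF this] * have "(norm (s m - s n))\<^sup>2 < e\<^sup>2" by linarith
      then show "dist (s m) (s n) < e"
        using e by (simp add: dist_norm power2_less_imp_less)
    qed
  qed
  then obtain p where p: "s \<longlonglongrightarrow> p"
    using Cauchy_convergent convergent_def by blast
  have pS: "p \<in> S" using closed_sequentially[OF assms(1) _ p] sS by blast
  have "norm (z - p) \<le> I"
  proof (rule LIMSEQ_le)
    show "(\<lambda>n. norm (z - s n)) \<longlonglongrightarrow> norm (z - p)" by (intro tendsto_intros p)
    show "(\<lambda>n. I + 1 / real (Suc n)) \<longlonglongrightarrow> I"
      using tendsto_add[OF tendsto_const LIMSEQ_inverse_real_of_nat, of I] by (simp add: inverse_eq_divide)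
    show "\<exists>N. \<forall>n\<ge>N. norm (z - s n) \<le> I + 1 / real (Suc n)" using s less_imp_le by blast
  qed
  then have "\<forall>s\<in>S. norm (z - p) \<le> norm (z - s)" using Ile by (meson order.trans)
  with pS show ?thesis by blast
qed

text \<open>The variational inequality characterizes the projection and is the form in which it is used.\<close>

lemma projection_exists:
  fixes S :: "'a::{real_inner,complete_space} set"
  assumes "closed S" "convex S" "S \<noteq> {}"
  shows "\<exists>P. \<forall>z. P z \<in> S \<and> (\<forall>s\<in>S. norm (z - P z) \<le> norm (z - s) \<and> inner (z - P z) (s - P z) \<le> 0)"
proof -
  obtain P where P: "\<forall>z. P z \<in> S \<and> (\<forall>s\<in>S. norm (z - P z) \<le> norm (z - s))"
    using nearest_point_exists[OF assms] by metis
  moreover have "inner (z - P z) (s - P z) \<le> 0" if "s \<in> S" for z s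
    by (rule any_closest_point_dot[OF assms(2,1)]) (use P that in \<open>auto simp: dist_norm\<close>)
  ultimately show ?thesis by blast
qed

text \<open>The operator is the projection onto the orthogonal complement of \<open>S\<close>, that is, the identity minus
  the projection onto \<open>S\<close>. It is the uniqueness of the orthogonal decomposition that makes it linear.\<close>

lemma orthogonal_projection_exists:
  fixes S :: "'a::{real_inner,complete_space} set"
  assumes "closed S" "subspace S"
  shows "\<exists>Q :: 'a \<Rightarrow>\<^sub>L 'a. (\<forall>z. z - Q z \<in> S) \<and> (\<forall>z. \<forall>s\<in>S. inner (Q z) s = 0)"
proof -
  obtain P where P: "\<And>z. P z \<in> S" "\<And>z s. s \<in> S \<Longrightarrow> inner (z - P z) (s - P z) \<le> 0"
    using projection_exists[OF assms(1) subspace_imp_convex[OF assms(2)]] subspace_0[OF assms(2)]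
    by (metis empty_iff)
  have orth: "inner (z - P z) s = 0" if "s \<in> S" for z s
    using P(2)[of "P z + s" z] P(2)[of "P z - s" z] P(1)[of z] that assms(2)
    by (auto simp: subspace_add subspace_diff)
  have uniq: "p = P z" if "p \<in> S" "\<And>s. s \<in> S \<Longrightarrow> inner (z - p) s = 0" for p z
  proof -
    have "p - P z \<in> S" using that P(1) assms(2) by (simp add: subspace_diff)
    from that(2)[OF this] orth[OF this, of z] have "inner (p - P z) (p - P z) = 0"
      by (simp add: inner_simps)
    then show ?thesis by simp
  qed
  have "bounded_linear (\<lambda>z. z - P z)"
  proof (rule bounded_linear_intro[where K = 1])
    have "P (a + b) = P a + P b" for a b
    proof (rule uniq[symmetric])
      show "P a + P b \<in> S" using P(1) assms(2) by (simp add: subspace_add)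
      show "inner (a + b - (P a + P b)) s = 0" if "s \<in> S" for s
        using orth[OF that, of a] orth[OF that, of b] by (simp add: inner_simps)
    qed
    then show "a + b - P (a + b) = (a - P a) + (b - P b)" for a b by simp
    have "P (r *\<^sub>R a) = r *\<^sub>R P a" for r a
    proof (rule uniq[symmetric])
      show "r *\<^sub>R P a \<in> S" using P(1) assms(2) by (simp add: subspace_scale)
      show "inner (r *\<^sub>R a - r *\<^sub>R P a) s = 0" if "s \<in> S" for s
        using orth[OF that, of a] by (simp add: scaleR_diff_right[symmetric])
    qed
    then show "r *\<^sub>R a - P (r *\<^sub>R a) = r *\<^sub>R (a - P a)" for r a by (simp add: scaleR_diff_right)
    show "norm (a - P a) \<le> norm a * 1" for a
    proof -
      have "inner a a = inner (a - P a) (a - P a) + inner (P a) (P a)"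
        using orth[OF P(1), of a a] by (simp add: inner_simps inner_commute)
      then have "inner (a - P a) (a - P a) \<le> inner a a" by simp
      then show ?thesis by (simp add: norm_le)
    qed
  qed
  then have "blinfun_apply (Blinfun (\<lambda>z. z - P z)) = (\<lambda>z. z - P z)"
    by (rule bounded_linear_Blinfun_apply)
  then show ?thesis using P(1) orth by (intro exI[of _ "Blinfun (\<lambda>z. z - P z)"]) simp
qed

lemma complement_projection:
  fixes Q :: "'a::real_inner \<Rightarrow>\<^sub>L 'a"
  assumes S: "subspace S" and Q: "\<And>z. z - Q z \<in> S" "\<And>z. \<forall>s\<in>S. inner (Q z) s = 0"
  shows complement_projection_zero: "s \<in> S \<Longrightarrow> Q s = 0"
    and inner_complement_projection: "inner (Q z) z = (norm (Q z))\<^sup>2"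
    and norm_complement_projection_le: "norm (Q z) \<le> norm z"
proof -
  assume s: "s \<in> S"
  have "s - (s - Q s) \<in> S" using S s Q(1) by (rule subspace_diff)
  then have "inner (Q s) (Q s) = 0" using Q(2) by simp
  then show "Q s = 0" by simp
next
  show *: "inner (Q z) z = (norm (Q z))\<^sup>2"
    using bspec[OF Q(2) Q(1)[of z], of z] by (simp add: inner_diff_right power2_norm_eq_inner)
  have "norm (Q z) * norm (Q z) \<le> norm (Q z) * norm z"
    using * norm_cauchy_schwarz[of "Q z" z] by (simp add: power2_eq_square)
  then show "norm (Q z) \<le> norm z" by (cases "Q z = 0") simp_all
qed

lemma eq_if_inner_eq:
  fixes u :: "'a::real_inner"
  assumes "\<And>y. inner u y = inner v y"
  shows "u = v"
proof -
  have "inner (u - v) (u - v) = 0" using assms by (simp add: inner_diff_left)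
  then show ?thesis by simp
qed

text \<open>The representer is a multiple of any vector orthogonal to the kernel of the functional; the kernel is
  closed, so the projection theorem supplies one.\<close>

lemma riesz_exists:
  fixes l :: "'y::{real_inner,complete_space} \<Rightarrow>\<^sub>L real"
  shows "\<exists>u. \<forall>y. inner u y = l y"
proof (cases "\<exists>z. l z \<noteq> 0")
  case False
  then show ?thesis by (intro exI[of _ 0]) simp
next
  case True
  then obtain z where z: "l z \<noteq> 0" ..
  have "subspace {y. l y = 0}"
    by (auto simp: subspace_def blinfun.bilinear_simps)
  moreover have "closed {y. l y = 0}"
    by (intro closed_Collect_eq continuous_intros)
  ultimately obtain Q :: "'y \<Rightarrow>\<^sub>L 'y" where Q: "\<And>z. l (z - Q z) = 0"
    "\<And>z s. l s = 0 \<Longrightarrow> inner (Q z) s = 0"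
    using orthogonal_projection_exists[of "{y. l y = 0}"] by auto
  define q where "q = Q z"
  have lq: "l q \<noteq> 0" using Q(1)[of z] z by (simp add: q_def blinfun.bilinear_simps)
  then have qq: "inner q q \<noteq> 0" by (auto simp: blinfun.bilinear_simps)
  have "inner q (y - (l y / l q) *\<^sub>R q) = 0" for y
    unfolding q_def by (rule Q(2)) (use lq in \<open>simp add: blinfun.bilinear_simps q_def\<close>)
  then have "inner ((l q / inner q q) *\<^sub>R q) y = l y" for y
    using lq qq by (simp add: inner_simps field_simps)
  then show ?thesis by blast
qed

lemma inner_riesz:
  fixes l :: "'y::{real_inner,complete_space} \<Rightarrow>\<^sub>L real"
  shows "inner (riesz l) y = l y"
proof -
  obtain u where u: "\<And>y. inner u y = l y" using riesz_exists by blast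
  have "\<exists>!u. \<forall>y. inner u y = l y"
  proof (intro ex1I[of _ u] allI u)
    show "v = u" if "\<forall>y. inner v y = l y" for v
      by (rule eq_if_inner_eq) (simp add: that u)
  qed
  then show ?thesis unfolding riesz_def using theI'[of "\<lambda>u. \<forall>y. inner u y = l y"] by blast
qed

lemma riesz_unique:
  fixes l :: "'y::{real_inner,complete_space} \<Rightarrow>\<^sub>L real"
  assumes "\<And>y. inner u y = l y"
  shows "riesz l = u"
  by (rule eq_if_inner_eq) (simp add: inner_riesz assms)

lemma riesz_inner_right [simp]:
  fixes u :: "'y::{real_inner,complete_space}"
  shows "riesz (blinfun_inner_right u) = u"
  by (rule riesz_unique) simp

lemma inner_right_riesz [simp]:
  fixes l :: "'y::{real_inner,complete_space} \<Rightarrow>\<^sub>L real"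
  shows "blinfun_inner_right (riesz l) = l"
  by (rule blinfun_eqI) (simp add: inner_riesz)

lemma riesz_add:
  fixes l :: "'y::{real_inner,complete_space} \<Rightarrow>\<^sub>L real"
  shows "riesz (l + l') = riesz l + riesz l'"
  by (rule riesz_unique) (simp add: inner_simps inner_riesz blinfun.bilinear_simps)

lemma riesz_diff:
  fixes l :: "'y::{real_inner,complete_space} \<Rightarrow>\<^sub>L real"
  shows "riesz (l - l') = riesz l - riesz l'"
  by (rule riesz_unique) (simp add: inner_simps inner_riesz blinfun.bilinear_simps)

lemma norm_riesz [simp]:
  fixes l :: "'y::{real_inner,complete_space} \<Rightarrow>\<^sub>L real"
  shows "norm (riesz l) = norm l"
proof (rule antisym)
  have "(norm (riesz l))\<^sup>2 = l (riesz l)"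
    by (simp add: power2_norm_eq_inner inner_riesz)
  also have "\<dots> \<le> norm l * norm (riesz l)" using norm_blinfun[of l "riesz l"] by simp
  finally show "norm (riesz l) \<le> norm l"
    by (cases "riesz l = 0") (simp_all add: power2_eq_square)
  show "norm l \<le> norm (riesz l)"
    by (rule norm_blinfun_bound)
      (use Cauchy_Schwarz_ineq2[of "riesz l"] in \<open>auto simp: inner_riesz\<close>)
qed

lemma apply_riesz_self:
  fixes l :: "'y::{real_inner,complete_space} \<Rightarrow>\<^sub>L real"
  shows "l (riesz l) = (norm l)\<^sup>2"
  by (metis inner_riesz norm_riesz power2_norm_eq_inner)

text \<open>The dual space carries only a norm, so the projection theorem is applied to the Riesz representers.\<close>

lemma nearest_functional_exists:
  fixes S :: "('y::{real_inner,complete_space} \<Rightarrow>\<^sub>L real) set"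
  assumes "closed S" "convex S" "S \<noteq> {}"
  shows "\<exists>m. is_arg_min (\<lambda>\<mu>. norm (l - \<mu>)) (\<lambda>\<mu>. \<mu> \<in> S) m"
proof -
  define S' where "S' = (blinfun_inner_right :: 'y \<Rightarrow> _) -` S"
  have "closed S'" unfolding S'_def using assms(1)
    by (intro closed_vimage bounded_linear.continuous_on[OF bounded_linear_blinfun_inner_right] continuous_on_id)
  moreover have "convex S'" unfolding S'_def using assms(2)
    by (intro convex_linear_vimage bounded_linear.linear bounded_linear_blinfun_inner_right)
  moreover have "S' \<noteq> {}" using assms(3) inner_right_riesz unfolding S'_def by (metis all_not_in_conv vimageI2)
  ultimately obtain p where p: "p \<in> S'" "\<forall>s\<in>S'. norm (riesz l - p) \<le> norm (riesz l - s)"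
    using nearest_point_exists[of S' "riesz l"] by blast
  have "norm (l - blinfun_inner_right p) \<le> norm (l - \<mu>)" if "\<mu> \<in> S" for \<mu>
  proof -
    have "riesz \<mu> \<in> S'" using that by (simp add: S'_def)
    with p(2) have "norm (riesz (l - blinfun_inner_right p)) \<le> norm (riesz (l - \<mu>))" by (simp add: riesz_diff)
    then show ?thesis by simp
  qed
  then show ?thesis using p(1) by (intro exI[of _ "blinfun_inner_right p"]) (auto simp: is_arg_min_linorder S'_def)
qed

section \<open>Finite-dimensional subspaces and finitely generated cones\<close>

text \<open>Adding one vector to a closed subspace keeps it closed: after replacing the vector by its component
  \<open>q\<close> orthogonal to the subspace, membership becomes a linear equation.\<close>

lemma closed_span_insert:
  fixes M :: "'a::{real_inner,complete_space} set"
  assumes "closed (span M)"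
  shows "\<exists>q. (\<forall>s\<in>span M. inner q s = 0) \<and> span (insert v M) = span (insert q M) \<and>
    closed (span (insert v M))"
proof -
  obtain Q :: "'a \<Rightarrow>\<^sub>L 'a" where Q: "\<And>z. z - Q z \<in> span M" "\<And>z s. s \<in> span M \<Longrightarrow> inner (Q z) s = 0"
    using orthogonal_projection_exists[OF assms subspace_span] by blast
  define q where "q = Q v"
  have vq: "v - q \<in> span M" using Q by (simp add: q_def)
  have sp: "span (insert v M) = span (insert q M)"
  proof -
    have "v - 1 *\<^sub>R q \<in> span M" "q - 1 *\<^sub>R v \<in> span M"
      using vq span_neg[OF vq] by (simp, simp only: minus_diff_eq scaleR_one)
    then have "v \<in> span (insert q M)" "q \<in> span (insert v M)"
      unfolding span_breakdown_eq by blast+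
    then have "insert v M \<subseteq> span (insert q M)" "insert q M \<subseteq> span (insert v M)"
      using span_base[of _ "insert q M"] span_base[of _ "insert v M"] by auto
    then show ?thesis by (intro antisym span_minimal subspace_span)
  qed
  have Q0: "Q m = 0" if "m \<in> span M" for m
    by (rule complement_projection_zero[OF subspace_span Q(1) _ that]) (simp add: Q(2))
  have Qq: "Q q = q"
    using Q0[OF vq] by (simp add: q_def blinfun.bilinear_simps)
  \<comment> \<open>For \<open>q = 0\<close> the quotient is zero by convention, and the equation describes \<open>span M\<close>.\<close>
  have "span (insert q M) = {z. Q z = (inner q z / inner q q) *\<^sub>R q}"
  proof safe
    fix z assume "z \<in> span (insert q M)"
    then obtain k where k: "z - k *\<^sub>R q \<in> span M" unfolding span_breakdown_eq by blast
    then have "Q z = k *\<^sub>R q" "inner q z = k * inner q q"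
      using Q0[OF k] Q(2)[OF k, of v] Qq by (simp_all add: blinfun.bilinear_simps inner_simps q_def)
    then show "Q z = (inner q z / inner q q) *\<^sub>R q" by simp
  next
    fix z assume "Q z = (inner q z / inner q q) *\<^sub>R q"
    then have "z - (inner q z / inner q q) *\<^sub>R q \<in> span M" using Q(1)[of z] by simp
    then show "z \<in> span (insert q M)" unfolding span_breakdown_eq by blast
  qed
  moreover have "closed {z. Q z = (inner q z / inner q q) *\<^sub>R q}"
    unfolding divide_inverse by (intro closed_Collect_eq continuous_intros)
  ultimately have "closed (span (insert q M))" by simp
  then show ?thesis using Q(2) sp by (intro exI[of _ q]) (simp add: q_def)
qed

lemma closed_span_Un_finite:
  fixes M :: "'a::{real_inner,complete_space} set"
  assumes "closed (span M)" "finite B"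
  shows "closed (span (B \<union> M))"
  using assms(2)
proof induction
  case empty
  then show ?case using assms(1) by simp
next
  case (insert v B)
  show ?case using closed_span_insert[OF insert.IH, of v] by auto
qed

lemma closed_span_finite:
  fixes B :: "'a::{real_inner,complete_space} set"
  assumes "finite B"
  shows "closed (span B)"
  using closed_span_Un_finite[of "{}" B] assms by simp

text \<open>Finite-dimensional subspaces of a Hilbert space have compact balls. In the induction step the ball is a
  closed part of the sum of the smaller ball and a segment in an orthogonal direction.\<close>

lemma compact_cball_Int_span_finite:
  fixes B :: "'a::{real_inner,complete_space} set"
  assumes "finite B"
  shows "compact (span B \<inter> cball 0 r)"
  using assms
proof induction
  case empty
  have "compact ({0 :: 'a} \<inter> cball 0 r)" by (intro finite_imp_compact) simp
  then show ?case by simp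
next
  case (insert v B)
  obtain q where q: "\<And>s. s \<in> span B \<Longrightarrow> inner q s = 0" "span (insert v B) = span (insert q B)"
    "closed (span (insert v B))"
    using closed_span_insert[OF closed_span_finite[OF insert.hyps(1)], of v] by blast
  define J where "J = (\<lambda>t. t *\<^sub>R q) ` {- r / norm q .. r / norm q}"
  have "compact J" unfolding J_def
    by (intro compact_continuous_image continuous_intros compact_Icc)
  have sub: "span (insert v B) \<inter> cball 0 r \<subseteq> {x + y | x y. x \<in> span B \<inter> cball 0 r \<and> y \<in> J}"
  proof
    fix z assume z: "z \<in> span (insert v B) \<inter> cball 0 r"
    then obtain k where k: "z - k *\<^sub>R q \<in> span B" unfolding q(2) using span_breakdown_eq by blast
    have "inner z z = inner (z - k *\<^sub>R q) (z - k *\<^sub>R q) + inner (k *\<^sub>R q) (k *\<^sub>R q)"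
      using q(1)[OF k] by (simp add: inner_simps inner_commute)
    then have "inner (z - k *\<^sub>R q) (z - k *\<^sub>R q) \<le> inner z z" "inner (k *\<^sub>R q) (k *\<^sub>R q) \<le> inner z z"
      by (metis add.commute le_add_same_cancel2 inner_ge_zero)+
    then have n: "norm (z - k *\<^sub>R q) \<le> r" "norm (k *\<^sub>R q) \<le> r"
      using z unfolding norm_le[symmetric] by auto
    \<comment> \<open>If \<open>q = 0\<close>, the coefficient \<open>k\<close> is arbitrary and need not satisfy the bound.\<close>
    define k' where "k' = (if q = 0 then 0 else k)"
    have "\<bar>k'\<bar> \<le> r / norm q" using n(2) by (simp add: k'_def pos_le_divide_eq)
    then have "k' *\<^sub>R q \<in> J" unfolding J_def by (intro imageI) auto
    moreover have "k' *\<^sub>R q = k *\<^sub>R q" by (simp add: k'_def)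
    ultimately have "k *\<^sub>R q \<in> J" by simp
    moreover have "z = (z - k *\<^sub>R q) + k *\<^sub>R q" by simp
    ultimately show "z \<in> {x + y | x y. x \<in> span B \<inter> cball 0 r \<and> y \<in> J}"
      using k n by (intro CollectI exI[of _ "z - k *\<^sub>R q"] exI[of _ "k *\<^sub>R q"]) auto
  qed
  have "compact {x + y | x y. x \<in> span B \<inter> cball 0 r \<and> y \<in> J}"
    by (rule compact_sums[OF insert.IH \<open>compact J\<close>])
  then have "compact ({x + y | x y. x \<in> span B \<inter> cball 0 r \<and> y \<in> J} \<inter> (span (insert v B) \<inter> cball 0 r))"
    by (intro compact_Int_closed closed_Int q closed_cball)
  then show ?case using sub by (simp add: Int_absorb1)
qed

definition finite_cone :: "'a::real_vector set \<Rightarrow> 'a set"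
  where "finite_cone B = {\<Sum>b\<in>B. c b *\<^sub>R b | c. \<forall>b\<in>B. 0 \<le> c b}"

text \<open>If the generators are independent, the coordinates of a vector of their span are continuous, so the
  cone is cut out of a closed span by closed half-spaces. If they are dependent, one can subtract from
  any nonnegative combination a multiple of the dependency that makes one coefficient zero and keeps the
  others nonnegative; then the cone is the union of the finitely many cones with one generator less.\<close>

lemma closed_finite_cone:
  fixes B :: "'a::{real_inner,complete_space} set"
  assumes "finite B"
  shows "closed (finite_cone B)"
  using assms
proof (induction B rule: finite_psubset_induct)
  case (psubset B)
  show ?case
  proof (cases "independent B")
    case True
    define Q where "Q b = (SOME Q :: 'a \<Rightarrow>\<^sub>L 'a. (\<forall>z. z - Q z \<in> span (B - {b})) \<and>
      (\<forall>z. \<forall>s\<in>span (B - {b}). inner (Q z) s = 0))" for b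
    have Q: "(\<forall>z. z - Q b z \<in> span (B - {b})) \<and> (\<forall>z. \<forall>s\<in>span (B - {b}). inner (Q b z) s = 0)" for b
      unfolding Q_def using psubset.hyps
      by (intro someI_ex[OF orthogonal_projection_exists] closed_span_finite) auto
    \<comment> \<open>\<open>q b\<close> is orthogonal to the other generators: it reads off the coordinate of \<open>b\<close>.\<close>
    define q where "q b = Q b b" for b
    have coord: "inner (q b) (\<Sum>a\<in>B. c a *\<^sub>R a) = c b * inner (q b) (q b)" if b: "b \<in> B" for b c
    proof -
      have "inner (q b) a = 0" if "a \<in> B - {b}" for a
        using Q[of b] that unfolding q_def by (blast intro: span_base)
      then have "inner (q b) (\<Sum>a\<in>B. c a *\<^sub>R a) = c b * inner (q b) b"
        using psubset.hyps b by (simp add: sum.remove inner_add_right inner_sum_right)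
      moreover have "inner (q b) (b - q b) = 0" using Q[of b] by (simp add: q_def)
      ultimately show ?thesis by (simp add: inner_diff_right)
    qed
    have qpos: "inner (q b) (q b) > 0" if "b \<in> B" for b
    proof -
      have "q b \<noteq> 0"
      proof
        assume "q b = 0"
        then have "b \<in> span (B - {b})" using Q[of b] by (metis q_def diff_zero)
        then show False using True that by (auto simp: dependent_def)
      qed
      then show ?thesis by simp
    qed
    have "finite_cone B = span B \<inter> (\<Inter>b\<in>B. {z. 0 \<le> inner (q b) z})"
    proof safe
      fix z assume "z \<in> finite_cone B"
      then obtain c where c: "z = (\<Sum>b\<in>B. c b *\<^sub>R b)" "\<forall>b\<in>B. 0 \<le> c b"
        by (auto simp: finite_cone_def)
      then show "z \<in> span B" by (auto intro: span_sum span_scale span_base)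
      show "0 \<le> inner (q b) z" if "b \<in> B" for b
        using c coord[OF that] qpos[OF that] that by simp
    next
      fix z assume z: "z \<in> span B" "z \<in> (\<Inter>b\<in>B. {z. 0 \<le> inner (q b) z})"
      then obtain c where c: "z = (\<Sum>b\<in>B. c b *\<^sub>R b)"
        using span_finite[OF psubset.hyps(1)] by auto
      have "0 \<le> c b" if "b \<in> B" for b
      proof -
        have "0 \<le> c b * inner (q b) (q b)" using z(2) c coord[OF that] that by force
        then show ?thesis using qpos[OF that] by (simp add: zero_le_mult_iff)
      qed
      then show "z \<in> finite_cone B" using c by (auto simp: finite_cone_def)
    qed
    then show ?thesis
      using closed_span_finite[OF psubset.hyps(1)]
      by (auto intro!: closed_Int closed_INT closed_Collect_le continuous_intros)
  next
    case False
    then obtain u where u: "(\<Sum>b\<in>B. u b *\<^sub>R b) = 0" "\<exists>b\<in>B. u b \<noteq> 0"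
      using dependent_finite[OF psubset.hyps(1)] by auto
    obtain c where c: "(\<Sum>b\<in>B. c b *\<^sub>R b) = 0" "\<exists>b\<in>B. c b > 0"
    proof (cases "\<exists>b\<in>B. u b > 0")
      case True
      then show ?thesis using u that by blast
    next
      case False
      then have "\<exists>b\<in>B. - u b > 0" using u(2) by (metis linorder_neqE_linordered_idom neg_0_less_iff_less)
      moreover have "(\<Sum>b\<in>B. (- u b) *\<^sub>R b) = 0" using u(1) by (simp add: sum_negf)
      ultimately show ?thesis by (intro that[of "\<lambda>b. - u b"])
    qed
    have "finite_cone B = (\<Union>b\<in>B. finite_cone (B - {b}))"
    proof safe
      fix z assume "z \<in> finite_cone B"
      then obtain d where d: "z = (\<Sum>b\<in>B. d b *\<^sub>R b)" "\<forall>b\<in>B. 0 \<le> d b"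
        by (auto simp: finite_cone_def)
      define P where "P = {b\<in>B. c b > 0}"
      have P: "finite P" "P \<noteq> {}" using c(2) psubset.hyps by (auto simp: P_def)
      then obtain b where b: "b \<in> P" "\<And>a. a \<in> P \<Longrightarrow> d b / c b \<le> d a / c a"
        using arg_min_if_finite[OF P, of "\<lambda>a. d a / c a"] by (metis not_less)
      \<comment> \<open>The smallest ratio is the largest multiple that can be subtracted.\<close>
      define t where "t = d b / c b"
      define g where "g a = d a - t * c a" for a
      have t0: "t \<ge> 0" using b d by (auto simp: t_def P_def)
      have bB: "b \<in> B" and gb: "g b = 0" using b by (auto simp: P_def g_def t_def)
      have "0 \<le> g a" if "a \<in> B" for a
      proof (cases "a \<in> P")
        case True
        then have "t \<le> d a / c a" "c a > 0" using b(2) by (auto simp: t_def P_def)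
        then show ?thesis by (simp add: g_def pos_le_divide_eq)
      next
        case False
        then have "c a \<le> 0" using that by (auto simp: P_def)
        then have "t * c a \<le> 0" using t0 by (simp add: mult_nonneg_nonpos)
        moreover have "0 \<le> d a" using d(2) that by blast
        ultimately show ?thesis by (simp add: g_def)
      qed
      moreover have "z = (\<Sum>a\<in>B. g a *\<^sub>R a)"
      proof -
        have "(\<Sum>a\<in>B. g a *\<^sub>R a) = (\<Sum>a\<in>B. d a *\<^sub>R a) - t *\<^sub>R (\<Sum>a\<in>B. c a *\<^sub>R a)"
          by (simp add: g_def scaleR_diff_left sum_subtractf scaleR_sum_right)
        then show ?thesis using c(1) d(1) by simp
      qed
      then have "z = (\<Sum>a\<in>B - {b}. g a *\<^sub>R a)"
        using gb psubset.hyps bB by (simp add: sum.remove)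
      ultimately show "z \<in> (\<Union>b\<in>B. finite_cone (B - {b}))"
        using bB by (auto simp: finite_cone_def)
    next
      fix z b assume b: "b \<in> B" and "z \<in> finite_cone (B - {b})"
      then obtain d where d: "z = (\<Sum>b\<in>B - {b}. d b *\<^sub>R b)" "\<forall>b\<in>B - {b}. 0 \<le> d b"
        by (auto simp: finite_cone_def)
      have "z = (\<Sum>a\<in>B. (d(b := 0)) a *\<^sub>R a)"
        using d(1) psubset.hyps b by (simp add: sum.remove)
      moreover have "\<forall>a\<in>B. 0 \<le> (d(b := 0)) a" using d(2) by simp
      ultimately show "z \<in> finite_cone B" unfolding finite_cone_def by blast
    qed
    moreover have "closed (finite_cone (B - {b}))" if "b \<in> B" for b
      using that by (intro psubset.IH) blast
    ultimately show ?thesis using psubset.hyps by (auto intro!: closed_UN)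
  qed
qed

text \<open>The residual of the projection of \<open>w\<close> onto \<open>K\<close> is an admissible \<open>u\<close>, and the hypothesis makes it vanish.\<close>

lemma bipolar:
  fixes K :: "'a::{real_inner,complete_space} set"
  assumes "closed K" "convex_cone K"
    and w: "\<And>u. (\<And>k. k \<in> K \<Longrightarrow> inner u k \<le> 0) \<Longrightarrow> inner u w \<le> 0"
  shows "w \<in> K"
proof -
  have K: "convex K" "K \<noteq> {}" "\<And>x y. x \<in> K \<Longrightarrow> y \<in> K \<Longrightarrow> x + y \<in> K" "0 \<in> K"
    using assms(2) by (auto simp: convex_cone_add convex_cone_contains_0 convex_cone_nonempty) (simp add: convex_cone_def)
  obtain p where p: "p \<in> K" "\<And>s. s \<in> K \<Longrightarrow> inner (w - p) (s - p) \<le> 0"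
    using projection_exists[OF assms(1) K(1,2)] by metis
  have "inner (w - p) k \<le> 0" if "k \<in> K" for k
    using p(2)[of "p + k"] K(3) p(1) that by simp
  then have "inner (w - p) w \<le> 0" by (rule w)
  moreover have "inner (w - p) (0 - p) \<le> 0" using p(2) K(4) by blast
  ultimately have "inner (w - p) (w - p) \<le> 0" by (simp add: inner_simps)
  then have "w = p" using inner_gt_zero_iff[of "w - p"] by fastforce
  then show ?thesis using p(1) by simp
qed

text \<open>Generators given as a family may repeat: from left to right their coefficients are added up, from
  right to left one index is chosen for each generator.\<close>

lemma finite_cone_of_family:
  assumes "finite I"
  shows "{\<Sum>i\<in>I. \<mu> i *\<^sub>R ys i | \<mu>. \<forall>i\<in>I. 0 \<le> \<mu> i} = finite_cone (ys ` I)"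
proof (intro subset_antisym subsetI)
  fix z assume "z \<in> {\<Sum>i\<in>I. \<mu> i *\<^sub>R ys i | \<mu>. \<forall>i\<in>I. 0 \<le> \<mu> i}"
  then obtain \<mu> where \<mu>: "z = (\<Sum>i\<in>I. \<mu> i *\<^sub>R ys i)" "\<forall>i\<in>I. 0 \<le> \<mu> i" by blast
  define c where "c b = (\<Sum>i\<in>{i\<in>I. ys i = b}. \<mu> i)" for b
  have "z = (\<Sum>b\<in>ys ` I. \<Sum>i\<in>{i\<in>I. ys i = b}. \<mu> i *\<^sub>R ys i)"
    unfolding \<mu>(1) by (rule sum.image_gen[OF assms])
  also have "\<dots> = (\<Sum>b\<in>ys ` I. c b *\<^sub>R b)"
    by (intro sum.cong refl) (simp add: c_def scaleR_sum_left)
  finally show "z \<in> finite_cone (ys ` I)"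
    using \<mu>(2) unfolding finite_cone_def c_def by (force intro: sum_nonneg)
next
  fix z assume "z \<in> finite_cone (ys ` I)"
  then obtain c where c: "z = (\<Sum>b\<in>ys ` I. c b *\<^sub>R b)" "\<forall>b\<in>ys ` I. 0 \<le> c b"
    unfolding finite_cone_def by blast
  obtain J where J: "J \<subseteq> I" "inj_on ys J" "ys ` I = ys ` J"
    using subset_image_inj[of "ys ` I" ys I] by auto
  have "z = (\<Sum>i\<in>J. c (ys i) *\<^sub>R ys i)"
    unfolding c(1) J(3) by (simp add: sum.reindex[OF J(2)])
  also have "\<dots> = (\<Sum>i\<in>I. (if i \<in> J then c (ys i) else 0) *\<^sub>R ys i)"
    using J(1) assms by (intro sum.mono_neutral_cong_left) auto
  finally show "z \<in> {\<Sum>i\<in>I. \<mu> i *\<^sub>R ys i | \<mu>. \<forall>i\<in>I. 0 \<le> \<mu> i}"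
    using c(2) by force
qed

lemma convex_cone_finite_cone: "convex_cone (finite_cone B)"
  unfolding convex_cone_iff finite_cone_def
proof (intro conjI ballI allI impI)
  show "0 \<in> {\<Sum>b\<in>B. c b *\<^sub>R b |c. \<forall>b\<in>B. 0 \<le> c b}" by (intro CollectI exI[of _ "\<lambda>_. 0"]) simp
  fix x y assume "x \<in> {\<Sum>b\<in>B. c b *\<^sub>R b |c. \<forall>b\<in>B. 0 \<le> c b}" "y \<in> {\<Sum>b\<in>B. c b *\<^sub>R b |c. \<forall>b\<in>B. 0 \<le> c b}"
  then obtain c d where "x = (\<Sum>b\<in>B. c b *\<^sub>R b)" "\<forall>b\<in>B. 0 \<le> c b" "y = (\<Sum>b\<in>B. d b *\<^sub>R b)" "\<forall>b\<in>B. 0 \<le> d b"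
    by blast
  then show "x + y \<in> {\<Sum>b\<in>B. c b *\<^sub>R b |c. \<forall>b\<in>B. 0 \<le> c b}"
    by (intro CollectI exI[of _ "\<lambda>b. c b + d b"]) (simp add: scaleR_add_left sum.distrib)
next
  fix x t assume "x \<in> {\<Sum>b\<in>B. c b *\<^sub>R b |c. \<forall>b\<in>B. 0 \<le> c b}" "0 \<le> (t::real)"
  then obtain c where "x = (\<Sum>b\<in>B. c b *\<^sub>R b)" "\<forall>b\<in>B. 0 \<le> c b" by blast
  then show "t *\<^sub>R x \<in> {\<Sum>b\<in>B. c b *\<^sub>R b |c. \<forall>b\<in>B. 0 \<le> c b}"
    using \<open>0 \<le> t\<close> by (intro CollectI exI[of _ "\<lambda>b. t * c b"]) (simp add: scaleR_sum_right)
qed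

section \<open>Hoffman's error bound\<close>

text \<open>Take the nearest feasible point \<open>p\<close> and let \<open>J\<close> be the constraints active there. Then \<open>u - p\<close> lies in
  the set \<open>D J\<close>, the polar of the cone cut out by the active constraints, which sits inside the
  finite-dimensional span of their normals. A nonzero element of \<open>D J\<close> violates one of
  these constraints, for otherwise it would belong to the cone as well as to its polar
  and be orthogonal to itself. So the violation is positive on the compact unit sphere of \<open>D J\<close>, hence
  bounded below there, and by homogeneity it bounds the norm on \<open>D J\<close>. There are only finitely many sets \<open>J\<close>, so one constant serves all of them.\<close>

lemma hoffman:
  fixes a :: "'i \<Rightarrow> 'a::{real_inner,complete_space}" and b :: "'i \<Rightarrow> real"
  assumes "finite I" and ne: "\<exists>p. \<forall>i\<in>I. inner (a i) p \<le> b i"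
  shows "\<exists>C\<ge>0. \<forall>u. \<exists>p. (\<forall>i\<in>I. inner (a i) p \<le> b i) \<and> u - p \<in> span (a ` I) \<and>
    norm (u - p) \<le> C * (\<Sum>i\<in>I. max 0 (inner (a i) u - b i))"
proof -
  define D where "D J = {n \<in> span (a ` J). \<forall>t. (\<forall>i\<in>J. inner (a i) t \<le> 0) \<longrightarrow> inner n t \<le> 0}" for J
  have "\<exists>c>0. \<forall>n\<in>D J. c * norm n \<le> (\<Sum>i\<in>J. max 0 (inner (a i) n))" if "J \<subseteq> I" for J
  proof -
    have fin: "finite J" using that assms(1) finite_subset by blast
    define \<theta> where "\<theta> n = (\<Sum>i\<in>J. max 0 (inner (a i) n))" for n
    define N where "N = D J \<inter> sphere 0 1"
    have "closed {n. \<forall>t. (\<forall>i\<in>J. inner (a i) t \<le> 0) \<longrightarrow> inner n t \<le> 0}"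
      by (intro closed_Collect_all closed_Collect_imp closed_Collect_le continuous_intros open_Collect_const)
    moreover have "N = (span (a ` J) \<inter> cball 0 1) \<inter> (sphere 0 1 \<inter> {n. \<forall>t. (\<forall>i\<in>J. inner (a i) t \<le> 0) \<longrightarrow> inner n t \<le> 0})"
      by (auto simp: N_def D_def)
    moreover have "closed (sphere 0 1 :: 'a set)"
      unfolding sphere_def by (intro closed_Collect_eq continuous_intros)
    ultimately have Neq: "N = (span (a ` J) \<inter> cball 0 1) \<inter> (sphere 0 1 \<inter> {n. \<forall>t. (\<forall>i\<in>J. inner (a i) t \<le> 0) \<longrightarrow> inner n t \<le> 0})"
      and Ncl: "closed (sphere 0 1 \<inter> {n. \<forall>t. (\<forall>i\<in>J. inner (a i) t \<le> 0) \<longrightarrow> inner n t \<le> 0})"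
      by (simp_all add: closed_Int)
    have cN: "compact N"
      unfolding Neq using fin by (intro compact_Int_closed[OF compact_cball_Int_span_finite Ncl]) simp
    have pos: "\<theta> n > 0" if "n \<in> N" for n
    proof (rule ccontr)
      assume "\<not> ?thesis"
      moreover have "\<theta> n \<ge> 0" unfolding \<theta>_def by (intro sum_nonneg) auto
      ultimately have "\<theta> n = 0" by linarith
      then have "\<forall>i\<in>J. max 0 (inner (a i) n) = 0"
        unfolding \<theta>_def using fin by (subst (asm) sum_nonneg_eq_0_iff) auto
      then have "\<forall>i\<in>J. inner (a i) n \<le> 0" by (metis max.cobounded2)
      then have "inner n n \<le> 0" using that by (auto simp: N_def D_def)
      then have "n = 0" using inner_gt_zero_iff[of n] by fastforce
      then show False using that by (simp add: N_def)
    qed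
    have "\<exists>c>0. \<forall>n\<in>N. c \<le> \<theta> n"
    proof (cases "N = {}")
      case False
      have "continuous_on N \<theta>" unfolding \<theta>_def by (intro continuous_intros)
      then obtain m where "m \<in> N" "\<forall>n\<in>N. \<theta> m \<le> \<theta> n"
        using continuous_attains_inf[OF cN False] by blast
      then show ?thesis using pos by blast
    qed (auto intro: zero_less_one)
    then obtain c where c: "c > 0" "\<And>n. n \<in> N \<Longrightarrow> c \<le> \<theta> n" by blast
    have "c * norm n \<le> \<theta> n" if n: "n \<in> D J" for n
    proof (cases "n = 0")
      case True
      then show ?thesis unfolding \<theta>_def by (auto intro: sum_nonneg)
    next
      case False
      have "(1 / norm n) *\<^sub>R n \<in> D J"
        using n by (auto simp: D_def intro!: span_scale divide_nonpos_nonneg)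
      then have "c \<le> \<theta> ((1 / norm n) *\<^sub>R n)" using False by (intro c) (simp add: N_def)
      also have "\<dots> = (\<Sum>i\<in>J. (1 / norm n) * max 0 (inner (a i) n))"
        unfolding \<theta>_def using False by (intro sum.cong) (auto simp: max_def zero_le_divide_iff divide_le_0_iff)
      also have "\<dots> = \<theta> n / norm n" unfolding \<theta>_def by (simp add: sum_distrib_left sum_divide_distrib)
      finally show ?thesis using False by (simp add: pos_le_divide_eq)
    qed
    then show ?thesis using c(1) unfolding \<theta>_def by blast
  qed
  then obtain c where c: "\<And>J. J \<subseteq> I \<Longrightarrow> c J > 0"
    "\<And>J n. J \<subseteq> I \<Longrightarrow> n \<in> D J \<Longrightarrow> c J * norm n \<le> (\<Sum>i\<in>J. max 0 (inner (a i) n))"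
    by metis
  define C where "C = (\<Sum>J\<in>Pow I. 1 / c J)"
  have C0: "C \<ge> 0" unfolding C_def by (intro sum_nonneg) (use c(1) in \<open>auto simp: less_imp_le\<close>)
  have Cge: "1 / c J \<le> C" if "J \<subseteq> I" for J
    unfolding C_def using assms(1) c(1) that by (intro member_le_sum) (auto simp: less_imp_le)
  define P where "P = {p. \<forall>i\<in>I. inner (a i) p \<le> b i}"
  have P: "closed P" "convex P" "P \<noteq> {}"
  proof -
    have eq: "P = (\<Inter>i\<in>I. {p. inner (a i) p \<le> b i})" by (auto simp: P_def)
    show "closed P" unfolding eq by (intro closed_INT ballI closed_halfspace_le)
    show "convex P" unfolding eq by (intro convex_INT ballI convex_halfspace_le)
    show "P \<noteq> {}" using ne by (auto simp: P_def)
  qed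
  have "\<exists>p\<in>P. u - p \<in> span (a ` I) \<and> norm (u - p) \<le> C * (\<Sum>i\<in>I. max 0 (inner (a i) u - b i))" for u
  proof -
    obtain p where p: "p \<in> P" "\<And>s. s \<in> P \<Longrightarrow> inner (u - p) (s - p) \<le> 0"
      using projection_exists[OF P] by metis
    define J where "J = {i\<in>I. inner (a i) p = b i}"
    have JI: "J \<subseteq> I" by (auto simp: J_def)
    \<comment> \<open>A direction admissible for the active constraints stays feasible for a short step.\<close>
    have dual: "inner (u - p) t \<le> 0" if t: "\<forall>i\<in>J. inner (a i) t \<le> 0" for t
    proof -
      have "\<exists>\<epsilon>>0. \<forall>\<epsilon>'. 0 < \<epsilon>' \<and> \<epsilon>' \<le> \<epsilon> \<longrightarrow> inner (a i) (p + \<epsilon>' *\<^sub>R t) \<le> b i"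
        if i: "i \<in> I" for i
      proof (cases "i \<in> J")
        case True
        then show ?thesis using t by (intro exI[of _ 1]) (auto simp: J_def inner_simps mult_nonneg_nonpos)
      next
        case False
        define g where "g = b i - inner (a i) p"
        have g: "g > 0" using False p(1) i by (auto simp: J_def P_def g_def less_le)
        define s where "s = \<bar>inner (a i) t\<bar> + 1"
        have s: "s > 0" "inner (a i) t \<le> s" by (auto simp: s_def)
        have *: "inner (a i) (p + \<epsilon>' *\<^sub>R t) \<le> b i" if "0 < \<epsilon>'" "\<epsilon>' \<le> g / s" for \<epsilon>'
        proof -
          have "\<epsilon>' * inner (a i) t \<le> \<epsilon>' * s" using that s by (intro mult_left_mono) auto
          also have "\<dots> \<le> g" using that s by (simp add: pos_le_divide_eq)
          finally show ?thesis by (simp add: inner_simps g_def)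
        qed
        then show ?thesis using g s by (intro exI[of _ "g / s"]) auto
      qed
      then have "\<exists>\<epsilon>. \<forall>i\<in>I. \<epsilon> i > 0 \<and> (\<forall>\<epsilon>'. 0 < \<epsilon>' \<and> \<epsilon>' \<le> \<epsilon> i \<longrightarrow> inner (a i) (p + \<epsilon>' *\<^sub>R t) \<le> b i)"
        by metis
      then obtain \<epsilon> where \<epsilon>: "\<And>i. i \<in> I \<Longrightarrow> \<epsilon> i > 0"
        "\<And>i \<epsilon>'. i \<in> I \<Longrightarrow> 0 < \<epsilon>' \<Longrightarrow> \<epsilon>' \<le> \<epsilon> i \<Longrightarrow> inner (a i) (p + \<epsilon>' *\<^sub>R t) \<le> b i" by metis
      define e where "e = Min (insert 1 (\<epsilon> ` I))"
      have e: "e > 0" "\<And>i. i \<in> I \<Longrightarrow> e \<le> \<epsilon> i"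
        using assms(1) \<epsilon>(1) by (auto simp: e_def)
      then have "p + e *\<^sub>R t \<in> P" using \<epsilon>(2) by (auto simp: P_def)
      from p(2)[OF this] e(1) show ?thesis by (simp add: mult_le_0_iff)
    qed
    have sp: "u - p \<in> span (a ` J)"
    proof -
      have "closed (span (a ` J))"
        by (intro closed_span_finite finite_imageI finite_subset[OF JI assms(1)])
      then obtain Q :: "'a \<Rightarrow>\<^sub>L 'a" where Q: "\<And>z. z - Q z \<in> span (a ` J)"
        "\<And>z s. s \<in> span (a ` J) \<Longrightarrow> inner (Q z) s = 0"
        using orthogonal_projection_exists[OF _ subspace_span] by metis
      have "inner (a i) (Q (u - p)) = 0" if "i \<in> J" for i
        using Q(2)[of "a i" "u - p"] that by (simp add: span_base inner_commute)
      then have "inner (u - p) (Q (u - p)) \<le> 0" by (intro dual) simp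
      moreover have "inner (Q (u - p)) (u - p - Q (u - p)) = 0" using Q by blast
      ultimately have "inner (Q (u - p)) (Q (u - p)) \<le> 0"
        by (simp add: inner_commute inner_diff_right)
      then have "Q (u - p) = 0" using inner_gt_zero_iff[of "Q (u - p)"] by fastforce
      then show ?thesis using Q(1)[of "u - p"] by simp
    qed
    have "u - p \<in> D J" using sp dual by (auto simp: D_def)
    have "norm (u - p) \<le> (1 / c J) * (\<Sum>i\<in>J. max 0 (inner (a i) (u - p)))"
      using c(2)[OF JI \<open>u - p \<in> D J\<close>] c(1)[OF JI] by (simp add: pos_le_divide_eq mult.commute)
    also have "(\<Sum>i\<in>J. max 0 (inner (a i) (u - p))) = (\<Sum>i\<in>J. max 0 (inner (a i) u - b i))"
      by (intro sum.cong) (auto simp: J_def inner_diff_right)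
    also have "(1 / c J) * (\<Sum>i\<in>J. max 0 (inner (a i) u - b i))
        \<le> C * (\<Sum>i\<in>I. max 0 (inner (a i) u - b i))"
      using JI assms(1) Cge[OF JI] C0 by (intro mult_mono sum_mono2 sum_nonneg) auto
    finally have "norm (u - p) \<le> C * (\<Sum>i\<in>I. max 0 (inner (a i) u - b i))" .
    moreover have "u - p \<in> span (a ` I)" using sp span_mono[OF image_mono[OF JI]] by blast
    ultimately show ?thesis using p(1) by blast
  qed
  then show ?thesis using C0 unfolding P_def by blast
qed

section \<open>Operators with closed range\<close>

text \<open>This is the open mapping theorem for the map onto its range. By Baire's theorem the closure of the
  image of some ball has interior points in the range; hence every \<open>y\<close> is, up to an error of half its
  size, the image of a vector of comparable norm. Iterating on the errors gives an absolutely
  convergent series of corrections, whose sum is an exact preimage.\<close>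

lemma bounded_preimage_of_closed_range:
  fixes A :: "'a::{real_normed_vector,complete_space} \<Rightarrow>\<^sub>L 'b::{real_normed_vector,complete_space}"
  assumes cl: "closed (range A)"
  shows "\<exists>C>0. \<forall>y\<in>range A. \<exists>x. A x = y \<and> norm x \<le> C * norm y"
proof -
  define M where "M = range A"
  define R where "R n = closure (A ` cball 0 (real n))" for n
  have sub: "subspace M" unfolding M_def
    by (intro linear_subspace_image subspace_UNIV blinfun.bounded_linear_right bounded_linear.linear)
  have RM: "R n \<subseteq> M" for n unfolding R_def M_def by (intro closure_minimal cl) auto
  have cover: "M \<subseteq> (\<Union>n. R n)"
  proof
    fix y assume "y \<in> M"
    then obtain x where x: "y = A x" by (auto simp: M_def)
    obtain n where "norm x \<le> real n" using real_arch_simple by blast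
    then have "y \<in> R n" unfolding R_def x by (intro subsetD[OF closure_subset] imageI) simp
    then show "y \<in> (\<Union>n. R n)" by blast
  qed
  have "\<exists>n. (top_of_set M) interior_of (R n) \<noteq> {}"
  proof (rule ccontr)
    assume *: "\<not> ?thesis"
    have "completely_metrizable_space (top_of_set M)"
      using cl completely_metrizable_space_closedin[OF completely_metrizable_space_euclidean]
      by (simp add: M_def)
    then have "(top_of_set M) interior_of (\<Union>(range R)) = {}"
      by (intro Baire_category_alt) (use * RM in \<open>auto simp: R_def intro!: closed_subset\<close>)
    moreover have "\<Union>(range R) = M" using RM cover by blast
    moreover have "(top_of_set M) interior_of M = M" using interior_of_topspace[of "top_of_set M"] by simp
    ultimately show False using subspace_0[OF sub] by auto
  qed
  then obtain n y0 where "y0 \<in> (top_of_set M) interior_of (R n)" by blast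
  then obtain T where T: "open T" "y0 \<in> T" "y0 \<in> M" "M \<inter> T \<subseteq> R n"
    unfolding interior_of_def openin_open by auto
  then obtain \<epsilon> where \<epsilon>: "\<epsilon> > 0" "ball y0 \<epsilon> \<subseteq> T" using open_contains_ball by blast
  have app: "\<exists>x. norm x \<le> 2 * real n \<and> norm (y - A x) \<le> \<eta>" if y: "y \<in> M" "norm y < \<epsilon>" and \<eta>: "\<eta> > 0" for y \<eta>
  proof -
    have y0: "y0 + y \<in> R n" "y0 \<in> R n"
      using y T \<epsilon> subspace_add[OF sub] by (auto simp: dist_norm subset_iff)
    have near: "\<exists>x. norm x \<le> real n \<and> norm (A x - z) < \<eta> / 2" if "z \<in> R n" for z
    proof -
      have "\<forall>e>0. \<exists>w\<in>A ` cball 0 (real n). dist w z < e"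
        using that unfolding R_def closure_approachable .
      from this[rule_format, OF half_gt_zero[OF \<eta>]]
      have "\<exists>w\<in>A ` cball 0 (real n). dist w z < \<eta> / 2" .
      then show ?thesis by (auto simp: dist_norm simp del: less_divide_eq_numeral1)
    qed
    obtain x1 where x1: "norm x1 \<le> real n" "norm (A x1 - (y0 + y)) < \<eta> / 2" using near[OF y0(1)] by blast
    obtain x2 where x2: "norm x2 \<le> real n" "norm (A x2 - y0) < \<eta> / 2" using near[OF y0(2)] by blast
    note x = x1 x2
    have "y - A (x1 - x2) = (A x2 - y0) - (A x1 - (y0 + y))" by (simp add: blinfun.bilinear_simps)
    then have "norm (y - A (x1 - x2)) \<le> norm (A x2 - y0) + norm (A x1 - (y0 + y))"
      using norm_triangle_ineq4 by metis
    moreover have "norm (x1 - x2) \<le> 2 * real n" using x norm_triangle_ineq4[of x1 x2] by linarith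
    ultimately show ?thesis using x by (intro exI[of _ "x1 - x2"]) auto
  qed
  define c where "c = (2 * real n) / (\<epsilon> / 2) + 1"
  have c: "c > 0" using \<epsilon> by (auto simp: c_def intro: add_nonneg_pos)
  have half: "\<exists>x. norm x \<le> c * norm y \<and> norm (y - A x) \<le> norm y / 2" if y: "y \<in> M" for y
  proof (cases "y = 0")
    case True
    then show ?thesis by (intro exI[of _ 0]) simp
  next
    case False
    define t where "t = (\<epsilon> / 2) / norm y"
    have t: "t > 0" using False \<epsilon> by (simp add: t_def)
    have "norm (t *\<^sub>R y) < \<epsilon>" using False \<epsilon> by (simp add: t_def)
    moreover have "t *\<^sub>R y \<in> M" using y sub by (simp add: subspace_scale)
    moreover have "t * norm y / 2 > 0" using t False by simp
    ultimately obtain x where x: "norm x \<le> 2 * real n" "norm (t *\<^sub>R y - A x) \<le> t * norm y / 2"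
      using app by blast
    have "y - A ((1 / t) *\<^sub>R x) = (1 / t) *\<^sub>R (t *\<^sub>R y - A x)"
      using t by (simp add: blinfun.bilinear_simps scaleR_diff_right)
    then have "norm (y - A ((1 / t) *\<^sub>R x)) = norm (t *\<^sub>R y - A x) / t" using t by simp
    also have "\<dots> \<le> norm y / 2" using x(2) t by (simp add: pos_divide_le_eq mult.commute)
    finally have 1: "norm (y - A ((1 / t) *\<^sub>R x)) \<le> norm y / 2" .
    have "norm ((1 / t) *\<^sub>R x) = norm x / t" using t by simp
    also have "\<dots> \<le> (2 * real n) / t" using x(1) t by (simp add: divide_right_mono)
    also have "\<dots> = (2 * real n) / (\<epsilon> / 2) * norm y" by (simp add: t_def)
    also have "\<dots> \<le> c * norm y" by (intro mult_right_mono) (auto simp: c_def)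
    finally show ?thesis using 1 by blast
  qed
  then obtain g where g: "\<And>y. y \<in> M \<Longrightarrow> norm (g y) \<le> c * norm y"
    "\<And>y. y \<in> M \<Longrightarrow> norm (y - A (g y)) \<le> norm y / 2" by metis
  have "\<exists>x. A x = y \<and> norm x \<le> (2 * c) * norm y" if y: "y \<in> M" for y
  proof -
    define r where "r k = ((\<lambda>z. z - A (g z)) ^^ k) y" for k
    have r0: "r 0 = y" and rS: "r (Suc k) = r k - A (g (r k))" for k by (auto simp: r_def)
    have rM: "r k \<in> M" for k
    proof (induction k)
      case (Suc k)
      have "A (g (r k)) \<in> M" by (simp add: M_def)
      then show ?case unfolding rS by (rule subspace_diff[OF sub Suc])
    qed (simp add: r0 y)
    have rn: "norm (r k) \<le> norm y * (1/2) ^ k" for k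
    proof (induction k)
      case (Suc k)
      then show ?case using g(2)[OF rM[of k]] by (simp add: rS)
    qed (simp add: r0)
    have gn: "norm (g (r k)) \<le> (c * norm y) * (1/2) ^ k" for k
    proof -
      have "norm (g (r k)) \<le> c * norm (r k)" by (rule g(1)[OF rM])
      also have "\<dots> \<le> c * (norm y * (1/2) ^ k)" using c rn by (intro mult_left_mono) auto
      finally show ?thesis by (simp add: mult.assoc)
    qed
    have geo: "(\<lambda>k. (c * norm y) * (1/2) ^ k) sums ((c * norm y) * 2)"
      using sums_mult[OF geometric_sums[of "1/2 :: real"], of "c * norm y"] by simp
    have sg: "summable (\<lambda>k. norm (g (r k)))"
      by (rule summable_comparison_test'[OF sums_summable[OF geo]]) (use gn in auto)
    define X where "X n = (\<Sum>k<n. g (r k))" for n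
    have AX: "A (X n) = y - r n" for n
      by (induction n) (simp_all add: X_def r0 rS blinfun.bilinear_simps)
    have "Cauchy X"
    proof (rule metric_CauchyI)
      fix e :: real assume "e > 0"
      then obtain N where N: "\<And>m n. m \<ge> N \<Longrightarrow> norm (\<Sum>k = m..<n. norm (g (r k))) < e"
        using sg unfolding summable_Cauchy by blast
      have "dist (X m) (X n) < e" if "N \<le> m" "m \<le> n" for m n
      proof -
        have "X n - X m = (\<Sum>k = m..<n. g (r k))"
          unfolding X_def using that by (simp add: lessThan_atLeast0 sum_diff_nat_ivl)
        then have "dist (X m) (X n) \<le> (\<Sum>k = m..<n. norm (g (r k)))"
          by (metis dist_commute dist_norm norm_sum)
        also have "\<dots> < e" using N[OF that(1), of n] by simp
        finally show ?thesis .
      qed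
      then show "\<exists>M. \<forall>m\<ge>M. \<forall>n\<ge>M. dist (X m) (X n) < e"
        by (metis dist_commute linorder_le_cases)
    qed
    then obtain x where x: "X \<longlonglongrightarrow> x" using Cauchy_convergent convergent_def by blast
    have "norm (X n) \<le> (c * norm y) * 2" for n
    proof -
      have "norm (X n) \<le> (\<Sum>k<n. norm (g (r k)))" unfolding X_def by (rule norm_sum)
      also have "\<dots> \<le> (\<Sum>k. norm (g (r k)))" by (rule sum_le_suminf[OF sg]) auto
      also have "\<dots> \<le> (c * norm y) * 2"
        using suminf_le[OF gn sg sums_summable[OF geo]] sums_unique[OF geo] by simp
      finally show ?thesis .
    qed
    then have nx: "norm x \<le> 2 * c * norm y"
      using LIMSEQ_le_const2[OF tendsto_norm[OF x], of "(c * norm y) * 2"] by (auto simp: mult_ac)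
    have "(\<lambda>k. norm y * (1/2) ^ k) \<longlonglongrightarrow> norm y * 0" by (intro tendsto_intros) auto
    then have "r \<longlonglongrightarrow> 0"
      using rn by (intro Lim_null_comparison[of r "\<lambda>k. norm y * (1/2) ^ k"]) auto
    then have "(\<lambda>n. A (X n)) \<longlonglongrightarrow> y - 0" unfolding AX by (intro tendsto_intros)
    moreover have "(\<lambda>n. A (X n)) \<longlonglongrightarrow> A x" by (intro tendsto_intros x)
    ultimately have "A x = y" using LIMSEQ_unique by fastforce
    then show ?thesis using nx by blast
  qed
  then show ?thesis using c unfolding M_def by (intro exI[of _ "2 * c"]) auto
qed

lemma abs_blinfun_form_le:
  fixes H :: "'x::real_normed_vector \<Rightarrow>\<^sub>L 'x \<Rightarrow>\<^sub>L real"
  shows "\<bar>H u v\<bar> \<le> norm H * norm u * norm v"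
proof -
  have "\<bar>H u v\<bar> \<le> norm (H u) * norm v" using norm_blinfun[of "H u" v] by simp
  also have "\<dots> \<le> norm H * norm u * norm v" by (intro mult_right_mono norm_blinfun) simp
  finally show ?thesis .
qed

text \<open>Split \<open>d\<close> into a kernel element and a vector \<open>w\<close> with the same image and norm of order \<open>norm (T d)\<close>; the
  mixed terms are absorbed by half of the coercivity and by the penalty.\<close>

lemma coercive_with_penalty:
  fixes T :: "'x::{real_normed_vector,complete_space} \<Rightarrow>\<^sub>L 'z::{real_normed_vector,complete_space}" and H :: "'x \<Rightarrow>\<^sub>L 'x \<Rightarrow>\<^sub>L real"
  assumes cl: "closed (range T)" and \<alpha>: "\<alpha> > 0"
    and ker: "\<And>d. T d = 0 \<Longrightarrow> \<alpha> * (norm d)\<^sup>2 \<le> H d d"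
  shows "\<exists>M>0. \<forall>d. \<alpha> / 2 * (norm d)\<^sup>2 \<le> H d d + M * (norm (T d))\<^sup>2"
proof -
  obtain C where C: "C > 0" "\<And>y. y \<in> range T \<Longrightarrow> \<exists>x. T x = y \<and> norm x \<le> C * norm y"
    using bounded_preimage_of_closed_range[OF cl] by blast
  define h where "h = norm H"
  define p where "p = 2 * h + \<alpha>"
  define M where "M = p\<^sup>2 / (2 * \<alpha>) + h + \<alpha> / 2"
  have h: "h \<ge> 0" by (simp add: h_def)
  have M: "M > 0" unfolding M_def using h \<alpha> by (intro add_nonneg_pos add_nonneg_nonneg) auto
  show ?thesis
  proof (intro exI[of _ "M * C\<^sup>2"] conjI allI)
    show "M * C\<^sup>2 > 0" using M C by simp
    fix d
    obtain w where w: "T w = T d" "norm w \<le> C * norm (T d)" using C(2) by blast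
    define v where "v = d - w"
    define a t where "a = norm v" and "t = norm w"
    have at: "a \<ge> 0" "t \<ge> 0" by (auto simp: a_def t_def)
    have "\<alpha> * a\<^sup>2 \<le> H v v" unfolding a_def by (rule ker) (simp add: v_def w blinfun.bilinear_simps)
    moreover have "H d d = H v v + H v w + H w v + H w w"
      by (simp add: v_def blinfun.bilinear_simps)
    moreover have "\<bar>H v w\<bar> \<le> h * a * t" "\<bar>H w v\<bar> \<le> h * a * t" "\<bar>H w w\<bar> \<le> h * t\<^sup>2"
      using abs_blinfun_form_le[of H v w] abs_blinfun_form_le[of H w v] abs_blinfun_form_le[of H w w]
      by (simp_all add: h_def a_def t_def mult_ac power2_eq_square)
    ultimately have 1: "\<alpha> * a\<^sup>2 - 2 * (h * a * t) - h * t\<^sup>2 \<le> H d d" by linarith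
    have "norm d \<le> a + t" using norm_triangle_ineq[of v w] by (simp add: v_def a_def t_def)
    then have "(norm d)\<^sup>2 \<le> (a + t)\<^sup>2" by (simp add: power_mono)
    then have "\<alpha> / 2 * (norm d)\<^sup>2 \<le> \<alpha> / 2 * (a + t)\<^sup>2" using \<alpha> by (intro mult_left_mono) auto
    also have "\<dots> \<le> \<alpha> * a\<^sup>2 - 2 * (h * a * t) - h * t\<^sup>2 + M * t\<^sup>2"
    proof -
      have "0 \<le> \<alpha> / 2 * (a - p / \<alpha> * t)\<^sup>2" using \<alpha> by simp
      also have "\<dots> = \<alpha> / 2 * a\<^sup>2 - p * a * t + p\<^sup>2 / (2 * \<alpha>) * t\<^sup>2"
        using \<alpha> by (simp add: power2_eq_square field_simps)
      finally show ?thesis by (simp add: M_def p_def power2_eq_square algebra_simps)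
    qed
    also have "\<dots> \<le> H d d + M * t\<^sup>2" using 1 by simp
    also have "t\<^sup>2 \<le> (C * norm (T d))\<^sup>2" using w(2) by (simp add: t_def power_mono)
    finally show "\<alpha> / 2 * (norm d)\<^sup>2 \<le> H d d + M * C\<^sup>2 * (norm (T d))\<^sup>2"
      using M by (simp add: power_mult_distrib mult_ac)
  qed
qed

text \<open>The constants serve every curvature and every constraint derivative near the given ones, hence all
  iterates close to the solution.\<close>

lemma coercive_with_penalty_stable:
  fixes A :: "'x::{real_normed_vector,complete_space} \<Rightarrow>\<^sub>L 'y::{real_normed_vector,complete_space}" and Q :: "'y \<Rightarrow>\<^sub>L 'y" and H :: "'x \<Rightarrow>\<^sub>L 'x \<Rightarrow>\<^sub>L real"
  assumes cl: "closed (range (Q o\<^sub>L A))" and \<alpha>: "\<alpha> > 0"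
    and ker: "\<forall>d. Q (A d) = 0 \<longrightarrow> \<alpha> * (norm d)\<^sup>2 \<le> H d d"
    and Q: "\<And>z. norm (Q z) \<le> norm z"
  shows "\<exists>\<gamma>>0. \<exists>N>0. \<exists>\<epsilon>>0. \<forall>B H'. norm (B - A) \<le> \<epsilon> \<longrightarrow> norm (H' - H) \<le> \<epsilon> \<longrightarrow>
    (\<forall>d. \<gamma> * (norm d)\<^sup>2 \<le> H' d d + N * (norm (Q (B d)))\<^sup>2)"
proof -
  obtain M where M: "M > 0" "\<And>d. \<alpha> / 2 * (norm d)\<^sup>2 \<le> H d d + M * (norm (Q (A d)))\<^sup>2"
    using coercive_with_penalty[OF cl \<alpha>, of H] ker unfolding blinfun_apply_blinfun_compose by blast
  define \<epsilon> where "\<epsilon> = min 1 (\<alpha> / (4 * (1 + 2 * M)))"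
  have \<epsilon>: "\<epsilon> > 0" "\<epsilon> \<le> 1" "\<epsilon> * (1 + 2 * M) \<le> \<alpha> / 4"
  proof -
    have "\<epsilon> \<le> \<alpha> / (4 * (1 + 2 * M))" by (simp add: \<epsilon>_def)
    then show "\<epsilon> * (1 + 2 * M) \<le> \<alpha> / 4" using M(1) by (simp add: field_simps)
  qed (use M(1) \<alpha> in \<open>auto simp: \<epsilon>_def\<close>)
  have "\<alpha> / 4 * (norm d)\<^sup>2 \<le> H' d d + 2 * M * (norm (Q (B d)))\<^sup>2"
    if B: "norm (B - A) \<le> \<epsilon>" and H': "norm (H' - H) \<le> \<epsilon>" for B H' d
  proof -
    have "\<bar>(H' - H) d d\<bar> \<le> norm (H' - H) * norm d * norm d" by (rule abs_blinfun_form_le)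
    also have "\<dots> \<le> \<epsilon> * norm d * norm d" by (intro mult_right_mono H') auto
    finally have 1: "H d d \<le> H' d d + \<epsilon> * (norm d)\<^sup>2"
      by (simp add: blinfun.bilinear_simps power2_eq_square)
    have "norm (Q ((A - B) d)) \<le> norm ((A - B) d)" by (rule Q)
    also have "\<dots> \<le> norm (A - B) * norm d" by (rule norm_blinfun)
    also have "\<dots> \<le> \<epsilon> * norm d" using B by (intro mult_right_mono) (auto simp: norm_minus_commute)
    finally have 2: "norm (Q ((A - B) d)) \<le> \<epsilon> * norm d" .
    have "Q (A d) = Q (B d) + Q ((A - B) d)" by (simp add: blinfun.bilinear_simps)
    then have "norm (Q (A d)) \<le> norm (Q (B d)) + \<epsilon> * norm d"
      using norm_triangle_ineq[of "Q (B d)" "Q ((A - B) d)"] 2 by simp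
    then have "(norm (Q (A d)))\<^sup>2 \<le> (norm (Q (B d)) + \<epsilon> * norm d)\<^sup>2" by (simp add: power_mono)
    also have "\<dots> \<le> 2 * (norm (Q (B d)))\<^sup>2 + 2 * (\<epsilon> * norm d)\<^sup>2"
      using sum_squares_bound[of "norm (Q (B d))" "\<epsilon> * norm d"] by (simp add: power2_sum)
    finally have "M * (norm (Q (A d)))\<^sup>2 \<le> 2 * M * (norm (Q (B d)))\<^sup>2 + 2 * M * (\<epsilon> * \<epsilon>) * (norm d)\<^sup>2"
      using mult_left_mono[of _ _ M] M(1) by (fastforce simp: power_mult_distrib power2_eq_square algebra_simps)
    also have "\<dots> \<le> 2 * M * (norm (Q (B d)))\<^sup>2 + 2 * M * (\<epsilon> * 1) * (norm d)\<^sup>2"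
      using \<epsilon> M(1) by (intro add_left_mono mult_right_mono mult_left_mono) auto
    finally have "\<alpha> / 2 * (norm d)\<^sup>2 \<le> H' d d + 2 * M * (norm (Q (B d)))\<^sup>2 + \<epsilon> * (1 + 2 * M) * (norm d)\<^sup>2"
      using M(2)[of d] 1 by (simp add: algebra_simps)
    moreover have "\<epsilon> * (1 + 2 * M) * (norm d)\<^sup>2 \<le> \<alpha> / 4 * (norm d)\<^sup>2" by (intro mult_right_mono \<epsilon>) simp
    ultimately show ?thesis by simp
  qed
  then show ?thesis using \<alpha> M(1) \<epsilon>(1)
    by (intro exI[of _ "\<alpha> / 4"] conjI exI[of _ "2 * M"] exI[of _ \<epsilon>]) auto
qed

text \<open>The range is the part of \<open>span B\<close> plus the range of \<open>A\<close> that \<open>Q\<close> fixes, and this sum is closed because one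
  summand is closed and the other has finite dimension.\<close>

lemma closed_range_projected:
  fixes A :: "'x::{real_inner,complete_space} \<Rightarrow>\<^sub>L 'y::{real_inner,complete_space}" and Q :: "'y \<Rightarrow>\<^sub>L 'y"
  assumes cl: "closed (range A)" and B: "finite B"
    and Q: "\<And>z. z - Q z \<in> span B" "\<And>s. s \<in> span B \<Longrightarrow> Q s = 0"
  shows "closed (range (Q o\<^sub>L A))"
proof -
  have spA: "span (range A) = range A"
    by (intro span_eq_iff[THEN iffD2] linear_subspace_image subspace_UNIV blinfun.bounded_linear_right bounded_linear.linear)
  have "range (Q o\<^sub>L A) = span (B \<union> range A) \<inter> {z. Q z = z}"
  proof safe
    fix x
    have "A x \<in> span (B \<union> range A)" "A x - Q (A x) \<in> span (B \<union> range A)"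
      using Q(1)[of "A x"] span_mono[of B "B \<union> range A"] by (auto intro: span_base)
    then have "A x - (A x - Q (A x)) \<in> span (B \<union> range A)" by (rule span_diff)
    then show "(Q o\<^sub>L A) x \<in> span (B \<union> range A)" by simp
    show "Q ((Q o\<^sub>L A) x) = (Q o\<^sub>L A) x"
      using Q(2)[OF Q(1)[of "A x"]] by (simp add: blinfun.bilinear_simps)
  next
    fix z assume "z \<in> span (B \<union> range A)" and Qz: "Q z = z"
    then obtain s x where "z = s + A x" "s \<in> span B" unfolding span_Un spA by auto
    then have "z = (Q o\<^sub>L A) x" using Qz Q(2)[of s] by (metis add_0 blinfun.add_right blinfun_apply_blinfun_compose)
    then show "z \<in> range (Q o\<^sub>L A)" by blast
  qed
  moreover have "closed {z. Q z = z}" by (intro closed_Collect_eq continuous_intros)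
  moreover have "closed (span (B \<union> range A))"
    using cl B by (intro closed_span_Un_finite) (simp_all add: spA)
  ultimately show ?thesis by (simp add: closed_Int)
qed

text \<open>First correct \<open>l\<close> so that the equation holds; as the range is closed, the correction \<open>z\<close> has norm of
  the order of the residual of the equation. This violates the inequalities by at most a multiple of
  \<open>norm z\<close>. Hoffman's bound for the inequalities alone, with normals projected onto the
  orthogonal complement of the range, then gives a correction that keeps the equation valid.\<close>

lemma multiplier_error_bound:
  fixes A :: "'x::{real_inner,complete_space} \<Rightarrow>\<^sub>L 'y::{real_inner,complete_space}" and ys :: "'i \<Rightarrow> 'y"
    and ls :: "'y \<Rightarrow>\<^sub>L real"
  assumes cl: "closed (range A)" and "finite I" and ls: "\<forall>i\<in>I. ls (ys i) \<le> 0"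
  shows "\<exists>C\<ge>0. \<forall>l :: 'y \<Rightarrow>\<^sub>L real. (\<forall>i\<in>I. blinfun_apply l (ys i) \<le> 0) \<longrightarrow>
    (\<exists>m :: 'y \<Rightarrow>\<^sub>L real. (\<forall>i\<in>I. blinfun_apply m (ys i) \<le> 0) \<and> (m - ls) o\<^sub>L A = 0 \<and> norm (l - m) \<le> C * norm ((l - ls) o\<^sub>L A))"
proof -
  have "subspace (range A)"
    by (intro linear_subspace_image subspace_UNIV blinfun.bounded_linear_right bounded_linear.linear)
  then obtain P :: "'y \<Rightarrow>\<^sub>L 'y" where P: "\<And>z. z - P z \<in> range A" "\<And>z x. inner (P z) (A x) = 0"
    using orthogonal_projection_exists[OF cl] by blast
  obtain CA where CA: "CA > 0" "\<And>y. y \<in> range A \<Longrightarrow> \<exists>x. A x = y \<and> norm x \<le> CA * norm y"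
    using bounded_preimage_of_closed_range[OF cl] by blast
  define us where "us = riesz ls"
  define a where "a i = P (ys i)" for i
  have Pswap: "inner (P y) n = inner y n" if n: "\<And>x. inner n (A x) = 0" for y n
  proof -
    obtain x where "y - P y = A x" using P(1)[of y] by auto
    then have "inner n (y - P y) = 0" using n by simp
    then show ?thesis by (simp add: inner_diff_right inner_commute)
  qed
  define b where "b i = - inner (ys i) us" for i
  have "\<exists>p. \<forall>i\<in>I. inner (a i) p \<le> b i"
    using ls by (intro exI[of _ 0]) (simp add: b_def us_def inner_riesz inner_commute)
  then obtain C where C: "C \<ge> 0" "\<And>u. \<exists>p. (\<forall>i\<in>I. inner (a i) p \<le> b i) \<and> u - p \<in> span (a ` I) \<and>
    norm (u - p) \<le> C * (\<Sum>i\<in>I. max 0 (inner (a i) u - b i))"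
    using hoffman[OF \<open>finite I\<close>, of a b] by blast
  define S where "S = (\<Sum>i\<in>I. norm (ys i))"
  have S0: "S \<ge> 0" by (simp add: S_def sum_nonneg)
  have "\<exists>m :: 'y \<Rightarrow>\<^sub>L real. (\<forall>i\<in>I. blinfun_apply m (ys i) \<le> 0) \<and> (m - ls) o\<^sub>L A = 0 \<and>
    norm (l - m) \<le> ((1 + C * S) * CA) * norm ((l - ls) o\<^sub>L A)" if l: "\<forall>i\<in>I. blinfun_apply l (ys i) \<le> 0"
    for l :: "'y \<Rightarrow>\<^sub>L real"
  proof -
    define u n0 where "u = riesz l" and "n0 = P (u - us)"
    define z where "z = (u - us) - n0"
    define t where "t = norm ((l - ls) o\<^sub>L A)"
    have n0: "inner n0 (A x) = 0" for x using P(2) by (simp add: n0_def)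
    obtain x where x: "A x = z" "norm x \<le> CA * norm z" using CA(2)[of z] P(1)[of "u - us"] by (auto simp: z_def n0_def)
    have "(norm z)\<^sup>2 = inner z (A x)" by (simp add: x power2_norm_eq_inner)
    also have "\<dots> = ((l - ls) o\<^sub>L A) x"
      using n0[of x] by (simp add: z_def inner_diff_left u_def us_def inner_riesz blinfun.bilinear_simps)
    also have "\<dots> \<le> t * norm x" using norm_blinfun[of "(l - ls) o\<^sub>L A" x] by (simp add: t_def)
    also have "\<dots> \<le> t * (CA * norm z)" by (intro mult_left_mono x) (simp add: t_def)
    finally have "norm z * norm z \<le> (CA * t) * norm z" by (simp add: power2_eq_square mult_ac)
    then have z: "norm z \<le> CA * t" using CA(1) by (cases "z = 0") (auto simp: t_def)
    obtain n where n: "\<forall>i\<in>I. inner (a i) n \<le> b i" "n0 - n \<in> span (a ` I)"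
      "norm (n0 - n) \<le> C * (\<Sum>i\<in>I. max 0 (inner (a i) n0 - b i))" using C(2)[of n0] by blast
    have nA: "inner n (A x) = 0" for x
    proof -
      have "subspace {y. inner y (A x) = 0}" by (auto simp: subspace_def inner_add_left)
      then have "span (a ` I) \<subseteq> {y. inner y (A x) = 0}"
        by (intro span_minimal) (auto simp: a_def P(2))
      then have "inner (n0 - n) (A x) = 0" using n(2) by blast
      then show ?thesis using n0[of x] by (simp add: inner_diff_left)
    qed
    define m where "m = blinfun_inner_right (us + n)"
    have "m (ys i) \<le> 0" if "i \<in> I" for i
      using bspec[OF n(1) that] Pswap[OF nA, of "ys i"] by (simp add: m_def a_def b_def inner_add_left inner_add_right inner_commute)
    moreover have "(m - ls) o\<^sub>L A = 0"
      by (rule blinfun_eqI) (simp add: m_def blinfun.bilinear_simps us_def inner_add_left inner_riesz nA)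
    moreover have "norm (l - m) \<le> ((1 + C * S) * CA) * t"
    proof -
      have "(\<Sum>i\<in>I. max 0 (inner (a i) n0 - b i)) \<le> (\<Sum>i\<in>I. norm (ys i) * norm z)"
      proof (rule sum_mono)
        fix i assume i: "i \<in> I"
        have "inner (a i) n0 - b i = inner (ys i) (n0 + us)"
          using Pswap[OF n0, of "ys i"] by (simp add: a_def b_def inner_add_right)
        also have "n0 + us = u - z" by (simp add: z_def)
        also have "inner (ys i) (u - z) \<le> - inner (ys i) z"
          using l i by (simp add: inner_diff_right u_def inner_riesz inner_commute)
        also have "\<dots> \<le> norm (ys i) * norm z" using Cauchy_Schwarz_ineq2[of "ys i" z] by simp
        finally show "max 0 (inner (a i) n0 - b i) \<le> norm (ys i) * norm z" by simp
      qed
      also have "\<dots> = S * norm z" by (simp add: S_def sum_distrib_right)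
      finally have "norm (n0 - n) \<le> C * (S * norm z)" using n(3) mult_left_mono[OF _ C(1)] order_trans by blast
      moreover have "norm (l - m) = norm (z + (n0 - n))"
        using norm_riesz[of "l - m"] by (simp add: riesz_diff m_def z_def u_def algebra_simps)
      ultimately have "norm (l - m) \<le> norm z + C * (S * norm z)"
        using norm_triangle_ineq[of z "n0 - n"] by linarith
      also have "\<dots> = (1 + C * S) * norm z" by (simp add: algebra_simps)
      also have "\<dots> \<le> (1 + C * S) * (CA * t)" using C(1) S0 by (intro mult_left_mono z) auto
      finally show ?thesis by (simp add: mult.assoc)
    qed
    ultimately show ?thesis unfolding t_def by blast
  qed
  then show ?thesis using C(1) S0 CA(1) by (intro exI[of _ "(1 + C * S) * CA"]) auto
qed

section \<open>Derivatives of the Lagrangian\<close>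

lemma fderiv_apply_eq:
  assumes "(g has_derivative g') (at x)"
  shows "blinfun_apply (fderiv g x) = g'"
  unfolding fderiv_def frechet_derivative_at[OF assms, symmetric]
  by (rule bounded_linear_Blinfun_apply[OF has_derivative_bounded_linear[OF assms]])

lemma has_derivative_fderiv:
  assumes "g differentiable (at x)"
  shows "(g has_derivative blinfun_apply (fderiv g x)) (at x)"
  using assms fderiv_apply_eq unfolding differentiable_def by metis

lemma quadratic_remainder:
  fixes F :: "'a::real_normed_vector \<Rightarrow> 'b::real_normed_vector"
  assumes der: "\<And>x. (F has_derivative blinfun_apply (F' x)) (at x)"
    and lip: "C-lipschitz_on (ball z r) F'"
    and xy: "x \<in> ball z r" "y \<in> ball z r"
  shows "norm (F y - F x - F' x (y - x)) \<le> C * (norm (y - x))\<^sup>2"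
proof -
  have seg: "closed_segment x y \<subseteq> ball z r"
    using xy by (intro closed_segment_subset convex_ball)
  have "norm (F y - F x - F' x (y - x)) \<le> norm (y - x) * (C * norm (y - x))"
  proof (rule differentiable_bound_linearization[where S = "closed_segment x y" and f' = "\<lambda>u. blinfun_apply (F' u)"])
    show "x + t *\<^sub>R (y - x) \<in> closed_segment x y" if "t \<in> {0..1}" for t
      using that unfolding in_segment by (intro exI[of _ t]) (auto simp: algebra_simps)
    show "(F has_derivative blinfun_apply (F' u)) (at u within closed_segment x y)" for u
      by (rule has_derivative_at_withinI[OF der])
    show "onorm (blinfun_apply (F' u) - blinfun_apply (F' x)) \<le> C * norm (y - x)"
      if "u \<in> closed_segment x y" for u
    proof -
      have "blinfun_apply (F' u) - blinfun_apply (F' x) = blinfun_apply (F' u - F' x)"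
        by (simp add: fun_eq_iff blinfun.diff_left)
      then have "onorm (blinfun_apply (F' u) - blinfun_apply (F' x)) = norm (F' u - F' x)"
        by (simp add: norm_blinfun.rep_eq)
      also have "\<dots> \<le> C * norm (u - x)"
        using lipschitz_onD[OF lip, of u x] that seg xy by (auto simp: dist_norm)
      also have "\<dots> \<le> C * norm (y - x)"
        using segment_bound(1)[OF that] lipschitz_on_nonneg[OF lip] by (intro mult_left_mono) (auto simp: norm_minus_commute)
      finally show ?thesis .
    qed
  qed simp
  then show ?thesis by (simp add: power2_eq_square mult_ac)
qed

lemma lipschitz_of_lipschitz_derivative:
  fixes F :: "'a::real_normed_vector \<Rightarrow> 'b::real_normed_vector"
  assumes der: "\<And>x. (F has_derivative blinfun_apply (F' x)) (at x)"
    and lip: "C-lipschitz_on (ball z r) F'" and "r > 0"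
  shows "(norm (F' z) + C * r)-lipschitz_on (ball z r) F"
proof (rule lipschitz_onI)
  have C: "C \<ge> 0" using lip by (rule lipschitz_on_nonneg)
  show "0 \<le> norm (F' z) + C * r" using C \<open>r > 0\<close> by simp
  fix x y assume xy: "x \<in> ball z r" "y \<in> ball z r"
  have "norm (F x - F y) \<le> (norm (F' z) + C * r) * norm (x - y)"
  proof (rule differentiable_bound[OF convex_ball _ _ xy])
    show "(F has_derivative blinfun_apply (F' u)) (at u within ball z r)" for u
      by (rule has_derivative_at_withinI[OF der])
    show "onorm (blinfun_apply (F' u)) \<le> norm (F' z) + C * r" if "u \<in> ball z r" for u
    proof -
      have "norm (F' u) \<le> norm (F' z) + norm (F' u - F' z)" by (rule norm_triangle_sub)
      also have "norm (F' u - F' z) \<le> C * norm (u - z)"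
        using lipschitz_onD[OF lip, of u z] that \<open>r > 0\<close> by (auto simp: dist_norm)
      also have "C * norm (u - z) \<le> C * r"
        using that C by (intro mult_left_mono) (auto simp: dist_norm norm_minus_commute)
      finally show ?thesis by (simp add: norm_blinfun.rep_eq)
    qed
  qed
  then show "dist (F x) (F y) \<le> (norm (F' z) + C * r) * dist x y" by (simp add: dist_norm)
qed

lemma twice_lipschitz_local_estimates:
  fixes g :: "'a::real_normed_vector \<Rightarrow> 'b::real_normed_vector"
  assumes "twice_lipschitz_differentiable g"
  shows "\<exists>r>0. \<exists>C\<ge>0. \<forall>x\<in>ball z r. \<forall>y\<in>ball z r.
    norm (fderiv (fderiv g) x - fderiv (fderiv g) y) \<le> C * norm (x - y) \<and>
    norm (fderiv g x - fderiv g y) \<le> C * norm (x - y) \<and>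
    norm (g y - g x - fderiv g x (y - x)) \<le> C * (norm (y - x))\<^sup>2 \<and>
    norm (fderiv g y - fderiv g x - fderiv (fderiv g) x (y - x)) \<le> C * (norm (y - x))\<^sup>2"
proof -
  have d1: "(g has_derivative blinfun_apply (fderiv g x)) (at x)"
    and d2: "(fderiv g has_derivative blinfun_apply (fderiv (fderiv g) x)) (at x)" for x
    using assms by (auto simp: twice_lipschitz_differentiable_def intro: has_derivative_fderiv)
  obtain r C where r: "r > 0" and C2: "C-lipschitz_on (ball z r) (fderiv (fderiv g))"
    using assms unfolding twice_lipschitz_differentiable_def locally_lipschitz_def by blast
  define C' where "C' = norm (fderiv (fderiv g) z) + C * r"
  have C1: "C'-lipschitz_on (ball z r) (fderiv g)"
    unfolding C'_def by (rule lipschitz_of_lipschitz_derivative[OF d2 C2 r])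
  define D where "D = max C C'"
  have D1: "D-lipschitz_on (ball z r) (fderiv g)" and D2: "D-lipschitz_on (ball z r) (fderiv (fderiv g))"
    using lipschitz_on_le[OF C1] lipschitz_on_le[OF C2] by (auto simp: D_def)
  have "D \<ge> 0" using D1 by (rule lipschitz_on_nonneg)
  then show ?thesis
    using r lipschitz_onD[OF D1] lipschitz_onD[OF D2] quadratic_remainder[OF d1 D1] quadratic_remainder[OF d2 D2]
    unfolding dist_norm by blast
qed

text \<open>By the mean value theorem the second difference is a difference of first derivatives at two points
  near \<open>x\<close> that differ by \<open>s *\<^sub>R u\<close>, and these are linear up to a small error.\<close>

lemma second_difference_quotient:
  fixes g :: "'a::real_normed_vector \<Rightarrow> real"
  assumes d1: "\<And>y. (g has_derivative blinfun_apply (g' y)) (at y)"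
    and d2: "(g' has_derivative blinfun_apply B) (at x)" and "\<epsilon> > 0"
  shows "\<exists>\<delta>>0. \<forall>s. 0 < s \<and> s < \<delta> \<longrightarrow>
    \<bar>g (x + s *\<^sub>R u + s *\<^sub>R v) - g (x + s *\<^sub>R u) - g (x + s *\<^sub>R v) + g x - s\<^sup>2 * B u v\<bar> \<le> \<epsilon> * s\<^sup>2"
proof -
  define n where "n = norm u + norm v + 1"
  have n: "n > 0" "norm u + norm v \<le> n" "norm v \<le> n" by (auto simp: n_def intro: add_nonneg_pos)
  define \<eta> where "\<eta> = \<epsilon> / (2 * n * n)"
  have "\<eta> > 0" using n \<open>\<epsilon> > 0\<close> by (simp add: \<eta>_def)
  then obtain \<delta> where \<delta>: "\<delta> > 0" "\<And>y. norm (y - x) < \<delta> \<Longrightarrow> norm (g' y - g' x - B (y - x)) \<le> \<eta> * norm (y - x)"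
    using d2 unfolding has_derivative_at_alt by blast
  show ?thesis
  proof (intro exI[of _ "\<delta> / n"] conjI allI impI)
    show "\<delta> / n > 0" using \<delta> n by simp
    fix s assume s: "0 < s \<and> s < \<delta> / n"
    then have sn: "s * n < \<delta>" using n by (simp add: pos_less_divide_eq)
    define p where "p r = g (x + s *\<^sub>R u + r *\<^sub>R s *\<^sub>R v) - g (x + r *\<^sub>R s *\<^sub>R v)" for r
    have "\<exists>\<xi>\<in>{0<..<1}. p 1 - p 0 =
      (\<lambda>h. g' (x + s *\<^sub>R u + \<xi> *\<^sub>R s *\<^sub>R v) (h *\<^sub>R s *\<^sub>R v) - g' (x + \<xi> *\<^sub>R s *\<^sub>R v) (h *\<^sub>R s *\<^sub>R v)) (1 - 0)"
      unfolding p_def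
      by (rule mvt_simple[OF zero_less_one]) (auto intro!: derivative_eq_intros has_derivative_compose[OF _ d1])
    then obtain \<xi> where \<xi>: "0 < \<xi>" "\<xi> < 1"
      and eq: "p 1 - p 0 = g' (x + s *\<^sub>R u + \<xi> *\<^sub>R s *\<^sub>R v) (s *\<^sub>R v) - g' (x + \<xi> *\<^sub>R s *\<^sub>R v) (s *\<^sub>R v)"
      by auto
    define w1 w2 where "w1 = s *\<^sub>R u + \<xi> *\<^sub>R s *\<^sub>R v" and "w2 = \<xi> *\<^sub>R s *\<^sub>R v"
    define E1 E2 where "E1 = g' (x + w1) - g' x - B w1" and "E2 = g' (x + w2) - g' x - B w2"
    have xiv: "norm (\<xi> *\<^sub>R s *\<^sub>R v) \<le> s * norm v"
      using \<xi> s by (simp add: mult_left_le_one_le)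
    have "norm w1 \<le> norm (s *\<^sub>R u) + norm (\<xi> *\<^sub>R s *\<^sub>R v)" unfolding w1_def by (rule norm_triangle_ineq)
    also have "\<dots> \<le> s * norm u + s * norm v" using xiv s by simp
    also have "\<dots> = s * (norm u + norm v)" by (simp add: algebra_simps)
    also have "\<dots> \<le> s * n" using s n by (intro mult_left_mono) auto
    finally have w1: "norm w1 \<le> s * n" .
    have "norm w2 \<le> s * norm v" using xiv by (simp add: w2_def)
    also have "\<dots> \<le> s * n" using s n by (intro mult_left_mono) auto
    finally have w2: "norm w2 \<le> s * n" .
    have E: "norm E1 \<le> \<eta> * (s * n)" "norm E2 \<le> \<eta> * (s * n)"
    proof -
      have "norm E1 \<le> \<eta> * norm w1" "norm E2 \<le> \<eta> * norm w2"
        using \<delta>(2)[of "x + w1"] \<delta>(2)[of "x + w2"] w1 w2 sn by (auto simp: E1_def E2_def)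
      moreover have "\<eta> * norm w1 \<le> \<eta> * (s * n)" "\<eta> * norm w2 \<le> \<eta> * (s * n)"
        using w1 w2 \<open>\<eta> > 0\<close> by (auto intro: mult_left_mono)
      ultimately show "norm E1 \<le> \<eta> * (s * n)" "norm E2 \<le> \<eta> * (s * n)" by linarith+
    qed
    have "g' (x + w1) - g' (x + w2) = E1 - E2 + B (w1 - w2)"
      by (simp add: E1_def E2_def blinfun.bilinear_simps)
    also have "w1 - w2 = s *\<^sub>R u" by (simp add: w1_def w2_def)
    finally have "p 1 - p 0 = (E1 - E2 + B (s *\<^sub>R u)) (s *\<^sub>R v)"
      unfolding eq by (simp add: w1_def w2_def add.assoc blinfun.diff_left[symmetric] del: blinfun.scaleR_right)
    then have "p 1 - p 0 - s\<^sup>2 * B u v = (E1 - E2) (s *\<^sub>R v)"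
      by (simp add: blinfun.bilinear_simps power2_eq_square algebra_simps)
    also have "\<bar>\<dots>\<bar> \<le> norm (E1 - E2) * norm (s *\<^sub>R v)"
      using norm_blinfun[of "E1 - E2" "s *\<^sub>R v"] by simp
    also have "\<dots> \<le> (2 * (\<eta> * (s * n))) * (s * n)"
    proof (rule mult_mono)
      show "norm (E1 - E2) \<le> 2 * (\<eta> * (s * n))" using E norm_triangle_ineq4[of E1 E2] by linarith
      show "norm (s *\<^sub>R v) \<le> s * n" using s n by (simp add: mult_left_mono)
    qed (use s n \<open>\<eta> > 0\<close> in auto)
    also have "\<dots> = \<epsilon> * s\<^sup>2" using n by (simp add: \<eta>_def power2_eq_square)
    finally show "\<bar>g (x + s *\<^sub>R u + s *\<^sub>R v) - g (x + s *\<^sub>R u) - g (x + s *\<^sub>R v) + g x - s\<^sup>2 * B u v\<bar> \<le> \<epsilon> * s\<^sup>2"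
      by (simp add: p_def algebra_simps)
  qed
qed

text \<open>The second difference quotient is symmetric in its two directions, and it tends to both values.\<close>

lemma second_derivative_symmetric:
  fixes g :: "'a::real_normed_vector \<Rightarrow> real"
  assumes d1: "\<And>y. (g has_derivative blinfun_apply (g' y)) (at y)"
    and d2: "(g' has_derivative blinfun_apply B) (at x)"
  shows "B u v = B v u"
proof -
  have "\<bar>B u v - B v u\<bar> \<le> 0 + \<epsilon>" if "\<epsilon> > 0" for \<epsilon>
  proof -
    define \<Delta> where "\<Delta> s = g (x + s *\<^sub>R u + s *\<^sub>R v) - g (x + s *\<^sub>R u) - g (x + s *\<^sub>R v) + g x" for s
    from that have e2: "\<epsilon> / 2 > 0" by simp
    obtain \<delta>1 where \<delta>1: "\<delta>1 > 0" "\<And>s. 0 < s \<and> s < \<delta>1 \<Longrightarrow> \<bar>\<Delta> s - s\<^sup>2 * B u v\<bar> \<le> \<epsilon> / 2 * s\<^sup>2"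
      using second_difference_quotient[OF d1 d2 e2, of u v] unfolding \<Delta>_def by blast
    have sw: "\<Delta> s = g (x + s *\<^sub>R v + s *\<^sub>R u) - g (x + s *\<^sub>R v) - g (x + s *\<^sub>R u) + g x" for s
      by (simp add: \<Delta>_def algebra_simps)
    obtain \<delta>2 where \<delta>2: "\<delta>2 > 0" "\<And>s. 0 < s \<and> s < \<delta>2 \<Longrightarrow> \<bar>\<Delta> s - s\<^sup>2 * B v u\<bar> \<le> \<epsilon> / 2 * s\<^sup>2"
      using second_difference_quotient[OF d1 d2 e2, of v u] unfolding sw by blast
    define s where "s = min \<delta>1 \<delta>2 / 2"
    have s: "0 < s" "s < \<delta>1" "s < \<delta>2" using \<delta>1(1) \<delta>2(1) by (auto simp: s_def)
    have "\<bar>s\<^sup>2 * B u v - s\<^sup>2 * B v u\<bar> \<le> \<epsilon> * s\<^sup>2"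
      using \<delta>1(2)[of s] \<delta>2(2)[of s] s by linarith
    also have "s\<^sup>2 * B u v - s\<^sup>2 * B v u = s\<^sup>2 * (B u v - B v u)" by (simp add: algebra_simps)
    finally show ?thesis using s by (simp add: abs_mult)
  qed
  then have "\<bar>B u v - B v u\<bar> \<le> 0" by (rule field_le_epsilon)
  then show ?thesis by simp
qed

context
  fixes f :: "'x::real_normed_vector \<Rightarrow> real" and G :: "'x \<Rightarrow> 'y::real_normed_vector"
  assumes f: "twice_lipschitz_differentiable f" and G: "twice_lipschitz_differentiable G"
begin

lemma lagrangian_derivatives:
  shows lagrangian_x_eq: "lagrangian_x f G x l = fderiv f x + (l o\<^sub>L fderiv G x)"
    and lagrangian_xx_apply:
      "lagrangian_xx f G x l d = fderiv (fderiv f) x d + (l o\<^sub>L fderiv (fderiv G) x d)"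
    and lagrangian_has_derivative:
      "((\<lambda>z. lagrangian f G z l) has_derivative blinfun_apply (lagrangian_x f G x l)) (at x)"
    and lagrangian_x_has_derivative:
      "((\<lambda>z. lagrangian_x f G z l) has_derivative blinfun_apply (lagrangian_xx f G x l)) (at x)"
proof -
  have d1: "(f has_derivative blinfun_apply (fderiv f x)) (at x)"
    "(G has_derivative blinfun_apply (fderiv G x)) (at x)"
    and d2: "(fderiv f has_derivative blinfun_apply (fderiv (fderiv f) x)) (at x)"
    "(fderiv G has_derivative blinfun_apply (fderiv (fderiv G) x)) (at x)" for x
    using f G by (auto simp: twice_lipschitz_differentiable_def intro: has_derivative_fderiv)
  have 1: "((\<lambda>z. lagrangian f G z l) has_derivative blinfun_apply (fderiv f x + (l o\<^sub>L fderiv G x))) (at x)" for x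
    unfolding lagrangian_def
    by (rule has_derivative_eq_rhs[OF has_derivative_add[OF d1(1)
        bounded_linear.has_derivative[OF blinfun.bounded_linear_right d1(2)]]])
      (simp add: fun_eq_iff blinfun.bilinear_simps)
  show lx: "lagrangian_x f G x l = fderiv f x + (l o\<^sub>L fderiv G x)" for x
    unfolding lagrangian_x_def using fderiv_apply_eq[OF 1] by (simp add: blinfun_apply_inject)
  show "((\<lambda>z. lagrangian f G z l) has_derivative blinfun_apply (lagrangian_x f G x l)) (at x)"
    using 1 by (simp add: lx)
  have 2: "((\<lambda>z. lagrangian_x f G z l) has_derivative
      (\<lambda>d. fderiv (fderiv f) x d + (l o\<^sub>L fderiv (fderiv G) x d))) (at x)"
    unfolding lx
    by (intro has_derivative_add d2 bounded_linear.has_derivative[OF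
        bounded_bilinear.bounded_linear_right[OF bounded_bilinear_blinfun_compose]])
  show 3: "lagrangian_xx f G x l d = fderiv (fderiv f) x d + (l o\<^sub>L fderiv (fderiv G) x d)" for d
    unfolding lagrangian_xx_def fderiv_apply_eq[OF 2] ..
  show "((\<lambda>z. lagrangian_x f G z l) has_derivative blinfun_apply (lagrangian_xx f G x l)) (at x)"
    using 2 unfolding 3[abs_def, symmetric] .
qed

lemma lagrangian_xx_symmetric: "lagrangian_xx f G x l u v = lagrangian_xx f G x l v u"
  by (rule second_derivative_symmetric[OF lagrangian_has_derivative lagrangian_x_has_derivative])

text \<open>The last two estimates expand from the current point \<open>x\<close> towards \<open>xs\<close>, with derivatives taken at \<open>x\<close>, as
  the linearization in the algorithm does.\<close>

lemma lagrangian_local_estimates: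
  shows "\<exists>R>0. \<exists>C>0. \<forall>x l. norm (x - xs) < R \<longrightarrow> norm (l - ls) < R \<longrightarrow>
    norm (fderiv G x - fderiv G xs) \<le> C * norm (x - xs) \<and>
    norm (lagrangian_xx f G x l - lagrangian_xx f G xs ls) \<le> C * (norm (x - xs) + norm (l - ls)) \<and>
    norm (G xs - G x - fderiv G x (xs - x)) \<le> C * (norm (x - xs))\<^sup>2 \<and>
    norm (lagrangian_x f G xs l - lagrangian_x f G x l - lagrangian_xx f G x l (xs - x))
      \<le> C * (norm (x - xs))\<^sup>2"
proof -
  obtain r1 C1 where r1: "r1 > 0" "C1 \<ge> 0" and f_est: "\<And>x y. x \<in> ball xs r1 \<Longrightarrow> y \<in> ball xs r1 \<Longrightarrow>
    norm (fderiv (fderiv f) x - fderiv (fderiv f) y) \<le> C1 * norm (x - y) \<and>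
    norm (fderiv f y - fderiv f x - fderiv (fderiv f) x (y - x)) \<le> C1 * (norm (y - x))\<^sup>2"
    using twice_lipschitz_local_estimates[OF f, of xs] by meson
  obtain r2 C2 where r2: "r2 > 0" "C2 \<ge> 0" and G_est: "\<And>x y. x \<in> ball xs r2 \<Longrightarrow> y \<in> ball xs r2 \<Longrightarrow>
    norm (fderiv (fderiv G) x - fderiv (fderiv G) y) \<le> C2 * norm (x - y) \<and>
    norm (fderiv G x - fderiv G y) \<le> C2 * norm (x - y) \<and>
    norm (G y - G x - fderiv G x (y - x)) \<le> C2 * (norm (y - x))\<^sup>2 \<and>
    norm (fderiv G y - fderiv G x - fderiv (fderiv G) x (y - x)) \<le> C2 * (norm (y - x))\<^sup>2"
    using twice_lipschitz_local_estimates[OF G, of xs] by meson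
  define L where "L = norm ls + 1"
  define R where "R = min 1 (min r1 r2)"
  define N where "N = norm (fderiv (fderiv G) xs)"
  define C where "C = C1 + C2 + L * C2 + N + 1"
  have nn: "L \<ge> 0" "N \<ge> 0" "L * C2 \<ge> 0" using r2 by (auto simp: L_def N_def)
  show ?thesis
  proof (rule exI[of _ R], intro conjI exI[of _ C] allI impI)
    show "R > 0" using r1 r2 by (simp add: R_def)
    show "C > 0" unfolding C_def using r1 r2 nn by linarith
    fix x l assume x: "norm (x - xs) < R" and l: "norm (l - ls) < R"
    have xb: "x \<in> ball xs r1" "x \<in> ball xs r2" "xs \<in> ball xs r1" "xs \<in> ball xs r2"
      using x r1 r2 by (auto simp: R_def dist_norm norm_minus_commute)
    have nl: "norm l \<le> L" using l norm_triangle_sub[of l ls] by (simp add: L_def R_def)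
    define e where "e = norm (x - xs)"
    have e: "e \<ge> 0" "norm (xs - x) = e" by (auto simp: e_def norm_minus_commute)
    have le: "C2 * t \<le> C * t" "(C1 + L * C2) * t \<le> C * t" "N * t \<le> C * t" if "t \<ge> 0" for t
      using that r1 r2 nn by (auto simp: C_def intro!: mult_right_mono)
    show "norm (fderiv G x - fderiv G xs) \<le> C * norm (x - xs)"
      using G_est[OF xb(2,4)] le(1)[of e] e by (simp add: e_def)
    show "norm (G xs - G x - fderiv G x (xs - x)) \<le> C * (norm (x - xs))\<^sup>2"
      using G_est[OF xb(2,4)] le(1)[of "e\<^sup>2"] e by (simp add: e_def norm_minus_commute)
    show "norm (lagrangian_xx f G x l - lagrangian_xx f G xs ls) \<le> C * (norm (x - xs) + norm (l - ls))"
    proof (rule norm_blinfun_bound)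
      show "0 \<le> C * (norm (x - xs) + norm (l - ls))" using \<open>C > 0\<close> by simp
      fix d
      define a where "a = fderiv (fderiv f) x - fderiv (fderiv f) xs"
      define b where "b = fderiv (fderiv G) x - fderiv (fderiv G) xs"
      have "(lagrangian_xx f G x l - lagrangian_xx f G xs ls) d
        = a d + (l o\<^sub>L b d) + ((l - ls) o\<^sub>L fderiv (fderiv G) xs d)"
        by (rule blinfun_eqI) (simp add: lagrangian_xx_apply a_def b_def blinfun.bilinear_simps)
      also have "norm \<dots> \<le> norm (a d) + norm (l o\<^sub>L b d) + norm ((l - ls) o\<^sub>L fderiv (fderiv G) xs d)"
        by (intro norm_triangle_le add_mono norm_triangle_ineq order_refl)
      also have "\<dots> \<le> norm a * norm d + norm l * (norm b * norm d) + norm (l - ls) * (N * norm d)"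
        unfolding N_def
        by (intro add_mono norm_blinfun order_trans[OF norm_blinfun_compose] mult_left_mono) auto
      also have "\<dots> \<le> (C1 * e) * norm d + L * ((C2 * e) * norm d) + norm (l - ls) * (N * norm d)"
        using f_est[OF xb(1,3)] G_est[OF xb(2,4)] nl nn(1)
        by (intro add_mono mult_mono mult_right_mono order_refl) (auto simp: a_def b_def e_def)
      also have "\<dots> = ((C1 + L * C2) * e + N * norm (l - ls)) * norm d" by (simp add: algebra_simps)
      also have "\<dots> \<le> (C * e + C * norm (l - ls)) * norm d"
        using le(2)[OF e(1)] le(3)[of "norm (l - ls)"] by (intro mult_right_mono[OF add_mono]) auto
      finally show "norm ((lagrangian_xx f G x l - lagrangian_xx f G xs ls) d)
          \<le> C * (norm (x - xs) + norm (l - ls)) * norm d" by (simp add: e_def algebra_simps)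
    qed
    define a where "a = fderiv f xs - fderiv f x - fderiv (fderiv f) x (xs - x)"
    define b where "b = fderiv G xs - fderiv G x - fderiv (fderiv G) x (xs - x)"
    have "lagrangian_x f G xs l - lagrangian_x f G x l - lagrangian_xx f G x l (xs - x) = a + (l o\<^sub>L b)"
      by (rule blinfun_eqI) (simp add: lagrangian_xx_apply lagrangian_x_eq a_def b_def blinfun.bilinear_simps)
    also have "norm \<dots> \<le> norm a + norm l * norm b"
      by (intro norm_triangle_le add_mono order_refl norm_blinfun_compose)
    also have "\<dots> \<le> C1 * e\<^sup>2 + L * (C2 * e\<^sup>2)"
      using f_est[OF xb(1,3)] G_est[OF xb(2,4)] nl nn(1) e
      by (intro add_mono mult_mono) (auto simp: a_def b_def)
    also have "\<dots> = (C1 + L * C2) * e\<^sup>2" by (simp add: algebra_simps)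
    also have "\<dots> \<le> C * e\<^sup>2" by (rule le) simp
    finally show "norm (lagrangian_x f G xs l - lagrangian_x f G x l - lagrangian_xx f G x l (xs - x))
      \<le> C * (norm (x - xs))\<^sup>2" by (simp add: e_def)
  qed
qed

end

section \<open>The stabilized subproblem\<close>

lemma complementarity_monotone:
  assumes "l1 \<in> polar_cone K" "l2 \<in> polar_cone K" "w1 \<in> K \<inter> annihilator l1" "w2 \<in> K \<inter> annihilator l2"
  shows "blinfun_apply (l1 - l2) (w1 - w2) \<ge> 0"
proof -
  have "l1 w2 \<le> 0" "l2 w1 \<le> 0" "l1 w1 = 0" "l2 w2 = 0"
    using assms by (auto simp: polar_cone_def annihilator_def)
  then show ?thesis by (simp add: blinfun.bilinear_simps)
qed

text \<open>Moreau's decomposition. The projection is onto the polar cone; that the residual lies in \<open>K\<close> itself, and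
  not only in its bipolar, is where closedness of \<open>K\<close> matters.\<close>

lemma polar_projection_exists:
  fixes K :: "'y::{real_inner,complete_space} set"
  assumes "closed K" "convex_cone K"
  shows "\<exists>pr. \<forall>z. pr z \<in> polar_cone K \<and> z - riesz (pr z) \<in> K \<inter> annihilator (pr z)"
proof -
  define C where "C = {u. \<forall>k\<in>K. inner u k \<le> 0}"
  have "C = (\<Inter>k\<in>K. {u. inner k u \<le> 0})" by (auto simp: C_def inner_commute)
  then have C: "closed C" "convex C"
    by (auto intro!: closed_INT convex_INT closed_halfspace_le convex_halfspace_le)
  have C0: "0 \<in> C" by (simp add: C_def)
  obtain P where P: "\<And>z. P z \<in> C" "\<And>z s. s \<in> C \<Longrightarrow> inner (z - P z) (s - P z) \<le> 0"
    using projection_exists[OF C] C0 by (metis empty_iff)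
  have "inner (z - P z) (P z) = 0" for z
  proof -
    have "2 *\<^sub>R P z \<in> C" using P(1)[of z] by (auto simp: C_def)
    from P(2)[OF C0, of z] P(2)[OF this, of z] show ?thesis by (simp add: scaleR_2)
  qed
  moreover have "z - P z \<in> K" for z
  proof (rule bipolar[OF assms])
    fix u assume "\<And>k. k \<in> K \<Longrightarrow> inner u k \<le> 0"
    then have "u \<in> C" by (simp add: C_def)
    from P(2)[OF this, of z] calculation[of z] show "inner u (z - P z) \<le> 0"
      by (simp add: inner_diff_right inner_commute)
  qed
  moreover have "blinfun_inner_right (P z) \<in> polar_cone K" for z
    using P(1)[of z] by (simp add: C_def polar_cone_def)
  ultimately show ?thesis
    by (intro exI[of _ "\<lambda>z. blinfun_inner_right (P z)"]) (simp add: annihilator_def inner_commute)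
qed

text \<open>For a small step size \<open>\<tau>\<close> the map \<open>s \<mapsto> s - \<tau> F s\<close> is a contraction.\<close>

lemma strongly_monotone_lipschitz_zero:
  fixes F :: "'x::{real_inner,complete_space} \<Rightarrow> 'x"
  assumes \<kappa>: "\<kappa> > 0" and mono: "\<And>s t. \<kappa> * (norm (s - t))\<^sup>2 \<le> inner (F s - F t) (s - t)"
    and lip: "\<And>s t. norm (F s - F t) \<le> L * norm (s - t)" and "L \<ge> 0"
  shows "\<exists>s. F s = 0"
proof -
  define M where "M = L + \<kappa>"
  define \<tau> where "\<tau> = \<kappa> / M\<^sup>2"
  have M: "M > 0" "L \<le> M" "\<kappa> \<le> M" using \<kappa> \<open>L \<ge> 0\<close> by (auto simp: M_def)
  have \<tau>: "\<tau> > 0" using \<kappa> M by (simp add: \<tau>_def)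
  define c where "c = sqrt (1 - \<kappa>\<^sup>2 / M\<^sup>2)"
  have le1: "\<kappa>\<^sup>2 / M\<^sup>2 \<le> 1" "\<kappa>\<^sup>2 / M\<^sup>2 > 0" using M \<kappa> by (auto simp: power_mono)
  then have c: "0 \<le> c" "c < 1" "c\<^sup>2 = 1 - \<kappa>\<^sup>2 / M\<^sup>2" by (auto simp: c_def)
  define T where "T s = s - \<tau> *\<^sub>R F s" for s
  have "dist (T s) (T t) \<le> c * dist s t" for s t
  proof (rule power2_le_imp_le)
    define g w where "g = s - t" and "w = F s - F t"
    have "T s - T t = g - \<tau> *\<^sub>R w" by (simp add: T_def g_def w_def scaleR_diff_right)
    then have "(dist (T s) (T t))\<^sup>2 = (norm (g - \<tau> *\<^sub>R w))\<^sup>2" by (simp only: dist_norm)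
    also have "\<dots> = (norm g)\<^sup>2 - 2 * \<tau> * inner w g + \<tau>\<^sup>2 * (norm w)\<^sup>2"
      by (simp add: power2_norm_eq_inner inner_diff_left inner_diff_right inner_commute
          power2_eq_square[of \<tau>] algebra_simps)
    also have "\<dots> \<le> (norm g)\<^sup>2 - 2 * \<tau> * (\<kappa> * (norm g)\<^sup>2) + \<tau>\<^sup>2 * (M * norm g)\<^sup>2"
    proof -
      have "norm w \<le> M * norm g"
        using lip[of s t] mult_right_mono[OF M(2), of "norm g"] by (simp add: g_def w_def)
      then have "(norm w)\<^sup>2 \<le> (M * norm g)\<^sup>2" by (simp add: power_mono)
      then have "\<tau>\<^sup>2 * (norm w)\<^sup>2 \<le> \<tau>\<^sup>2 * (M * norm g)\<^sup>2" by (rule mult_left_mono) simp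
      moreover have "2 * \<tau> * (\<kappa> * (norm g)\<^sup>2) \<le> 2 * \<tau> * inner w g"
        using mono[of s t] \<tau> by (intro mult_left_mono) (auto simp: g_def w_def)
      ultimately show ?thesis by linarith
    qed
    also have "\<dots> = c\<^sup>2 * (norm g)\<^sup>2"
      using M(1) unfolding c \<tau>_def by (simp add: field_simps power2_eq_square)
    finally show "(dist (T s) (T t))\<^sup>2 \<le> (c * dist s t)\<^sup>2"
      by (simp add: g_def dist_norm power_mult_distrib)
  qed (use c in simp)
  then have "\<exists>!s. T s = s" using banach_fix_type[of c T] c by blast
  then obtain s where "T s = s" by blast
  then show ?thesis using \<tau> by (auto simp: T_def)
qed

text \<open>One step of the method, written in the increment \<open>s\<close> of the primal variable: \<open>b\<close>, \<open>c\<close>, \<open>B\<close> and \<open>H\<close> stand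
  for \<open>f'(x\<^sub>k)\<close>, \<open>G(x\<^sub>k)\<close>, \<open>G'(x\<^sub>k)\<close> and the Hessian of the Lagrangian, \<open>l0\<close> for \<open>\<lambda>\<^sub>k\<close>. The operator \<open>Q\<close> is an
  orthogonal projection that annihilates \<open>K\<close>; the last assumption is the coercivity of curvature plus
  penalty.\<close>

locale stabilized_subproblem =
  fixes K :: "'y::{real_inner,complete_space} set" and Q :: "'y \<Rightarrow>\<^sub>L 'y"
    and B :: "'x::{real_inner,complete_space} \<Rightarrow>\<^sub>L 'y" and H :: "'x \<Rightarrow>\<^sub>L 'x \<Rightarrow>\<^sub>L real"
    and b :: "'x \<Rightarrow>\<^sub>L real" and c :: 'y and l0 :: "'y \<Rightarrow>\<^sub>L real" and \<rho> \<kappa> :: real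
  assumes K: "closed K" "convex_cone K"
    and Q_zero: "\<And>k. k \<in> K \<Longrightarrow> Q k = 0"
    and Q_orth: "\<And>z k. k \<in> K \<Longrightarrow> inner (Q z) k = 0"
    and Q_inner: "\<And>z. inner (Q z) z = (norm (Q z))\<^sup>2"
    and norm_Q_le: "\<And>z. norm (Q z) \<le> norm z"
    and \<rho>: "\<rho> > 0" and \<kappa>: "\<kappa> > 0"
    and coercive: "\<And>d. \<kappa> * (norm d)\<^sup>2 \<le> H d d + (norm (Q (B d)))\<^sup>2 / \<rho>"
begin

definition solves :: "'x \<Rightarrow> ('y \<Rightarrow>\<^sub>L real) \<Rightarrow> bool"
  where "solves s l \<longleftrightarrow> l \<in> polar_cone K \<and> b + (l o\<^sub>L B) + H s = 0 \<and>
    c + B s - \<rho> *\<^sub>R riesz (l - l0) \<in> K \<inter> annihilator l"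

definition L :: "'x \<Rightarrow> ('y \<Rightarrow>\<^sub>L real) \<Rightarrow> real"
  where "L s l = b s + 1/2 * H s s + l (c + B s) - \<rho>/2 * (norm (l - l0))\<^sup>2"

lemma K_scale: "k \<in> K \<Longrightarrow> t \<ge> 0 \<Longrightarrow> t *\<^sub>R k \<in> K"
  using K(2) by (rule convex_cone_scaleR)

text \<open>Complementarity makes the multiplier a monotone function of the primal variable. As \<open>Q\<close> annihilates \<open>K\<close>,
  the \<open>Q\<close>-part of the multiplier difference is \<open>Q (B (s1 - s2))\<close> divided by \<open>\<rho>\<close>, so this
  monotonicity supplies at least the penalty term.\<close>

lemma strong_monotonicity:
  assumes l: "l1 \<in> polar_cone K" "l2 \<in> polar_cone K"
    and w: "c + B s1 - \<rho> *\<^sub>R riesz (l1 - l0) \<in> K \<inter> annihilator l1"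
      "c + B s2 - \<rho> *\<^sub>R riesz (l2 - l0) \<in> K \<inter> annihilator l2"
  shows "\<rho> * (norm (l1 - l2))\<^sup>2 \<le> (l1 - l2) (B (s1 - s2))"
    and "\<kappa> * (norm (s1 - s2))\<^sup>2 \<le> H (s1 - s2) (s1 - s2) + (l1 - l2) (B (s1 - s2))"
proof -
  define w1 w2 where "w1 = c + B s1 - \<rho> *\<^sub>R riesz (l1 - l0)" and "w2 = c + B s2 - \<rho> *\<^sub>R riesz (l2 - l0)"
  define g m where "g = s1 - s2" and "m = l1 - l2"
  have dw: "w1 - w2 = B g - \<rho> *\<^sub>R riesz m"
    by (simp add: w1_def w2_def g_def m_def riesz_diff blinfun.bilinear_simps scaleR_diff_right)
  have "0 \<le> m (w1 - w2)"
    unfolding m_def w1_def w2_def by (rule complementarity_monotone[OF l w])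
  also have "\<dots> = m (B g) - \<rho> * (norm m)\<^sup>2"
    unfolding dw by (simp add: blinfun.bilinear_simps apply_riesz_self)
  finally show 1: "\<rho> * (norm (l1 - l2))\<^sup>2 \<le> (l1 - l2) (B (s1 - s2))"
    by (simp add: m_def g_def)
  have "Q w1 = 0" "Q w2 = 0" using w by (auto simp: Q_zero w1_def w2_def)
  then have "Q (w1 - w2) = 0" by (simp add: blinfun.bilinear_simps)
  then have "Q (B g) = \<rho> *\<^sub>R Q (riesz m)" unfolding dw by (simp add: blinfun.bilinear_simps)
  then have "(norm (Q (B g)))\<^sup>2 / \<rho> = \<rho> * (norm (Q (riesz m)))\<^sup>2"
    using \<rho> by (simp add: power_mult_distrib power2_eq_square)
  also have "\<dots> \<le> \<rho> * (norm m)\<^sup>2"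
    using norm_Q_le[of "riesz m"] \<rho> by (simp add: power_mono)
  finally show "\<kappa> * (norm (s1 - s2))\<^sup>2 \<le> H (s1 - s2) (s1 - s2) + (l1 - l2) (B (s1 - s2))"
    using 1 coercive[of g] by (simp add: m_def g_def)
qed

lemma solution_unique:
  assumes "solves s1 l1" "solves s2 l2"
  shows "s1 = s2" "l1 = l2"
proof -
  have e: "b g + l1 (B g) + H s1 g = 0" "b g + l2 (B g) + H s2 g = 0" for g
    using assms unfolding solves_def by (metis blinfun.add_left blinfun_apply_blinfun_compose zero_blinfun.rep_eq)+
  have "H (s1 - s2) (s1 - s2) + (l1 - l2) (B (s1 - s2)) = 0"
    using e[of "s1 - s2"] by (simp add: blinfun.diff_left blinfun.diff_right[of H])
  with strong_monotonicity[of l1 l2 s1 s2] assms have "\<kappa> * (norm (s1 - s2))\<^sup>2 \<le> 0"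
    by (simp add: solves_def)
  then show s: "s1 = s2" using \<kappa> by (simp add: mult_le_0_iff)
  from strong_monotonicity(1)[of l1 l2 s1 s2] assms have "\<rho> * (norm (l1 - l2))\<^sup>2 \<le> 0"
    by (simp add: solves_def s)
  then show "l1 = l2" using \<rho> by (simp add: mult_le_0_iff)
qed

text \<open>For every \<open>s\<close> the multiplier is the projection of \<open>l0\<close> plus the scaled constraint value onto the polar
  cone.\<close>

lemma multiplier_exists: "\<exists>l. l \<in> polar_cone K \<and> c + B s - \<rho> *\<^sub>R riesz (l - l0) \<in> K \<inter> annihilator l"
proof -
  obtain pr where pr: "\<And>z. pr z \<in> polar_cone K" "\<And>z. z - riesz (pr z) \<in> K \<inter> annihilator (pr z)"
    using polar_projection_exists[OF K] by metis
  define z where "z = riesz l0 + (1 / \<rho>) *\<^sub>R (c + B s)"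
  have "c + B s - \<rho> *\<^sub>R riesz (pr z - l0) = \<rho> *\<^sub>R (z - riesz (pr z))"
    using \<rho> by (simp add: z_def riesz_diff algebra_simps)
  also have "\<dots> \<in> K \<inter> annihilator (pr z)"
    using pr(2)[of z] \<rho> K_scale by (auto simp: annihilator_def blinfun.bilinear_simps)
  finally show ?thesis using pr(1) by blast
qed

lemma solution_exists: "\<exists>s l. solves s l"
proof -
  obtain lam where lam: "\<And>s. lam s \<in> polar_cone K"
    "\<And>s. c + B s - \<rho> *\<^sub>R riesz (lam s - l0) \<in> K \<inter> annihilator (lam s)"
    using multiplier_exists by metis
  note mono = strong_monotonicity[OF lam(1) lam(1) lam(2) lam(2)]
  define F where "F s = riesz (b + (lam s o\<^sub>L B) + H s)" for s
  define M where "M = norm B / \<rho> * norm B + norm H"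
  have dF: "F s - F t = riesz (((lam s - lam t) o\<^sub>L B) + H (s - t))" for s t
    unfolding F_def riesz_diff[symmetric]
    by (rule arg_cong[where f = riesz]) (rule blinfun_eqI, simp add: blinfun.bilinear_simps)
  have "\<exists>s. F s = 0"
  proof (rule strongly_monotone_lipschitz_zero[OF \<kappa>])
    fix s t
    show "\<kappa> * (norm (s - t))\<^sup>2 \<le> inner (F s - F t) (s - t)"
      using mono(2)[of s t] by (simp add: dF inner_riesz blinfun.bilinear_simps)
    have "\<rho> * (norm (lam s - lam t) * norm (lam s - lam t)) \<le> (lam s - lam t) (B (s - t))"
      using mono(1)[of s t] by (simp add: power2_eq_square)
    also have "\<dots> \<le> norm (lam s - lam t) * norm (B (s - t))"
      using norm_blinfun[of "lam s - lam t" "B (s - t)"] by simp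
    also have "\<dots> \<le> norm (lam s - lam t) * (norm B * norm (s - t))"
      by (intro mult_left_mono norm_blinfun) simp
    finally have "\<rho> * norm (lam s - lam t) \<le> norm B * norm (s - t)"
      by (cases "lam s = lam t") (simp_all add: algebra_simps)
    then have lamle: "norm (lam s - lam t) \<le> norm B / \<rho> * norm (s - t)"
      using \<rho> by (simp add: field_simps)
    have "norm (F s - F t) \<le> norm ((lam s - lam t) o\<^sub>L B) + norm (H (s - t))"
      unfolding dF norm_riesz by (rule norm_triangle_ineq)
    also have "\<dots> \<le> norm (lam s - lam t) * norm B + norm H * norm (s - t)"
      by (intro add_mono norm_blinfun norm_blinfun_compose)
    also have "\<dots> \<le> (norm B / \<rho> * norm (s - t)) * norm B + norm H * norm (s - t)"
      by (intro add_mono mult_right_mono lamle) auto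
    also have "\<dots> = M * norm (s - t)" by (simp add: M_def algebra_simps)
    finally show "norm (F s - F t) \<le> M * norm (s - t)" .
  next
    show "M \<ge> 0" using \<rho> by (simp add: M_def)
  qed
  then obtain s where "F s = 0" by blast
  then have "b + (lam s o\<^sub>L B) + H s = 0" unfolding F_def by (metis norm_riesz norm_eq_zero)
  then show ?thesis using lam[of s] unfolding solves_def by blast
qed

text \<open>\<open>L\<close> is strongly concave in the multiplier, and complementarity makes its linear part at \<open>l\<close> nonpositive on
  the polar cone.\<close>

lemma maximizer_gap:
  assumes l: "l \<in> polar_cone K" "c + B s - \<rho> *\<^sub>R riesz (l - l0) \<in> K \<inter> annihilator l"
    and l': "l' \<in> polar_cone K"
  shows "L s l' + \<rho>/2 * (norm (l' - l))\<^sup>2 \<le> L s l"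
proof -
  define w where "w = c + B s - \<rho> *\<^sub>R riesz (l - l0)"
  have w: "l w = 0" "l' w \<le> 0" using l l' by (auto simp: w_def annihilator_def polar_cone_def)
  define m n where "m = riesz (l' - l)" and "n = riesz (l - l0)"
  have "l' - l0 = (l' - l) + (l - l0)" by simp
  then have mn: "norm (l' - l0) = norm (m + n)" "norm (l' - l) = norm m" "norm (l - l0) = norm n"
    unfolding m_def n_def by (metis norm_riesz riesz_add)+
  have "inner m w \<le> 0" using w by (simp add: m_def inner_riesz blinfun.bilinear_simps)
  then have "inner m (c + B s) - \<rho> * inner m n \<le> 0" by (simp add: w_def n_def inner_diff_right)
  moreover have "inner m (c + B s) = l' (c + B s) - l (c + B s)" by (simp add: m_def inner_riesz blinfun.bilinear_simps)
  moreover have "(norm (m + n))\<^sup>2 = (norm m)\<^sup>2 + 2 * inner m n + (norm n)\<^sup>2"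
    by (simp add: power2_norm_eq_inner inner_add_left inner_add_right inner_commute)
  then have "\<rho>/2 * (norm (m + n))\<^sup>2 = \<rho>/2 * (norm m)\<^sup>2 + \<rho> * inner m n + \<rho>/2 * (norm n)\<^sup>2"
    by (simp add: algebra_simps)
  ultimately show ?thesis unfolding L_def mn by linarith
qed

lemma unique_maximizer_L:
  assumes "l \<in> polar_cone K" "c + B s - \<rho> *\<^sub>R riesz (l - l0) \<in> K \<inter> annihilator l"
  shows "unique_maximizer (L s) (polar_cone K) l"
  unfolding unique_maximizer_def
proof (intro allI iffI)
  fix l' assume "is_arg_max (L s) (\<lambda>l. l \<in> polar_cone K) l'"
  then have l': "l' \<in> polar_cone K" "\<not> L s l' < L s l" using assms by (auto simp: is_arg_max_def)
  then have "\<rho>/2 * (norm (l' - l))\<^sup>2 \<le> 0" using maximizer_gap[OF assms l'(1)] by linarith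
  then show "l' = l" using \<rho> by (simp add: mult_le_0_iff)
next
  fix l' assume [simp]: "l' = l"
  have "\<not> L s l < L s m" if "m \<in> polar_cone K" for m
  proof -
    have "0 \<le> \<rho>/2 * (norm (m - l))\<^sup>2" using \<rho> by simp
    then show ?thesis using maximizer_gap[OF assms that] by linarith
  qed
  then show "is_arg_max (L s) (\<lambda>l. l \<in> polar_cone K) l'" using assms by (auto simp: is_arg_max_def)
qed

text \<open>The functional \<open>l\<close> moves the solution's multiplier along the range of \<open>Q\<close>, which does not leave the polar cone.
  By stationarity the increase of \<open>L\<close> is half of curvature plus penalty, hence nonnegative. Symmetry of
  \<open>H\<close> is what makes the equation in \<open>solves\<close> a stationarity condition for \<open>L\<close>.\<close>

lemma attained_above_solution:
  assumes sol: "solves s0 m" and sym: "\<And>u v. H u v = H v u"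
  shows "\<exists>l\<in>polar_cone K. L s0 m \<le> L s l"
proof -
  define g where "g = s - s0"
  define \<eta> where "\<eta> = (1 / \<rho>) *\<^sub>R Q (B g)"
  define w where "w = c + B s0 - \<rho> *\<^sub>R riesz (m - l0)"
  define l where "l = m + blinfun_inner_right \<eta>"
  have m: "m \<in> polar_cone K" "w \<in> K" and eq: "b + (m o\<^sub>L B) + H s0 = 0"
    using sol by (auto simp: solves_def w_def)
  have orth: "inner \<eta> k = 0" if "k \<in> K" for k using Q_orth[OF that] by (simp add: \<eta>_def)
  have "l \<in> polar_cone K"
    using m orth by (simp add: l_def polar_cone_def blinfun.bilinear_simps)
  moreover have "L s0 m \<le> L s l"
  proof -
    have s: "s = s0 + g" by (simp add: g_def)
    have eqg: "b g + m (B g) + H s0 g = 0"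
      using arg_cong[OF eq, of "\<lambda>u. blinfun_apply u g"] by (simp add: blinfun.bilinear_simps)
    have Hs: "H s s = H s0 s0 + 2 * H s0 g + H g g"
      unfolding s by (simp add: blinfun.bilinear_simps sym[of g s0])
    have "riesz (l - l0) = riesz (m - l0) + \<eta>" by (simp add: l_def riesz_diff riesz_add)
    then have "(norm (l - l0))\<^sup>2 = (norm (riesz (m - l0) + \<eta>))\<^sup>2" using norm_riesz[of "l - l0"] by simp
    also have "\<dots> = (norm (riesz (m - l0)))\<^sup>2 + 2 * inner \<eta> (riesz (m - l0)) + (norm \<eta>)\<^sup>2"
      by (simp add: power2_norm_eq_inner inner_add_left inner_add_right inner_commute del: norm_riesz)
    finally have nl: "(norm (l - l0))\<^sup>2 = (norm (m - l0))\<^sup>2 + 2 * inner \<eta> (riesz (m - l0)) + (norm \<eta>)\<^sup>2"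
      by (simp only: norm_riesz)
    have "inner \<eta> w = 0" by (rule orth[OF m(2)])
    then have wz: "inner \<eta> (c + B s0) = \<rho> * inner \<eta> (riesz (m - l0))"
      by (simp add: w_def inner_diff_right)
    have ee: "inner \<eta> (B g) = \<rho> * (norm \<eta>)\<^sup>2"
      using \<rho> Q_inner[of "B g"] by (simp add: \<eta>_def power_mult_distrib power2_eq_square)
    have lv: "l (c + B s) = m (c + B s0) + m (B g) + inner \<eta> (c + B s0) + inner \<eta> (B g)"
      unfolding s l_def by (simp add: blinfun.bilinear_simps inner_add_right)
    have "L s l - L s0 m = 1/2 * (H g g + \<rho> * (norm \<eta>)\<^sup>2)"
      unfolding L_def Hs nl lv wz ee using eqg
      by (simp add: s blinfun.add_right algebra_simps)
    moreover have "\<rho> * (norm \<eta>)\<^sup>2 = (norm (Q (B g)))\<^sup>2 / \<rho>"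
      using \<rho> by (simp add: \<eta>_def power_mult_distrib power2_eq_square)
    moreover have "0 \<le> \<kappa> * (norm g)\<^sup>2" using \<kappa> by simp
    ultimately show ?thesis using coercive[of g] by simp
  qed
  ultimately show ?thesis by blast
qed

lemma solution_minimizes_max:
  assumes sol: "solves s0 m" and sym: "\<And>u v. H u v = H v u"
  shows "(SUP l\<in>polar_cone K. L s0 l) \<le> (SUP l\<in>polar_cone K. L s l)"
proof -
  obtain l1 where l1: "l1 \<in> polar_cone K" "L s0 m \<le> L s l1"
    using attained_above_solution[OF assms] by blast
  obtain l2 where l2: "l2 \<in> polar_cone K" "c + B s - \<rho> *\<^sub>R riesz (l2 - l0) \<in> K \<inter> annihilator l2"
    using multiplier_exists by blast
  have le: "L s l \<le> L s l2" if "l \<in> polar_cone K" for l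
  proof -
    have "0 \<le> \<rho>/2 * (norm (l - l2))\<^sup>2" using \<rho> by simp
    then show ?thesis using maximizer_gap[OF l2 that] by linarith
  qed
  have le0: "L s0 l \<le> L s0 m" if "l \<in> polar_cone K" for l
  proof -
    have "0 \<le> \<rho>/2 * (norm (l - m))\<^sup>2" using \<rho> by simp
    then show ?thesis using maximizer_gap[of m s0 l] that sol unfolding solves_def by linarith
  qed
  have "(SUP l\<in>polar_cone K. L s0 l) \<le> L s0 m"
    using l1 le0 by (intro cSUP_least) auto
  also have "\<dots> \<le> L s l1" by (rule l1(2))
  also have "\<dots> \<le> (SUP l\<in>polar_cone K. L s l)"
    using l1(1) le by (intro cSUP_upper bdd_aboveI2[where M = "L s l2"])
  finally show ?thesis .
qed

end

section \<open>Energy estimates\<close>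

text \<open>Test the equation with \<open>h\<close>: complementarity bounds \<open>u (B h)\<close> from below by \<open>\<rho> (norm u)\<^sup>2\<close> up to
  errors, and the penalty is at most a multiple of \<open>\<rho>\<^sup>2 (norm u)\<^sup>2\<close> up to errors, which is absorbed because
  \<open>N \<rho>\<close> is small. All products are then split by Young's inequality. In the application \<open>u\<close> is the
  new multiplier minus the multiplier nearest to the old one, \<open>v\<close> is the old multiplier
  minus that nearest one, and \<open>h\<close> is the new primal error.\<close>

lemma a_priori_multiplier_estimate:
  fixes H :: "'x::real_normed_vector \<Rightarrow>\<^sub>L 'x \<Rightarrow>\<^sub>L real" and B :: "'x \<Rightarrow>\<^sub>L 'y::{real_inner,complete_space}"
    and Q :: "'y \<Rightarrow>\<^sub>L 'y" and u v :: "'y \<Rightarrow>\<^sub>L real"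
  assumes \<gamma>: "\<gamma> > 0" and N: "N > 0" and \<rho>: "\<rho> > 0" "\<rho> \<le> 1" "6 * N * \<rho> \<le> 1"
    and Q: "\<And>z. norm (Q z) \<le> norm z"
    and coercive: "\<gamma> * (norm h)\<^sup>2 \<le> H h h + N * (norm (Q (B h)))\<^sup>2"
    and eq: "(u o\<^sub>L B) + H h = r1"
    and w: "u (B h + r2 - \<rho> *\<^sub>R riesz (u - v)) \<ge> 0" "Q (B h + r2 - \<rho> *\<^sub>R riesz (u - v)) = 0"
  shows "\<rho> * norm u \<le> (10 + 1 / \<gamma>) * (norm r1 + norm r2 + \<rho> * norm v)"
proof -
  define U a b d where "U = norm u" and "a = norm r1" and "b = norm r2" and "d = norm v"
  have nn: "U \<ge> 0" "a \<ge> 0" "b \<ge> 0" "d \<ge> 0" by (auto simp: U_def a_def b_def d_def)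
  have "u (B h) + H h h = r1 h" using eq by (metis blinfun.add_left blinfun_apply_blinfun_compose)
  moreover have "r1 h \<le> a * norm h" using norm_blinfun[of r1 h] by (simp add: a_def)
  moreover have "u (B h) + u r2 - \<rho> * (U\<^sup>2 - v (riesz u)) \<ge> 0"
  proof -
    have "u (riesz v) = v (riesz u)" by (metis inner_riesz inner_commute)
    then show ?thesis using w(1) by (simp add: blinfun.bilinear_simps riesz_diff apply_riesz_self U_def)
  qed
  moreover have "u r2 \<le> U * b" using norm_blinfun[of u r2] by (simp add: U_def b_def)
  moreover have "\<rho> * v (riesz u) \<le> \<rho> * (d * U)"
    using norm_blinfun[of v "riesz u"] \<rho> by (intro mult_left_mono) (auto simp: U_def d_def)
  ultimately have Hh: "H h h \<le> a * norm h + U * b - \<rho> * U\<^sup>2 + \<rho> * (d * U)"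
    by (simp add: algebra_simps)
  have "Q (B h) = Q (\<rho> *\<^sub>R riesz (u - v) - r2)"
    using w(2) by (simp add: blinfun.bilinear_simps algebra_simps)
  then have "norm (Q (B h)) \<le> norm (\<rho> *\<^sub>R riesz (u - v) - r2)" using Q by simp
  also have "\<dots> \<le> \<rho> * norm (u - v) + b"
    using norm_triangle_ineq4[of "\<rho> *\<^sub>R riesz (u - v)" r2] \<rho> by (simp add: b_def)
  also have "\<dots> \<le> \<rho> * (U + d) + b"
    using \<rho> norm_triangle_ineq4[of u v] by (simp add: U_def d_def)
  finally have "(norm (Q (B h)))\<^sup>2 \<le> (\<rho> * U + \<rho> * d + b)\<^sup>2" by (simp add: power_mono algebra_simps)
  also have "\<dots> \<le> 3 * (\<rho> * U)\<^sup>2 + 3 * (\<rho> * d)\<^sup>2 + 3 * b\<^sup>2"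
    using sum_squares_bound[of "\<rho> * U" "\<rho> * d"] sum_squares_bound[of "\<rho> * U" b] sum_squares_bound[of "\<rho> * d" b]
    by (simp add: power2_eq_square algebra_simps)
  finally have "N * (norm (Q (B h)))\<^sup>2 \<le> N * (3 * (\<rho> * U)\<^sup>2 + 3 * (\<rho> * d)\<^sup>2 + 3 * b\<^sup>2)"
    using N by (intro mult_left_mono) auto
  also have "\<dots> = (6 * N * \<rho>) * (\<rho> * U\<^sup>2 / 2 + \<rho> * d\<^sup>2 / 2) + 3 * N * b\<^sup>2"
    by (simp add: power2_eq_square algebra_simps)
  also have "\<dots> \<le> 1 * (\<rho> * U\<^sup>2 / 2 + \<rho> * d\<^sup>2 / 2) + 3 * N * b\<^sup>2"
    using \<rho> by (intro add_right_mono mult_right_mono) auto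
  finally have NQ: "N * (norm (Q (B h)))\<^sup>2 \<le> \<rho> * U\<^sup>2 / 2 + \<rho> * d\<^sup>2 / 2 + 3 * N * b\<^sup>2" by simp
  have y1: "a * norm h \<le> \<gamma> * (norm h)\<^sup>2 + a\<^sup>2 / (4 * \<gamma>)"
  proof -
    have "0 \<le> (\<gamma> * norm h - a / 2)\<^sup>2 / \<gamma>" using \<gamma> by simp
    also have "\<dots> = \<gamma> * (norm h)\<^sup>2 + a\<^sup>2 / (4 * \<gamma>) - a * norm h"
      using \<gamma> by (simp add: power2_eq_square field_simps)
    finally show ?thesis by simp
  qed
  have y2: "U * b \<le> \<rho> * U\<^sup>2 / 8 + 2 * b\<^sup>2 / \<rho>"
  proof -
    have "0 \<le> (\<rho> * U / 4 - b)\<^sup>2 * (2 / \<rho>)" using \<rho> by simp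
    also have "\<dots> = \<rho> * U\<^sup>2 / 8 + 2 * b\<^sup>2 / \<rho> - U * b" using \<rho> by (simp add: power2_eq_square field_simps)
    finally show ?thesis by simp
  qed
  have y3: "\<rho> * (d * U) \<le> \<rho> * U\<^sup>2 / 8 + 2 * \<rho> * d\<^sup>2"
  proof -
    have "0 \<le> \<rho> * ((U / 4 - d)\<^sup>2 * 2)" using \<rho> by simp
    also have "\<dots> = \<rho> * U\<^sup>2 / 8 + 2 * \<rho> * d\<^sup>2 - \<rho> * (d * U)" by (simp add: power2_eq_square field_simps)
    finally show ?thesis by simp
  qed
  have "\<rho> * U\<^sup>2 / 4 \<le> a\<^sup>2 / (4 * \<gamma>) + 2 * b\<^sup>2 / \<rho> + 5 / 2 * (\<rho> * d\<^sup>2) + 3 * N * b\<^sup>2"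
    using coercive Hh NQ y1 y2 y3 by linarith
  then have "(4 * \<rho>) * (\<rho> * U\<^sup>2 / 4) \<le> (4 * \<rho>) * (a\<^sup>2 / (4 * \<gamma>) + 2 * b\<^sup>2 / \<rho> + 5 / 2 * (\<rho> * d\<^sup>2) + 3 * N * b\<^sup>2)"
    using \<rho> by (intro mult_left_mono) auto
  moreover have "(4 * \<rho>) * (\<rho> * U\<^sup>2 / 4) = (\<rho> * U)\<^sup>2" by (simp add: power2_eq_square)
  moreover have "(4 * \<rho>) * (a\<^sup>2 / (4 * \<gamma>) + 2 * b\<^sup>2 / \<rho> + 5 / 2 * (\<rho> * d\<^sup>2) + 3 * N * b\<^sup>2) =
      \<rho> * (a\<^sup>2 / \<gamma>) + 8 * b\<^sup>2 + 10 * (\<rho> * d)\<^sup>2 + 2 * (6 * N * \<rho>) * b\<^sup>2"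
    using \<rho>(1) \<gamma> by (simp add: power2_eq_square field_simps)
  ultimately have "(\<rho> * U)\<^sup>2 \<le> \<rho> * (a\<^sup>2 / \<gamma>) + 8 * b\<^sup>2 + 10 * (\<rho> * d)\<^sup>2 + 2 * (6 * N * \<rho>) * b\<^sup>2"
    by simp
  also have "\<dots> \<le> 1 * (a\<^sup>2 / \<gamma>) + 8 * b\<^sup>2 + 10 * (\<rho> * d)\<^sup>2 + 2 * 1 * b\<^sup>2"
    using \<rho> \<gamma> by (intro add_mono mult_right_mono mult_left_mono) auto
  also have "\<dots> \<le> (10 + 1 / \<gamma>) * (a\<^sup>2 + b\<^sup>2 + (\<rho> * d)\<^sup>2)"
    using \<gamma> by (simp add: field_simps)
  also have "\<dots> \<le> (10 + 1 / \<gamma>) * (a + b + \<rho> * d)\<^sup>2"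
    using nn \<rho> \<gamma> by (intro mult_left_mono) (auto simp: power2_eq_square algebra_simps)
  \<comment> \<open>The factor is at least one, so it may be squared before the root is taken.\<close>
  also have "\<dots> \<le> (10 + 1 / \<gamma>)\<^sup>2 * (a + b + \<rho> * d)\<^sup>2"
    using \<gamma> by (intro mult_right_mono self_le_power) auto
  also have "\<dots> = ((10 + 1 / \<gamma>) * (a + b + \<rho> * d))\<^sup>2" by (simp add: power_mult_distrib)
  finally have "\<rho> * U \<le> (10 + 1 / \<gamma>) * (a + b + \<rho> * d)"
  proof (rule power2_le_imp_le)
    have "\<rho> * d \<ge> 0" "10 + 1 / \<gamma> \<ge> 0" using nn \<rho> \<gamma> by (auto intro: add_nonneg_nonneg)
    then show "0 \<le> (10 + 1 / \<gamma>) * (a + b + \<rho> * d)" using nn mult_nonneg_nonneg add_nonneg_nonneg by metis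
  qed
  then show ?thesis by (simp add: U_def a_def b_def d_def)
qed

text \<open>The same test for a system without regularization. The term \<open>v r2\<close> is now bounded through the error bound
  for \<open>v\<close> and the equation, which express \<open>norm v\<close> by \<open>norm h\<close> and the residuals; so every term on the
  right contains a residual as a factor, and the estimate for \<open>h\<close> is linear in the residuals.\<close>

lemma kkt_stability_estimate:
  fixes H :: "'x::real_normed_vector \<Rightarrow>\<^sub>L 'x \<Rightarrow>\<^sub>L real" and A :: "'x \<Rightarrow>\<^sub>L 'y::real_normed_vector"
    and Q :: "'y \<Rightarrow>\<^sub>L 'y" and v :: "'y \<Rightarrow>\<^sub>L real"
  assumes \<gamma>: "\<gamma> > 0" and N: "N \<ge> 0" and c: "c \<ge> 0" and H: "norm H \<le> \<eta>"
    and Q: "\<And>z. norm (Q z) \<le> norm z"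
    and coercive: "\<gamma> * (norm h)\<^sup>2 \<le> H h h + N * (norm (Q (A h)))\<^sup>2"
    and eq: "(v o\<^sub>L A) + H h = r1" and v: "norm v \<le> c * norm (v o\<^sub>L A)"
    and w: "v (A h + r2) \<ge> 0" "Q (A h + r2) = 0"
  defines "D \<equiv> (1 + c * \<eta> + c + N) / \<gamma> + 1"
  shows "norm h + norm v \<le> (D + c * (1 + \<eta> * D)) * (norm r1 + norm r2)"
proof -
  define t where "t = norm r1 + norm r2"
  have \<eta>: "\<eta> \<ge> 0" using H norm_ge_zero order_trans by blast
  have t: "norm r1 \<le> t" "norm r2 \<le> t" "t \<ge> 0" by (auto simp: t_def)
  have D: "D \<ge> 1" using c N \<gamma> \<eta> by (simp add: D_def)
  have "v o\<^sub>L A = r1 - H h" using eq by (simp add: algebra_simps)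
  then have "norm (v o\<^sub>L A) \<le> norm r1 + norm (H h)" using norm_triangle_ineq4 by simp
  also have "norm (H h) \<le> norm H * norm h" by (rule norm_blinfun)
  also have "\<dots> \<le> \<eta> * norm h" by (intro mult_right_mono H) simp
  finally have "norm (v o\<^sub>L A) \<le> t + \<eta> * norm h" using t by linarith
  then have v': "norm v \<le> c * (t + \<eta> * norm h)" using v mult_left_mono[OF _ c] order_trans by blast
  have "v (A h) + H h h = r1 h" using eq by (metis blinfun.add_left blinfun_apply_blinfun_compose)
  moreover have "r1 h \<le> norm r1 * norm h" using norm_blinfun[of r1 h] by simp
  moreover have "norm r1 * norm h \<le> t * norm h" by (intro mult_right_mono t) simp
  moreover have "v (A h) + v r2 \<ge> 0" using w by (simp add: blinfun.bilinear_simps)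
  moreover have "v r2 \<le> norm v * norm r2" using norm_blinfun[of v r2] by simp
  moreover have "norm v * norm r2 \<le> (c * (t + \<eta> * norm h)) * t"
    using v' t c \<eta> by (intro mult_mono) auto
  ultimately have Hh: "H h h \<le> t * norm h + (c * (t + \<eta> * norm h)) * t" by linarith
  have "Q (A h) = - Q r2" using w(2) by (simp add: blinfun.bilinear_simps eq_neg_iff_add_eq_0)
  then have "norm (Q (A h)) \<le> t" using Q[of r2] t by simp
  then have "N * (norm (Q (A h)))\<^sup>2 \<le> N * t\<^sup>2" using N by (intro mult_left_mono power_mono) auto
  with coercive Hh have main: "\<gamma> * (norm h)\<^sup>2 \<le> (1 + c * \<eta>) * t * norm h + (c + N) * t\<^sup>2"
    by (simp add: power2_eq_square algebra_simps)
  have h: "norm h \<le> D * t"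
  proof (cases "norm h \<le> t")
    case True
    then show ?thesis using mult_right_mono[OF D t(3)] by simp
  next
    case False
    then have "(c + N) * t\<^sup>2 \<le> (c + N) * (t * norm h)"
      using c N t unfolding power2_eq_square by (intro mult_left_mono) auto
    with main have "\<gamma> * (norm h * norm h) \<le> ((1 + c * \<eta> + c + N) * t) * norm h"
      by (simp add: power2_eq_square algebra_simps)
    moreover have "norm h > 0" using False t by linarith
    ultimately have "\<gamma> * norm h \<le> (1 + c * \<eta> + c + N) * t" by simp
    then have "norm h \<le> (1 + c * \<eta> + c + N) / \<gamma> * t" using \<gamma> by (simp add: field_simps)
    also have "\<dots> \<le> D * t" using t by (simp add: D_def distrib_right)
    finally show ?thesis .
  qed
  have "\<eta> * norm h \<le> \<eta> * (D * t)" by (intro mult_left_mono h \<eta>)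
  then have "c * (t + \<eta> * norm h) \<le> c * (t + \<eta> * (D * t))" by (intro mult_left_mono c) simp
  then have "norm v \<le> c * (1 + \<eta> * D) * t" using v' by (simp add: algebra_simps)
  then show ?thesis using h unfolding t_def[symmetric] by (simp add: algebra_simps)
qed

section \<open>Local convergence\<close>

text \<open>As \<open>0\<close> lies in every span, the second-order condition on the preimage of the span covers the kernel of the
  constraint derivative.\<close>

locale coercive_kkt_point =
  fixes f :: "'x::{real_inner,complete_space} \<Rightarrow> real"
    and G :: "'x \<Rightarrow> 'y::{real_inner,complete_space}"
    and K :: "'y set" and ys :: "'i \<Rightarrow> 'y" and I :: "'i set"
    and xs :: 'x and ls :: "'y \<Rightarrow>\<^sub>L real" and \<alpha> :: real
  assumes I: "finite I"
    and K: "K = {\<Sum>i\<in>I. \<mu> i *\<^sub>R ys i | \<mu>. \<forall>i\<in>I. 0 \<le> \<mu> i}"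
    and f_smooth: "twice_lipschitz_differentiable f"
    and G_smooth: "twice_lipschitz_differentiable G"
    and cl_range: "closed (range (fderiv G xs))"
    and G_xs: "G xs = 0"
    and ls: "ls \<in> multipliers f G K xs"
    and \<alpha>: "\<alpha> > 0"
    and coercive: "\<And>d. fderiv G xs d \<in> span (ys ` I) \<Longrightarrow>
        \<alpha> * (norm d)\<^sup>2 \<le> lagrangian_xx f G xs ls d d"
begin

abbreviation "A \<equiv> fderiv G xs"
abbreviation "H0 \<equiv> lagrangian_xx f G xs ls"
abbreviation "nearest_multiplier l \<equiv> is_arg_min (\<lambda>\<mu>. norm (l - \<mu>)) (\<lambda>\<mu>. \<mu> \<in> multipliers f G K xs)"

lemma K_eq: "K = finite_cone (ys ` I)"
  unfolding K by (rule finite_cone_of_family[OF I])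

lemma K_closed: "closed K" and K_cone: "convex_cone K"
  using I by (auto simp: K_eq closed_finite_cone convex_cone_finite_cone)

lemma K_span: "k \<in> K \<Longrightarrow> k \<in> span (ys ` I)"
  by (auto simp: K intro: span_sum span_scale span_base)

lemma generator_in_K: "i \<in> I \<Longrightarrow> ys i \<in> K"
  unfolding K using I
  by (intro CollectI exI[of _ "\<lambda>j. if j = i then 1 else 0"]) (simp add: if_distrib if_distribR sum.delta cong: if_cong)

lemma polar_cone_iff: "l \<in> polar_cone K \<longleftrightarrow> (\<forall>i\<in>I. blinfun_apply l (ys i) \<le> 0)"
proof
  assume "l \<in> polar_cone K"
  then show "\<forall>i\<in>I. blinfun_apply l (ys i) \<le> 0" using generator_in_K by (auto simp: polar_cone_def)
next
  assume l: "\<forall>i\<in>I. blinfun_apply l (ys i) \<le> 0"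
  show "l \<in> polar_cone K" unfolding polar_cone_def
  proof safe
    fix k assume "k \<in> K"
    then obtain \<mu> where \<mu>: "k = (\<Sum>i\<in>I. \<mu> i *\<^sub>R ys i)" "\<forall>i\<in>I. 0 \<le> \<mu> i" unfolding K by blast
    then show "blinfun_apply l k \<le> 0"
      using l by (simp add: blinfun.sum_right blinfun.scaleR_right sum_nonpos mult_nonneg_nonpos)
  qed
qed

lemma multipliers_iff: "l \<in> multipliers f G K xs \<longleftrightarrow> l \<in> polar_cone K \<and> (l - ls) o\<^sub>L A = 0"
proof -
  have "(l - ls) o\<^sub>L A = (l o\<^sub>L A) - (ls o\<^sub>L A)" by (rule blinfun_eqI) (simp add: blinfun.bilinear_simps)
  moreover have "ls o\<^sub>L A = - fderiv f xs" using ls by (simp add: multipliers_def eq_neg_iff_add_eq_0 add.commute)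
  ultimately show ?thesis by (simp add: multipliers_def G_xs add.commute)
qed

lemma nearest_multiplier_exists: "\<exists>m. nearest_multiplier l m"
proof (rule nearest_functional_exists)
  have eq: "multipliers f G K xs = (\<Inter>i\<in>I. {l. blinfun_apply l (ys i) \<le> 0}) \<inter> {l. (l - ls) o\<^sub>L A = 0}"
    by (auto simp: multipliers_iff polar_cone_iff)
  show "closed (multipliers f G K xs)"
    unfolding eq by (intro closed_Int closed_INT ballI closed_Collect_le closed_Collect_eq continuous_intros)
  show "convex (multipliers f G K xs)"
    unfolding convex_def
  proof (intro ballI allI impI)
    fix l m :: "'y \<Rightarrow>\<^sub>L real" and u v :: real
    assume lm: "l \<in> multipliers f G K xs" "m \<in> multipliers f G K xs" and uv: "0 \<le> u" "0 \<le> v" "u + v = 1"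
    have "(u *\<^sub>R l + v *\<^sub>R m) - ls = u *\<^sub>R (l - ls) + v *\<^sub>R (m - ls)"
      using uv(3) by (simp add: algebra_simps flip: scaleR_add_left)
    then have "((u *\<^sub>R l + v *\<^sub>R m) - ls) o\<^sub>L A = u *\<^sub>R ((l - ls) o\<^sub>L A) + v *\<^sub>R ((m - ls) o\<^sub>L A)"
      by (simp add: blinfun_eqI blinfun.bilinear_simps)
    moreover have "u *\<^sub>R l + v *\<^sub>R m \<in> polar_cone K"
      using lm uv by (auto simp: multipliers_iff polar_cone_iff blinfun.bilinear_simps
          intro!: add_nonpos_nonpos mult_nonneg_nonpos)
    ultimately show "u *\<^sub>R l + v *\<^sub>R m \<in> multipliers f G K xs" using lm by (simp add: multipliers_iff)
  qed
  show "multipliers f G K xs \<noteq> {}" using ls by blast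
qed

text \<open>The condition \<open>norm (x - xs) \<le> \<rho>\<close> follows from admissibility of \<open>\<rho>\<close> when \<open>\<sigma>0 \<ge> 1\<close>. The constants are chosen in
  the order in which the estimates consume them: \<open>C0\<close> and \<open>C1\<close> bound the multiplier step through the
  first energy estimate, \<open>E\<close> is the constant of the second one, and \<open>R\<close> is so small that the operators stay
  within the stability radius \<open>\<epsilon>\<close> and that the linearization error proportional to \<open>norm h\<close> can be absorbed.\<close>

lemma one_step:
  shows "\<exists>R>0. \<exists>s>0. \<exists>C>0. \<exists>\<beta>>0. \<forall>x l \<rho>.
    norm (x - xs) + norm (l - ls) < R \<longrightarrow> 0 < \<rho> \<longrightarrow> \<rho> \<le> s \<longrightarrow> norm (x - xs) \<le> \<rho> \<longrightarrow>
    (\<exists>!q. IP_solution f G K \<rho> (x, l, l) q) \<and>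
    (\<forall>x' l'. IP_solution f G K \<rho> (x, l, l) (x', l') \<longrightarrow>
      local_minimizer_of_max (subproblem_fun f G x l \<rho>) (polar_cone K) x' \<and>
      unique_maximizer (subproblem_fun f G x l \<rho> x') (polar_cone K) l' \<and>
      (\<forall>lh lh'. nearest_multiplier l lh \<longrightarrow> nearest_multiplier l' lh' \<longrightarrow>
        norm (l' - l) \<le> C * (norm (x - xs) + norm (l - lh)) \<and>
        norm (x' - xs) + norm (l' - lh') \<le>
          \<beta> * ((norm (x - xs))\<^sup>2 + (norm (l - lh))\<^sup>2 + \<rho> * norm (l - lh))))"
proof -
  obtain Q :: "'y \<Rightarrow>\<^sub>L 'y" where Q1: "\<And>z. z - Q z \<in> span (ys ` I)"
    and Q2: "\<And>z s. s \<in> span (ys ` I) \<Longrightarrow> inner (Q z) s = 0"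
    using orthogonal_projection_exists[OF closed_span_finite[of "ys ` I"] subspace_span] I by blast
  have orth: "\<forall>s\<in>span (ys ` I). inner (Q z) s = 0" for z using Q2 by blast
  note Q_zero = complement_projection_zero[OF subspace_span Q1 orth]
    and Q_inner = inner_complement_projection[OF subspace_span Q1 orth]
    and Q_le = norm_complement_projection_le[OF subspace_span Q1 orth]
  have ker: "\<forall>d. Q (A d) = 0 \<longrightarrow> \<alpha> * (norm d)\<^sup>2 \<le> H0 d d"
  proof (intro allI impI)
    fix d assume "Q (A d) = 0"
    then show "\<alpha> * (norm d)\<^sup>2 \<le> H0 d d" using coercive[of d] Q1[of "A d"] by simp
  qed
  have clQA: "closed (range (Q o\<^sub>L A))"
    using closed_range_projected[OF cl_range _ Q1 Q_zero] I by simp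
  obtain \<gamma> N \<epsilon> where pos: "\<gamma> > 0" "N > 0" "\<epsilon> > 0" and pen': "\<forall>B H'. norm (B - A) \<le> \<epsilon> \<longrightarrow> norm (H' - H0) \<le> \<epsilon> \<longrightarrow>
    (\<forall>d. \<gamma> * (norm d)\<^sup>2 \<le> H' d d + N * (norm (Q (B d)))\<^sup>2)"
    using coercive_with_penalty_stable[of Q A \<alpha> H0, OF clQA \<alpha> ker Q_le]
    by (elim exE conjE) (rule that)
  note pen = pen'[rule_format]
  have "\<forall>i\<in>I. ls (ys i) \<le> 0" using ls by (auto simp: multipliers_iff polar_cone_iff)
  from multiplier_error_bound[OF cl_range I this] obtain c where c: "c \<ge> 0"
    and eb: "\<forall>l :: 'y \<Rightarrow>\<^sub>L real. (\<forall>i\<in>I. blinfun_apply l (ys i) \<le> 0) \<longrightarrow>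
      (\<exists>m :: 'y \<Rightarrow>\<^sub>L real. (\<forall>i\<in>I. blinfun_apply m (ys i) \<le> 0) \<and> (m - ls) o\<^sub>L A = 0 \<and>
        norm (l - m) \<le> c * norm ((l - ls) o\<^sub>L A))"
    by (elim exE conjE) (rule that)
  obtain R0 C where R0: "R0 > 0" and C: "C > 0" and est: "\<forall>x l. norm (x - xs) < R0 \<longrightarrow> norm (l - ls) < R0 \<longrightarrow>
    norm (fderiv G x - A) \<le> C * norm (x - xs) \<and>
    norm (lagrangian_xx f G x l - H0) \<le> C * (norm (x - xs) + norm (l - ls)) \<and>
    norm (G xs - G x - fderiv G x (xs - x)) \<le> C * (norm (x - xs))\<^sup>2 \<and>
    norm (lagrangian_x f G xs l - lagrangian_x f G x l - lagrangian_xx f G x l (xs - x)) \<le> C * (norm (x - xs))\<^sup>2"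
    using lagrangian_local_estimates[OF f_smooth G_smooth, of xs ls] by (elim exE conjE) (rule that)
  define \<eta> where "\<eta> = norm H0 + \<epsilon>"
  define D where "D = (1 + c * \<eta> + c + N) / \<gamma> + 1"
  define E where "E = D + c * (1 + \<eta> * D)"
  define CA where "CA = 10 + 1 / \<gamma>"
  define C0 where "C0 = CA * (2 * C + 1)"
  define C1 where "C1 = C0 + 1"
  define \<beta> where "\<beta> = 2 * E * (2 * C + 2 * C * C1 + C1)"
  define R where "R = min R0 (min (\<epsilon> / C) (1 / (2 * E * C)))"
  define s where "s = min 1 (1 / (6 * N))"
  have \<eta>: "\<eta> > 0" using pos by (simp add: \<eta>_def add_nonneg_pos)
  have D1: "D \<ge> 1" using c pos \<eta> by (simp add: D_def)
  have "0 \<le> c * (1 + \<eta> * D)" using D1 c \<eta> by (intro mult_nonneg_nonneg add_nonneg_nonneg) auto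
  then have E: "E \<ge> 1" using D1 by (simp add: E_def)
  have CA: "CA > 0" using pos by (simp add: CA_def add_pos_pos)
  have C0: "C0 > 0" using CA C by (simp add: C0_def)
  have C1: "C1 > 1" using C0 by (simp add: C1_def)
  have \<beta>: "\<beta> > 0" using E C C1 by (simp add: \<beta>_def add_pos_pos)
  have R: "R > 0" using R0 pos C E by (simp add: R_def)
  have s: "s > 0" using pos by (simp add: s_def)
  show ?thesis
  proof (rule exI[of _ R], intro conjI R, rule exI[of _ s], intro conjI s, rule exI[of _ C1], intro conjI,
      use C1 in simp, rule exI[of _ \<beta>], intro conjI \<beta> allI impI)
    fix x l \<rho> assume near: "norm (x - xs) + norm (l - ls) < R" and \<rho>: "0 < \<rho>" "\<rho> \<le> s" and e\<rho>: "norm (x - xs) \<le> \<rho>"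
    define e where "e = norm (x - xs)"
    define B where "B = fderiv G x"
    define H where "H = lagrangian_xx f G x l"
    have e0: "e \<ge> 0" "e \<le> \<rho>" using e\<rho> by (auto simp: e_def)
    have nR: "e < R" "norm (l - ls) < R" "e + norm (l - ls) < R" using near norm_ge_zero[of "x - xs"] norm_ge_zero[of "l - ls"] unfolding e_def by linarith+
    then have estx: "norm (B - A) \<le> C * e" "norm (H - H0) \<le> C * (e + norm (l - ls))"
      "norm (G x + B (xs - x)) \<le> C * e\<^sup>2"
      "norm (lagrangian_x f G xs l - lagrangian_x f G x l - H (xs - x)) \<le> C * e\<^sup>2"
    proof -
      have "norm (- G x - B (xs - x)) = norm (G x + B (xs - x))"
        by (metis minus_add_distrib norm_minus_cancel uminus_add_conv_diff add.commute)
      then show "norm (B - A) \<le> C * e" "norm (H - H0) \<le> C * (e + norm (l - ls))"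
        "norm (G x + B (xs - x)) \<le> C * e\<^sup>2"
        "norm (lagrangian_x f G xs l - lagrangian_x f G x l - H (xs - x)) \<le> C * e\<^sup>2"
        using est[rule_format, of x l] nR by (auto simp: B_def H_def e_def R_def G_xs)
    qed
    have CR: "C * t \<le> \<epsilon>" "E * (C * t) \<le> 1 / 2" if "t \<le> R" for t
    proof -
      have "t \<le> \<epsilon> / C" "t \<le> 1 / (2 * E * C)" using that by (auto simp: R_def)
      then show "C * t \<le> \<epsilon>" "E * (C * t) \<le> 1 / 2" using C E by (simp_all add: field_simps)
    qed
    have BA: "norm (B - A) \<le> \<epsilon>" and HH: "norm (H - H0) \<le> \<epsilon>"
      using estx CR(1)[of e] CR(1)[of "e + norm (l - ls)"] nR by linarith+
    have HB: "\<gamma> * (norm d)\<^sup>2 \<le> H d d + N * (norm (Q (B d)))\<^sup>2" for d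
      by (rule pen[OF BA HH])
    have HA: "\<gamma> * (norm d)\<^sup>2 \<le> H d d + N * (norm (Q (A d)))\<^sup>2" for d
      by (rule pen[OF _ HH]) (use pos in simp)
    have H\<eta>: "norm H \<le> \<eta>" using HH norm_triangle_sub[of H H0] by (simp add: \<eta>_def)
    have \<rho>1: "\<rho> \<le> 1" "6 * N * \<rho> \<le> 1"
    proof -
      have "\<rho> \<le> 1 / (6 * N)" using \<rho> by (simp add: s_def)
      then show "6 * N * \<rho> \<le> 1" using pos by (simp add: field_simps)
    qed (use \<rho> in \<open>simp add: s_def\<close>)
    interpret sub: stabilized_subproblem K Q B H "fderiv f x" "G x" l \<rho> \<gamma>
    proof
      show "closed K" "convex_cone K" by (rule K_closed, rule K_cone)
      show "Q k = 0" "inner (Q z) k = 0" if "k \<in> K" for z k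
        using Q_zero Q2 K_span[OF that] by auto
      show "inner (Q z) z = (norm (Q z))\<^sup>2" "norm (Q z) \<le> norm z" for z
        by (rule Q_inner, rule Q_le)
      show "\<rho> > 0" "\<gamma> > 0" using \<rho> pos by auto
      fix d
      have "N \<le> 1 / \<rho>" using \<rho>1 \<rho>(1) pos by (simp add: field_simps)
      from mult_right_mono[OF this, of "(norm (Q (B d)))\<^sup>2"]
      have "N * (norm (Q (B d)))\<^sup>2 \<le> (norm (Q (B d)))\<^sup>2 / \<rho>" by simp
      then show "\<gamma> * (norm d)\<^sup>2 \<le> H d d + (norm (Q (B d)))\<^sup>2 / \<rho>" using HB[of d] by linarith
    qed
    have IP_iff: "IP_solution f G K \<rho> (x, l, l) (x', l') \<longleftrightarrow> sub.solves (x' - x) l'" for x' l'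
      unfolding sub.solves_def
      by (simp add: IP_solution_def lagrangian_x_eq[OF f_smooth G_smooth] B_def H_def)
    have fun_eq: "subproblem_fun f G x l \<rho> z = sub.L (z - x)" for z
      unfolding sub.L_def[abs_def] by (rule ext) (simp add: subproblem_fun_def B_def H_def)
    have sym: "H u v = H v u" for u v
      unfolding H_def by (rule lagrangian_xx_symmetric[OF f_smooth G_smooth])
    show "\<exists>!q. IP_solution f G K \<rho> (x, l, l) q"
    proof -
      obtain s1 l1 where s1: "sub.solves s1 l1" using sub.solution_exists by blast
      show ?thesis
      proof (rule ex1I[of _ "(x + s1, l1)"])
        show "IP_solution f G K \<rho> (x, l, l) (x + s1, l1)" unfolding IP_iff using s1 by simp
        fix q assume "IP_solution f G K \<rho> (x, l, l) q"
        then have "sub.solves (fst q - x) (snd q)" using IP_iff[of "fst q" "snd q"] by simp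
        from sub.solution_unique[OF this s1] show "q = (x + s1, l1)"
          by (metis prod.collapse diff_add_cancel add.commute)
      qed
    qed
    fix x' l' assume "IP_solution f G K \<rho> (x, l, l) (x', l')"
    then have sol: "sub.solves (x' - x) l'" unfolding IP_iff .
    define w where "w = G x + B (x' - x) - \<rho> *\<^sub>R riesz (l' - l)"
    have l': "l' \<in> polar_cone K" and eq: "fderiv f x + (l' o\<^sub>L B) + H (x' - x) = 0"
      and w: "w \<in> K" "l' w = 0"
      using sol by (auto simp: sub.solves_def w_def annihilator_def)
    show "local_minimizer_of_max (subproblem_fun f G x l \<rho>) (polar_cone K) x'"
      unfolding local_minimizer_of_max_def fun_eq
    proof (intro conjI allI exI[of _ 1] ballI)
      show "\<exists>m. is_arg_max (sub.L (z - x)) (\<lambda>l. l \<in> polar_cone K) m" for z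
        using sub.multiplier_exists[of "z - x"] sub.unique_maximizer_L
        unfolding unique_maximizer_def by blast
      show "(SUP l\<in>polar_cone K. sub.L (x' - x) l) \<le> (SUP l\<in>polar_cone K. sub.L (z - x) l)" for z
        by (rule sub.solution_minimizes_max[OF sol sym])
    qed simp
    show "unique_maximizer (subproblem_fun f G x l \<rho> x') (polar_cone K) l'"
      unfolding fun_eq using sol by (intro sub.unique_maximizer_L) (auto simp: sub.solves_def)
    fix lh lh' assume nlh: "nearest_multiplier l lh" and nlh': "nearest_multiplier l' lh'"
    have lh: "lh \<in> polar_cone K" "(lh - ls) o\<^sub>L A = 0" and lh': "lh' \<in> polar_cone K" "(lh' - ls) o\<^sub>L A = 0"
      using nlh nlh' by (auto simp: is_arg_min_def multipliers_iff)
    define d where "d = norm (l - lh)"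
    define h where "h = x' - xs"
    define q where "q = l' - l"
    define se where "se = lagrangian_x f G xs l - lagrangian_x f G x l - H (xs - x)"
    define r2 where "r2 = G x + B (xs - x)"
    have d0: "d \<ge> 0" by (simp add: d_def)
    have se: "norm se \<le> C * e\<^sup>2" and r2: "norm r2 \<le> C * e\<^sup>2" using estx by (auto simp: se_def r2_def)
    have w_eq: "w = B h + r2 - \<rho> *\<^sub>R riesz q"
      by (simp add: w_def h_def r2_def q_def blinfun.bilinear_simps)
    have Qw: "Q w = 0" using Q_zero K_span[OF w(1)] by blast
    \<comment> \<open>The first line of the inclusion problem, expanded around \<open>xs\<close>. It holds for every multiplier \<open>m\<close>, and
      is used for the one nearest to \<open>l\<close> and for the one nearest to \<open>l'\<close>.\<close>
    have kkt: "(m - ls) o\<^sub>L A = 0 \<Longrightarrow> ((l - m) o\<^sub>L A) + (q o\<^sub>L B) + H h = se" for m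
    proof -
      assume m: "(m - ls) o\<^sub>L A = 0"
      have "fderiv f xs + (ls o\<^sub>L A) = 0" using ls by (simp add: multipliers_def)
      then have "((l - m) o\<^sub>L A) = lagrangian_x f G xs l"
        using m unfolding lagrangian_x_eq[OF f_smooth G_smooth]
        by (simp add: bounded_bilinear.diff_left[OF bounded_bilinear_blinfun_compose] algebra_simps eq_neg_iff_add_eq_0)
      moreover have "lagrangian_x f G x l + (q o\<^sub>L B) + H (x' - x) = 0"
        using eq unfolding lagrangian_x_eq[OF f_smooth G_smooth] q_def B_def
        by (simp add: bounded_bilinear.diff_left[OF bounded_bilinear_blinfun_compose] algebra_simps)
      moreover have "H (x' - x) = H h + H (xs - x)" by (simp add: h_def blinfun.bilinear_simps)
      ultimately show ?thesis unfolding se_def by (simp add: algebra_simps)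
    qed
    have comp: "(l' - m) w \<ge> 0" if "m \<in> polar_cone K" for m
      using that w by (simp add: polar_cone_def blinfun.bilinear_simps)
    \<comment> \<open>First estimate, against the multiplier nearest to \<open>l\<close>, with the derivative \<open>B\<close> at \<open>x\<close>.\<close>
    define u where "u = l' - lh"
    define r1 where "r1 = se + ((l - lh) o\<^sub>L (B - A))"
    have r1: "norm r1 \<le> C * e\<^sup>2 + C * e * d"
    proof -
      have "norm r1 \<le> norm se + norm ((l - lh) o\<^sub>L (B - A))" unfolding r1_def by (rule norm_triangle_ineq)
      also have "norm ((l - lh) o\<^sub>L (B - A)) \<le> norm (l - lh) * norm (B - A)" by (rule norm_blinfun_compose)
      also have "\<dots> \<le> d * (C * e)" unfolding d_def[symmetric] by (intro mult_left_mono estx d0)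
      finally show ?thesis using se by (simp add: mult_ac)
    qed
    have "\<rho> * norm u \<le> CA * (norm r1 + norm r2 + \<rho> * norm (l - lh))"
      unfolding CA_def
    proof (rule a_priori_multiplier_estimate[OF pos(1,2) \<rho>(1) \<rho>1 Q_le HB])
      show "(u o\<^sub>L B) + H h = r1"
      proof (rule blinfun_eqI)
        fix g show "((u o\<^sub>L B) + H h) g = r1 g"
          using arg_cong[OF kkt[OF lh(2)], of "\<lambda>m. blinfun_apply m g"]
          by (simp add: u_def r1_def q_def blinfun.bilinear_simps)
      qed
      have "u - (l - lh) = q" by (simp add: u_def q_def)
      then show "u (B h + r2 - \<rho> *\<^sub>R riesz (u - (l - lh))) \<ge> 0" "Q (B h + r2 - \<rho> *\<^sub>R riesz (u - (l - lh))) = 0"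
        using comp[OF lh(1)] Qw by (simp_all add: w_eq u_def)
    qed
    also have "\<dots> \<le> CA * ((2 * C + 1) * (e\<^sup>2 + \<rho> * d))"
    proof (intro mult_left_mono)
      have "C * (e * d) \<le> C * (\<rho> * d)" using C e0 d0 by (intro mult_left_mono mult_right_mono) auto
      moreover have "0 \<le> C * (\<rho> * d)" "0 \<le> e\<^sup>2" using C \<rho> d0 by auto
      ultimately have ineqs: "C * (e * d) \<le> C * (\<rho> * d)" "0 \<le> C * (\<rho> * d)" "0 \<le> e\<^sup>2" by blast+
      show "norm r1 + norm r2 + \<rho> * norm (l - lh) \<le> (2 * C + 1) * (e\<^sup>2 + \<rho> * d)"
      proof -
        have "(2 * C + 1) * (e\<^sup>2 + \<rho> * d) = 2 * (C * e\<^sup>2) + e\<^sup>2 + 2 * (C * (\<rho> * d)) + \<rho> * d"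
          by (simp add: algebra_simps)
        moreover have "norm r1 \<le> C * e\<^sup>2 + C * (e * d)" using r1 by (simp only: mult.assoc)
        ultimately show ?thesis using ineqs r2 unfolding d_def[symmetric] by linarith
      qed
    qed (use CA in simp)
    finally have \<rho>u: "\<rho> * norm u \<le> C0 * (e\<^sup>2 + \<rho> * d)" by (simp add: C0_def mult.assoc)
    also have "\<dots> \<le> C0 * (\<rho> * (e + d))"
      using C0 e0 by (intro mult_left_mono) (auto simp: power2_eq_square algebra_simps mult_right_mono)
    finally have "\<rho> * norm u \<le> \<rho> * (C0 * (e + d))" by (simp add: mult_ac)
    then have u: "norm u \<le> C0 * (e + d)" using \<rho>(1) by simp
    have qu: "norm q \<le> norm u + d"
      using norm_triangle_ineq4[of u "l - lh"] by (simp add: u_def q_def d_def)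
    then have q: "norm q \<le> C1 * (e + d)" using u e0 by (simp add: C1_def algebra_simps)
    then show "norm (l' - l) \<le> C1 * (norm (x - xs) + norm (l - lh))" by (simp add: q_def e_def d_def)
    have "\<rho> * norm q \<le> \<rho> * norm u + \<rho> * d" using mult_left_mono[OF qu, of \<rho>] \<rho> by (simp add: algebra_simps)
    also have "\<dots> \<le> C0 * (e\<^sup>2 + \<rho> * d) + (e\<^sup>2 + \<rho> * d)" by (intro add_mono \<rho>u) simp
    also have "\<dots> = C1 * (e\<^sup>2 + \<rho> * d)" by (simp add: C1_def algebra_simps)
    finally have \<rho>q: "\<rho> * norm q \<le> C1 * (e\<^sup>2 + \<rho> * d)" .
    \<comment> \<open>Second estimate, against the multiplier nearest to \<open>l'\<close>, with the derivative \<open>A\<close> at \<open>xs\<close>; the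
      regularization and the change of derivative become residuals.\<close>
    define v where "v = l' - lh'"
    define r3 where "r3 = se - (q o\<^sub>L (B - A))"
    define r4 where "r4 = r2 + (B - A) h - \<rho> *\<^sub>R riesz q"
    have r3: "norm r3 \<le> C * e\<^sup>2 + C * e * (C1 * (e + d))"
    proof -
      have "norm r3 \<le> norm se + norm (q o\<^sub>L (B - A))" unfolding r3_def by (rule norm_triangle_ineq4)
      also have "norm (q o\<^sub>L (B - A)) \<le> norm q * norm (B - A)" by (rule norm_blinfun_compose)
      also have "\<dots> \<le> (C1 * (e + d)) * (C * e)"
        using C1 e0 d0 by (intro mult_mono q estx) auto
      finally show ?thesis using se by (simp add: mult_ac)
    qed
    have r4: "norm r4 \<le> C * e\<^sup>2 + C * e * norm h + C1 * (e\<^sup>2 + \<rho> * d)"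
    proof -
      have "norm r4 \<le> norm r2 + norm ((B - A) h) + norm (\<rho> *\<^sub>R riesz q)"
        unfolding r4_def by (intro order_trans[OF norm_triangle_ineq4] add_right_mono norm_triangle_ineq)
      also have "norm ((B - A) h) \<le> norm (B - A) * norm h" by (rule norm_blinfun)
      also have "\<dots> \<le> C * e * norm h" by (intro mult_right_mono estx) simp
      also have "norm (\<rho> *\<^sub>R riesz q) = \<rho> * norm q" using \<rho> by simp
      finally show ?thesis using r2 \<rho>q by linarith
    qed
    have "norm h + norm v \<le> E * (norm r3 + norm r4)"
      unfolding E_def D_def
    proof (rule kkt_stability_estimate[OF pos(1) less_imp_le[OF pos(2)] c H\<eta> Q_le HA])
      show "(v o\<^sub>L A) + H h = r3"
      proof (rule blinfun_eqI)
        fix g show "((v o\<^sub>L A) + H h) g = r3 g"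
          using arg_cong[OF kkt[OF lh'(2)], of "\<lambda>m. blinfun_apply m g"]
          by (simp add: v_def r3_def q_def blinfun.bilinear_simps)
      qed
      have "A h + r4 = w" by (simp add: r4_def w_eq blinfun.bilinear_simps)
      then show "v (A h + r4) \<ge> 0" "Q (A h + r4) = 0" using comp[OF lh'(1)] Qw by (simp_all add: v_def)
      obtain m where m: "\<forall>i\<in>I. blinfun_apply m (ys i) \<le> 0" "(m - ls) o\<^sub>L A = 0" "norm (l' - m) \<le> c * norm ((l' - ls) o\<^sub>L A)"
        using eb[rule_format, of l'] l' unfolding polar_cone_iff by blast
      have "norm v \<le> norm (l' - m)"
        using nlh' m unfolding v_def by (simp add: is_arg_min_linorder multipliers_iff polar_cone_iff)
      moreover have "v o\<^sub>L A = (l' - ls) o\<^sub>L A"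
      proof (rule blinfun_eqI)
        fix g show "(v o\<^sub>L A) g = ((l' - ls) o\<^sub>L A) g"
          using arg_cong[OF lh'(2), of "\<lambda>m. blinfun_apply m g"] by (simp add: v_def blinfun.bilinear_simps)
      qed
      ultimately show "norm v \<le> c * norm (v o\<^sub>L A)" using m(3) by simp
    qed
    also have "\<dots> \<le> E * ((2 * C + 2 * C * C1 + C1) * (e\<^sup>2 + \<rho> * d) + C * e * norm h)"
    proof (intro mult_left_mono)
      have "C * C1 * (e * d) \<le> C * C1 * (\<rho> * d)" using C C1 e0 d0 by (intro mult_left_mono mult_right_mono) auto
      moreover have "0 \<le> C * C1 * e\<^sup>2" "0 \<le> C * C1 * (\<rho> * d)" "0 \<le> C * (\<rho> * d)" using C C1 \<rho> d0 by auto
      ultimately have ineqs: "C * C1 * (e * d) \<le> C * C1 * (\<rho> * d)" "0 \<le> C * C1 * e\<^sup>2"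
        "0 \<le> C * C1 * (\<rho> * d)" "0 \<le> C * (\<rho> * d)" by blast+
      show "norm r3 + norm r4 \<le> (2 * C + 2 * C * C1 + C1) * (e\<^sup>2 + \<rho> * d) + C * e * norm h"
      proof -
        have "(2 * C + 2 * C * C1 + C1) * (e\<^sup>2 + \<rho> * d) = 2 * (C * e\<^sup>2) + 2 * (C * C1 * e\<^sup>2)
            + C1 * (e\<^sup>2 + \<rho> * d) + 2 * (C * (\<rho> * d)) + 2 * (C * C1 * (\<rho> * d))"
          by (simp add: algebra_simps)
        moreover have "C * e * (C1 * (e + d)) = C * C1 * e\<^sup>2 + C * C1 * (e * d)"
          by (simp add: power2_eq_square algebra_simps)
        ultimately show ?thesis using r3 r4 ineqs by linarith
      qed
    qed (use E in simp)
    also have "\<dots> = \<beta> / 2 * (e\<^sup>2 + \<rho> * d) + E * (C * e) * norm h" by (simp add: \<beta>_def algebra_simps)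
    also have "E * (C * e) * norm h \<le> 1 / 2 * norm h"
      using nR by (intro mult_right_mono CR) auto
    finally have "norm h + norm v \<le> \<beta> * (e\<^sup>2 + \<rho> * d) / 2 + norm h / 2" by simp
    then have "norm h + norm v \<le> \<beta> * (e\<^sup>2 + \<rho> * d)" using norm_ge_zero[of v] by linarith
    also have "\<dots> \<le> \<beta> * (e\<^sup>2 + d\<^sup>2 + \<rho> * d)" using \<beta> by (intro mult_left_mono) auto
    finally show "norm (x' - xs) + norm (l' - lh') \<le>
        \<beta> * ((norm (x - xs))\<^sup>2 + (norm (l - lh))\<^sup>2 + \<rho> * norm (l - lh))"
      by (simp add: h_def v_def e_def d_def)
  qed
qed

end

theorem theorem4p1:
  fixes f :: "'x::{real_inner,complete_space} \<Rightarrow> real"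
    and G :: "'x \<Rightarrow> 'y::{real_inner,complete_space}"
    and K :: "'y set" and ys :: "nat \<Rightarrow> 'y" and m :: nat
    and xs :: 'x and ls :: "'y \<Rightarrow>\<^sub>L real" and \<alpha> :: real
  assumes K: "K = {\<Sum>i=1..m. \<mu> i *\<^sub>R ys i | \<mu>. \<forall>i\<in>{1..m}. 0 \<le> \<mu> i}"
    and f_smooth: "twice_lipschitz_differentiable f"
    and G_smooth: "twice_lipschitz_differentiable G"
    and xs: "local_solution f G K xs"
    and G_fredholm: "fredholm (fderiv G xs)"
    and G_xs: "G xs = 0"
    and ls: "ls \<in> multipliers f G K xs"
    and \<alpha>: "\<alpha> > 0"
    and coercive: "\<forall>d \<in> {d. blinfun_apply (fderiv G xs) d = 0}
                      \<union> {d. blinfun_apply (fderiv G xs) d \<in> span (ys ` {1..m})}.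
        blinfun_apply (blinfun_apply (lagrangian_xx f G xs ls) d) d \<ge> \<alpha> * (norm d)\<^sup>2"
  shows "\<exists>\<sigma>bar>0. \<forall>\<sigma>0\<ge>\<sigma>bar. \<exists>\<sigma>1>0. \<exists>\<delta>>0. \<exists>\<beta>>0.
    \<sigma>0 * \<delta> \<le> \<sigma>1 \<and>
    (\<exists>r0>0. \<forall>(x :: nat \<Rightarrow> 'x) (l :: nat \<Rightarrow> 'y \<Rightarrow>\<^sub>L real) (\<rho> :: nat \<Rightarrow> real).
      (x 0, l 0) \<in> sum_ball (xs, ls) r0 \<longrightarrow>
      \<comment> \<open>The iteration is well defined: every finite run stays in the ball (so that admissible
         parameters exist) and each inclusion problem met has exactly one solution.\<close>
      (\<forall>n. (\<forall>k<n. admissible_parameter \<sigma>0 \<sigma>1 xs (x k) (\<rho> k) \<and>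
                   IP_solution f G K (\<rho> k) (x k, l k, l k) (x (Suc k), l (Suc k))) \<longrightarrow>
           (x n, l n) \<in> sum_ball (xs, ls) \<delta> \<and>
           (\<forall>\<rho>'. admissible_parameter \<sigma>0 \<sigma>1 xs (x n) \<rho>' \<longrightarrow>
                  (\<exists>!q. IP_solution f G K \<rho>' (x n, l n, l n) q))) \<and>
      ((\<forall>k. admissible_parameter \<sigma>0 \<sigma>1 xs (x k) (\<rho> k) \<and>
            IP_solution f G K (\<rho> k) (x k, l k, l k) (x (Suc k), l (Suc k))) \<longrightarrow>
        (\<forall>k. (x k, l k) \<in> sum_ball (xs, ls) \<delta>) \<and>
        (\<forall>k. local_minimizer_of_max (subproblem_fun f G (x k) (l k) (\<rho> k)) (polar_cone K)
               (x (Suc k)) \<and>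
             unique_maximizer (subproblem_fun f G (x k) (l k) (\<rho> k) (x (Suc k))) (polar_cone K)
               (l (Suc k))) \<and>
        (\<exists>lh. (\<forall>k. is_arg_min (\<lambda>\<mu>. norm (l k - \<mu>)) (\<lambda>\<mu>. \<mu> \<in> multipliers f G K xs) (lh k)) \<and>
              (\<forall>k. norm (x (Suc k) - xs) + norm (l (Suc k) - lh (Suc k))
                   \<le> \<beta> * ((norm (x k - xs))\<^sup>2 + (norm (l k - lh k))\<^sup>2
                            + \<rho> k * norm (l k - lh k))))))"
proof -
  interpret coercive_kkt_point f G K ys "{1..m}" xs ls \<alpha>
    using K f_smooth G_smooth G_fredholm G_xs ls \<alpha> coercive
    by unfold_locales (auto simp: fredholm_def)
  obtain R s C \<beta> where pos: "R > 0" "s > 0" "C > 0" "\<beta> > 0" and step: "\<forall>x l \<rho>.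
    norm (x - xs) + norm (l - ls) < R \<longrightarrow> 0 < \<rho> \<longrightarrow> \<rho> \<le> s \<longrightarrow> norm (x - xs) \<le> \<rho> \<longrightarrow>
    (\<exists>!q. IP_solution f G K \<rho> (x, l, l) q) \<and>
    (\<forall>x' l'. IP_solution f G K \<rho> (x, l, l) (x', l') \<longrightarrow>
      local_minimizer_of_max (subproblem_fun f G x l \<rho>) (polar_cone K) x' \<and>
      unique_maximizer (subproblem_fun f G x l \<rho> x') (polar_cone K) l' \<and>
      (\<forall>lh lh'. nearest_multiplier l lh \<longrightarrow> nearest_multiplier l' lh' \<longrightarrow>
        norm (l' - l) \<le> C * (norm (x - xs) + norm (l - lh)) \<and>
        norm (x' - xs) + norm (l' - lh') \<le>
          \<beta> * ((norm (x - xs))\<^sup>2 + (norm (l - lh))\<^sup>2 + \<rho> * norm (l - lh))))"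
    using one_step by (elim exE conjE) (rule that)
  obtain P where P: "\<And>l. nearest_multiplier l (P l)"
    using nearest_multiplier_exists by metis
  have well_posed: "\<exists>!q. IP_solution f G K \<rho> (x, l, l) q"
    if "norm (x - xs) + norm (l - ls) < R" "0 < \<rho>" "\<rho> \<le> s" "norm (x - xs) \<le> \<rho>" for x l \<rho>
    using step[THEN spec[of _ x], THEN spec[of _ l], THEN spec[of _ \<rho>]] that by (elim impE) simp_all
  have props: "local_minimizer_of_max (subproblem_fun f G x l \<rho>) (polar_cone K) x' \<and>
      unique_maximizer (subproblem_fun f G x l \<rho> x') (polar_cone K) l' \<and>
      norm (l' - l) \<le> C * (norm (x - xs) + norm (l - P l)) \<and>
      norm (x' - xs) + norm (l' - P l') \<le>
          \<beta> * ((norm (x - xs))\<^sup>2 + (norm (l - P l))\<^sup>2 + \<rho> * norm (l - P l))"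
    if hyp: "norm (x - xs) + norm (l - ls) < R" "0 < \<rho>" "\<rho> \<le> s" "norm (x - xs) \<le> \<rho>"
      and sol: "IP_solution f G K \<rho> (x, l, l) (x', l')" for x l \<rho> x' l'
  proof -
    have "\<forall>x' l'. IP_solution f G K \<rho> (x, l, l) (x', l') \<longrightarrow>
      local_minimizer_of_max (subproblem_fun f G x l \<rho>) (polar_cone K) x' \<and>
      unique_maximizer (subproblem_fun f G x l \<rho> x') (polar_cone K) l' \<and>
      (\<forall>lh lh'. nearest_multiplier l lh \<longrightarrow> nearest_multiplier l' lh' \<longrightarrow>
        norm (l' - l) \<le> C * (norm (x - xs) + norm (l - lh)) \<and>
        norm (x' - xs) + norm (l' - lh') \<le>
          \<beta> * ((norm (x - xs))\<^sup>2 + (norm (l - lh))\<^sup>2 + \<rho> * norm (l - lh)))"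
      using step[THEN spec[of _ x], THEN spec[of _ l], THEN spec[of _ \<rho>]] hyp by (elim impE) simp_all
    from this[THEN spec[of _ x'], THEN spec[of _ l'], THEN mp, OF sol] P[of l] P[of l']
    show ?thesis by blast
  qed
  have P_le: "norm (l - P l) \<le> norm (l - ls)" for l
    using P[of l] ls by (simp add: is_arg_min_linorder)
  \<comment> \<open>The potential \<open>\<Phi>\<close> does not increase: a step moves the multiplier by at most \<open>C * T\<close>, and this does
    not exceed what halving \<open>T\<close> with weight \<open>D\<close> releases.\<close>
  define D where "D = 2 * C + 1"
  define T where "T x l = norm (x - xs) + norm (l - P l)" for x l
  define \<Phi> where "\<Phi> x l = norm (l - ls) + D * T x l" for x l
  have D: "D \<ge> 1" using pos by (simp add: D_def)
  have T0: "T x l \<ge> 0" for x l by (simp add: T_def)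
  have \<Phi>_ge: "norm (x - xs) + norm (l - ls) \<le> \<Phi> x l" for x l
  proof -
    have "norm (x - xs) \<le> T x l" by (simp add: T_def)
    also have "\<dots> \<le> D * T x l" using mult_right_mono[OF D T0[of x l]] by simp
    finally show ?thesis by (simp add: \<Phi>_def)
  qed
  have \<Phi>_le: "\<Phi> x l \<le> (1 + D) * (norm (x - xs) + norm (l - ls))" for x l
  proof -
    define S where "S = norm (x - xs) + norm (l - ls)"
    have "D * T x l \<le> D * S"
      using D P_le[of l] by (intro mult_left_mono) (auto simp: T_def S_def)
    moreover have "norm (l - ls) \<le> S" by (simp add: S_def)
    ultimately show ?thesis unfolding \<Phi>_def S_def[symmetric] by (simp add: algebra_simps)
  qed
  let "\<exists>\<sigma>bar>0. \<forall>\<sigma>0\<ge>\<sigma>bar. \<exists>\<sigma>1>0. ?P \<sigma>0 \<sigma>1" = ?thesis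
  have "\<exists>\<sigma>1>0. ?P \<sigma>0 \<sigma>1" if \<sigma>0: "\<sigma>0 \<ge> 1" for \<sigma>0 :: real
  proof -
    \<comment> \<open>With \<open>\<beta> * \<sigma>1\<close> and \<open>\<beta> * \<delta>\<close> at most \<open>1 / 4\<close>, the estimate for one step halves \<open>T\<close>.\<close>
    define \<sigma>1 where "\<sigma>1 = min s (1 / (4 * \<beta>))"
    define \<delta> where "\<delta> = min R (min (\<sigma>1 / \<sigma>0) (1 / (4 * \<beta>)))"
    define r0 where "r0 = \<delta> / (1 + D)"
    have \<sigma>1: "\<sigma>1 > 0" "\<sigma>1 \<le> s" "\<beta> * \<sigma>1 \<le> 1 / 4"
    proof -
      have "\<sigma>1 \<le> 1 / (4 * \<beta>)" by (simp add: \<sigma>1_def)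
      then show "\<beta> * \<sigma>1 \<le> 1 / 4" using pos by (simp add: field_simps)
    qed (use pos in \<open>auto simp: \<sigma>1_def\<close>)
    have \<delta>: "\<delta> > 0" "\<delta> \<le> R" "\<beta> * \<delta> \<le> 1 / 4" "\<sigma>0 * \<delta> \<le> \<sigma>1"
    proof -
      have "\<delta> \<le> 1 / (4 * \<beta>)" "\<delta> \<le> \<sigma>1 / \<sigma>0" by (auto simp: \<delta>_def)
      then show "\<beta> * \<delta> \<le> 1 / 4" "\<sigma>0 * \<delta> \<le> \<sigma>1" using pos \<sigma>0 by (simp_all add: field_simps)
    qed (use pos \<sigma>0 \<sigma>1 in \<open>auto simp: \<delta>_def\<close>)
    have r0: "r0 > 0" "(1 + D) * r0 = \<delta>" using \<delta> D by (auto simp: r0_def)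
    have adm: "0 < \<rho>" "\<rho> \<le> s" "norm (x - xs) \<le> \<rho>" "\<beta> * \<rho> \<le> 1 / 4"
      if "admissible_parameter \<sigma>0 \<sigma>1 xs x \<rho>" for x \<rho>
    proof -
      have a: "\<rho> > 0" "\<sigma>0 * norm (x - xs) \<le> \<rho>" "\<rho> \<le> \<sigma>1"
        using that by (auto simp: admissible_parameter_def)
      then show "0 < \<rho>" "\<rho> \<le> s" using \<sigma>1 by auto
      show "norm (x - xs) \<le> \<rho>" using a(2) mult_right_mono[OF \<sigma>0, of "norm (x - xs)"] by simp
      show "\<beta> * \<rho> \<le> 1 / 4" using mult_left_mono[OF a(3), of \<beta>] pos \<sigma>1 by linarith
    qed
    have step1: "\<Phi> x' l' \<le> \<Phi> x l"
      if near: "\<Phi> x l < \<delta>" and a: "admissible_parameter \<sigma>0 \<sigma>1 xs x \<rho>"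
        and sol: "IP_solution f G K \<rho> (x, l, l) (x', l')" for x l \<rho> x' l'
    proof -
      define e d where "e = norm (x - xs)" and "d = norm (l - P l)"
      have ed: "e \<ge> 0" "d \<ge> 0" "T x l = e + d" by (auto simp: e_def d_def T_def)
      have n: "e + norm (l - ls) < \<delta>" using \<Phi>_ge[of x l] near by (simp add: e_def)
      then have le\<delta>: "e \<le> \<delta>" "d \<le> \<delta>" using P_le[of l] ed(1) norm_ge_zero[of "l - ls"] unfolding d_def by linarith+
      have "norm (l' - l) \<le> C * (e + d) \<and> norm (x' - xs) + norm (l' - P l') \<le> \<beta> * (e\<^sup>2 + d\<^sup>2 + \<rho> * d)"
        using props[OF _ adm(1-3)[OF a] sol] n \<delta>(2) unfolding e_def d_def by linarith
      then have move: "norm (l' - l) \<le> C * T x l"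
        and contract: "T x' l' \<le> \<beta> * (e\<^sup>2 + d\<^sup>2 + \<rho> * d)"
        unfolding ed(3) unfolding T_def by blast+
      have \<beta>le: "\<beta> * e \<le> 1 / 4" "\<beta> * d \<le> 1 / 4"
        using mult_left_mono[OF le\<delta>(1), of \<beta>] mult_left_mono[OF le\<delta>(2), of \<beta>] pos(4) \<delta>(3) by linarith+
      have "T x' l' \<le> \<beta> * (e\<^sup>2 + d\<^sup>2 + \<rho> * d)" by (rule contract)
      also have "\<dots> = (\<beta> * e) * e + (\<beta> * d) * d + (\<beta> * \<rho>) * d" by (simp add: power2_eq_square algebra_simps)
      also have "\<dots> \<le> (1 / 4) * e + (1 / 4) * d + (1 / 4) * d"
        by (intro add_mono mult_right_mono \<beta>le adm(4)[OF a] ed)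
      also have "\<dots> \<le> T x l / 2" using ed by simp
      finally have "D * T x' l' \<le> D * (T x l / 2)" using D by (intro mult_left_mono) auto
      moreover have "norm (l' - ls) \<le> norm (l' - l) + norm (l - ls)"
        using norm_triangle_ineq[of "l' - l" "l - ls"] by simp
      moreover have "C * T x l + D * (T x l / 2) \<le> D * T x l"
        using T0[of x l] by (simp add: D_def algebra_simps)
      ultimately show ?thesis using move unfolding \<Phi>_def by linarith
    qed
    show ?thesis
    proof (rule exI[of _ \<sigma>1], intro conjI \<sigma>1(1), rule exI[of _ \<delta>], intro conjI \<delta>(1), rule exI[of _ \<beta>],
        intro conjI pos(4) \<delta>(4), rule exI[of _ r0], rule conjI[OF r0(1)], intro allI impI conjI)
      fix x :: "nat \<Rightarrow> 'x" and l :: "nat \<Rightarrow> 'y \<Rightarrow>\<^sub>L real" and \<rho> :: "nat \<Rightarrow> real"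
      assume start: "(x 0, l 0) \<in> sum_ball (xs, ls) r0"
      let ?run = "\<lambda>k. admissible_parameter \<sigma>0 \<sigma>1 xs (x k) (\<rho> k) \<and>
        IP_solution f G K (\<rho> k) (x k, l k, l k) (x (Suc k), l (Suc k))"
      have "\<Phi> (x 0) (l 0) < \<delta>"
      proof -
        have "(1 + D) * (norm (x 0 - xs) + norm (l 0 - ls)) < (1 + D) * r0"
          using start D by (intro mult_strict_left_mono) (auto simp: sum_ball_def)
        then show ?thesis using \<Phi>_le[of "x 0" "l 0"] r0(2) by linarith
      qed
      then have inv: "\<Phi> (x n) (l n) < \<delta>" if "\<forall>k<n. ?run k" for n
        using that
      proof (induction n)
        case (Suc n)
        then have "\<Phi> (x n) (l n) < \<delta>" "?run n" by auto
        then show ?case using step1[of "x n" "l n" "\<rho> n" "x (Suc n)" "l (Suc n)"] by linarith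
      qed
      have near: "norm (x n - xs) + norm (l n - ls) < \<delta>" if "\<forall>k<n. ?run k" for n
        using inv[OF that] \<Phi>_ge[of "x n" "l n"] by linarith
      show "(x n, l n) \<in> sum_ball (xs, ls) \<delta>" if "\<forall>k<n. ?run k" for n
        using near[OF that] by (simp add: sum_ball_def)
      show "\<exists>!q. IP_solution f G K \<rho>' (x n, l n, l n) q"
        if "\<forall>k<n. ?run k" "admissible_parameter \<sigma>0 \<sigma>1 xs (x n) \<rho>'" for n \<rho>'
        using near[OF that(1)] \<delta>(2) by (intro well_posed adm(1-3)[OF that(2)]) linarith
      have all: "norm (x k - xs) + norm (l k - ls) < \<delta>" if "\<forall>k. ?run k" for k
        using near[of k] that by blast
      then show "(x k, l k) \<in> sum_ball (xs, ls) \<delta>" if "\<forall>k. ?run k" for k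
        using that by (simp add: sum_ball_def)
      have step_props: "local_minimizer_of_max (subproblem_fun f G (x k) (l k) (\<rho> k)) (polar_cone K) (x (Suc k)) \<and>
          unique_maximizer (subproblem_fun f G (x k) (l k) (\<rho> k) (x (Suc k))) (polar_cone K) (l (Suc k)) \<and>
          norm (x (Suc k) - xs) + norm (l (Suc k) - P (l (Suc k)))
            \<le> \<beta> * ((norm (x k - xs))\<^sup>2 + (norm (l k - P (l k)))\<^sup>2 + \<rho> k * norm (l k - P (l k)))"
        if run: "\<forall>k. ?run k" for k
      proof -
        have "norm (x k - xs) + norm (l k - ls) < R" using all[OF run, of k] \<delta>(2) by linarith
        from props[OF this adm(1-3)] run show ?thesis by blast
      qed
      then show "local_minimizer_of_max (subproblem_fun f G (x k) (l k) (\<rho> k)) (polar_cone K) (x (Suc k))"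
        "unique_maximizer (subproblem_fun f G (x k) (l k) (\<rho> k) (x (Suc k))) (polar_cone K) (l (Suc k))"
        if "\<forall>k. ?run k" for k
        using that by blast+
      show "\<exists>lh. (\<forall>k. nearest_multiplier (l k) (lh k)) \<and>
          (\<forall>k. norm (x (Suc k) - xs) + norm (l (Suc k) - lh (Suc k))
            \<le> \<beta> * ((norm (x k - xs))\<^sup>2 + (norm (l k - lh k))\<^sup>2 + \<rho> k * norm (l k - lh k)))"
        if "\<forall>k. ?run k"
        using P step_props[OF that] by (intro exI[of _ "\<lambda>k. P (l k)"]) simp
    qed
  qed
  then show ?thesis
    by (intro exI[of _ 1] conjI[OF zero_less_one]) blast
qed

end
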